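(* Let $X$ be a smooth compact manifold with corners. The homomorphism $\widehat{CS}:\mathrm{Struct}_{ST}(X)\to\wedge^{odd}(X)/\wedge_{GL}(X)$ is surjective, i.e. $\mathrm{Im}(\widehat{CS})=\wedge^{odd}(X)/\wedge_{GL}(X)$.
   Context: All vector bundles are smooth complex vector bundles, connections are $\mathbb{C}$-linear, forms are complex valued. For a smooth curve $\gamma=(\nabla^t)_{t\in[0,1]}$ of connections on $V\to X$, with $A^t=\frac{d}{dt}\nabla^t\in\wedge^1(X,\mathrm{End}(V))$ and curvatures $R^t$, set $cs(\gamma)=\int_0^1\sum_{j\ge1}\frac{1}{(j-1)!}\left(\frac1{2\pi i}\right)^j\mathrm{tr}\big(A^t\wedge (R^t)^{\wedge (j-1)}\big)dt\in\wedge^{odd}(X)$. Modulo exact forms it depends only on the endpoints; $CS(\nabla^0,\nabla^1)$ denotes the class mod exact forms. Connections on $V$ are equivalent if $CS(\nabla^0,\nabla^1)=0$. A structured bundle is a pair $\mathcal V=[V,\{\nabla\}]$ with $\{\nabla\}$ an equivalence class of connections on $V$; isomorphisms are bundle isomorphisms over $\mathrm{id}_X$ carrying one equivalence class to the other; $\mathrm{Struct}(X)$ is the semigroup under $\oplus$ of isomorphism classes. $\mathrm{Struct}_{ST}(X)\subseteq \mathrm{Struct}(X)$ consists of those $[V,\{\nabla\}]$ with $V$ stably trivial. A connection is called flat if it has trivial holonomy around every closed path, so the bundle with connection is isomorphic to a product bundle with the product connection. Let $GL=\bigcup_n GL(n,\mathbb{C})$ and let $\theta$ be its canonical left-invariant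 Lie algebra valued 1-form ($g^*\theta=g^{-1}dg$). Set $\Theta=\sum_{j\ge1}b_j\,\mathrm{tr}(\theta^{\wedge(2j-1)})$ with $b_j=\frac{1}{(j-1)!}\left(\frac1{2\pi i}\right)^j\int_0^1(t^2-t)^{j-1}dt$. Then $\wedge_{GL}(X)=\{g^*(\Theta)\mid g:X\to GL \text{ smooth}\}+\wedge^{odd}_{exact}(X)$, a subgroup of $\wedge^{odd}(X)$. For $\mathcal V=[V,\{\nabla\}]\in\mathrm{Struct}_{ST}(X)$, choose trivial bundles $F,H$ with $V\oplus F= H$ and flat connections $\nabla^F,\nabla^H$ on them; then $\widehat{CS}(\mathcal V)$ is the class of $CS(\nabla^H,\nabla\oplus\nabla^F)$ in $\wedge^{odd}(X)/\wedge_{GL}(X)$. This is independent of choices and is a homomorphism. *)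

theory Defs
  imports "HOL-Analysis.Analysis" "Jordan_Normal_Form.Gauss_Jordan_Elimination"
begin

unbundle no vec_syntax
hide_const (open) Finite_Cartesian_Product.vec Finite_Cartesian_Product.mat

section \<open>Smooth maps on subsets of normed spaces\<close>

text \<open>Class \<open>C\<^sup>k\<close> on an open set. In finite dimension, asking that every directional derivative
  is again of class \<open>C\<^sup>k\<close> is the usual definition.\<close>

primrec Ck_on :: "nat \<Rightarrow> 'v::real_normed_vector set \<Rightarrow> ('v \<Rightarrow> 'w::real_normed_vector) \<Rightarrow> bool" where
  "Ck_on 0 W f = continuous_on W f"
| "Ck_on (Suc k) W f =
     (\<exists>f'. (\<forall>x\<in>W. (f has_derivative f' x) (at x)) \<and> (\<forall>v. Ck_on k W (\<lambda>x. f' x v)))"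

text \<open>As usual for manifolds with corners, a function on an arbitrary subset is smooth if it
  extends locally to a smooth function on an open set.\<close>

definition smooth_on_set :: "'v::real_normed_vector set \<Rightarrow> ('v \<Rightarrow> 'w::real_normed_vector) \<Rightarrow> bool" where
  "smooth_on_set S f \<longleftrightarrow>
     (\<forall>x\<in>S. \<exists>W g. open W \<and> x \<in> W \<and> (\<forall>k. Ck_on k W g) \<and> (\<forall>y\<in>S \<inter> W. g y = f y))"

section \<open>Manifolds with corners\<close>

type_synonym ('a, 'b) chart = "'a set \<times> ('a \<Rightarrow> 'b)"

text \<open>The underlying space is the whole type \<open>'a\<close>. The model space \<open>\<real>\<^sup>n\<close> is the coordinate
  subspace of the Euclidean space \<open>'b\<close> spanned by a set \<open>coords\<close> of \<open>n\<close> standard basis vectors.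
  (Taking \<open>coords = Basis\<close> gives all of \<open>'b\<close>; proper subsets are allowed because
  \<open>n = 0\<close> is not the dimension of any Euclidean space type.)\<close>

record ('a, 'b) corner_manifold =
  coords :: "'b set"
  charts :: "('a, 'b) chart set"

definition model_proj :: "('a, 'b::euclidean_space) corner_manifold \<Rightarrow> 'b \<Rightarrow> 'b" where
  "model_proj M v = (\<Sum>b\<in>coords M. (v \<bullet> b) *\<^sub>R b)"

definition sector :: "('a, 'b::euclidean_space) corner_manifold \<Rightarrow> 'b set \<Rightarrow> 'b set" where
  "sector M K = {v. model_proj M v = v \<and> (\<forall>b\<in>K. v \<bullet> b \<ge> 0)}"

definition is_chart ::
  "('a::topological_space, 'b::euclidean_space) corner_manifold \<Rightarrow> ('a, 'b) chart \<Rightarrow> bool" where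
  "is_chart M = (\<lambda>(U, \<phi>). open U \<and> homeomorphism U (\<phi> ` U) \<phi> (inv_into U \<phi>) \<and>
     (\<exists>K\<subseteq>coords M. openin (top_of_set (sector M K)) (\<phi> ` U)))"

definition manifold_with_corners ::
  "('a::{t2_space, second_countable_topology}, 'b::euclidean_space) corner_manifold \<Rightarrow> bool" where
  "manifold_with_corners M \<longleftrightarrow>
     coords M \<subseteq> Basis \<and>
     (\<forall>c\<in>charts M. is_chart M c) \<and>
     (\<Union>c\<in>charts M. fst c) = UNIV \<and>
     (\<forall>(U, \<phi>)\<in>charts M. \<forall>(U', \<phi>')\<in>charts M.
        smooth_on_set (\<phi> ` (U \<inter> U')) (\<phi>' \<circ> inv_into U \<phi>))"

definition smooth_fun ::
  "('a, 'b::euclidean_space) corner_manifold \<Rightarrow> 'a set \<Rightarrow> ('a \<Rightarrow> 'w::real_normed_vector) \<Rightarrow> bool" where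
  "smooth_fun M W f \<longleftrightarrow> (\<forall>(U, \<phi>)\<in>charts M. smooth_on_set (\<phi> ` (U \<inter> W)) (f \<circ> inv_into U \<phi>))"

text \<open>Derivative of \<open>f\<close> at \<open>p\<close> along the tangent vector with coordinates \<open>v\<close> in the chart \<open>c\<close>.
  The Frechet derivative within the chart image is determined only on the model space,
  hence the projection.\<close>

definition chart_deriv ::
  "('a, 'b::euclidean_space) corner_manifold \<Rightarrow> ('a, 'b) chart \<Rightarrow>
     ('a \<Rightarrow> 'w::real_normed_vector) \<Rightarrow> 'a \<Rightarrow> 'b \<Rightarrow> 'w" where
  "chart_deriv M = (\<lambda>(U, \<phi>) f p v.
     frechet_derivative (f \<circ> inv_into U \<phi>) (at (\<phi> p) within \<phi> ` U) (model_proj M v))"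

section \<open>Differential forms\<close>

text \<open>A complex form, possibly of mixed degree, is given by its coordinate expressions:
  \<open>\<omega> c p [v\<^sub>1, \<dots>, v\<^sub>k]\<close> is the value of the degree \<open>k\<close> part at \<open>p\<close> on the tangent vectors which
  have coordinates \<open>v\<^sub>1, \<dots>, v\<^sub>k\<close> in the chart \<open>c\<close>. Outside the charts the value is \<open>0\<close>,
  so that equality of forms is equality of functions.\<close>

type_synonym ('a, 'b) cform = "('a, 'b) chart \<Rightarrow> 'a \<Rightarrow> 'b list \<Rightarrow> complex"

definition zero_form :: "('a, 'b) cform" where
  "zero_form = (\<lambda>c p vs. 0)"

definition add_form :: "('a, 'b) cform \<Rightarrow> ('a, 'b) cform \<Rightarrow> ('a, 'b) cform" where
  "add_form \<omega> \<eta> = (\<lambda>c p vs. \<omega> c p vs + \<eta> c p vs)"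

definition diff_form :: "('a, 'b) cform \<Rightarrow> ('a, 'b) cform \<Rightarrow> ('a, 'b) cform" where
  "diff_form \<omega> \<eta> = (\<lambda>c p vs. \<omega> c p vs - \<eta> c p vs)"

definition alternating_at ::
  "('a, 'b::euclidean_space) corner_manifold \<Rightarrow> ('b list \<Rightarrow> complex) \<Rightarrow> bool" where
  "alternating_at M a \<longleftrightarrow>
     (\<forall>vs. \<forall>i<length vs. linear (\<lambda>w. a (vs[i := w]))) \<and>
     (\<forall>vs. \<not> distinct vs \<longrightarrow> a vs = 0) \<and>
     (\<forall>vs. a (map (model_proj M) vs) = a vs)"

text \<open>Fields of alternating forms, without any regularity in the base point.\<close>

definition tensorial :: "('a, 'b::euclidean_space) corner_manifold \<Rightarrow> ('a, 'b) cform \<Rightarrow> bool" where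
  "tensorial M \<omega> \<longleftrightarrow>
     (\<forall>c p. c \<notin> charts M \<or> p \<notin> fst c \<longrightarrow> \<omega> c p = (\<lambda>vs. 0)) \<and>
     (\<forall>c\<in>charts M. \<forall>p\<in>fst c. alternating_at M (\<omega> c p)) \<and>
     (\<forall>c\<in>charts M. \<forall>c'\<in>charts M. \<forall>p\<in>fst c \<inter> fst c'. \<forall>vs.
        \<omega> c p vs = \<omega> c' p (map (chart_deriv M c (snd c') p) vs))"

definition forms :: "('a, 'b::euclidean_space) corner_manifold \<Rightarrow> ('a, 'b) cform set" where
  "forms M = {\<omega>. tensorial M \<omega> \<and> (\<forall>c\<in>charts M. \<forall>vs. smooth_fun M (fst c) (\<lambda>p. \<omega> c p vs))}"

definition odd_forms :: "('a, 'b::euclidean_space) corner_manifold \<Rightarrow> ('a, 'b) cform set" where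
  "odd_forms M = {\<omega>\<in>forms M. \<forall>c p vs. even (length vs) \<longrightarrow> \<omega> c p vs = 0}"

definition even_forms :: "('a, 'b::euclidean_space) corner_manifold \<Rightarrow> ('a, 'b) cform set" where
  "even_forms M = {\<omega>\<in>forms M. \<forall>c p vs. odd (length vs) \<longrightarrow> \<omega> c p vs = 0}"

definition ext_deriv ::
  "('a, 'b::euclidean_space) corner_manifold \<Rightarrow> ('a, 'b) cform \<Rightarrow> ('a, 'b) cform" where
  "ext_deriv M \<omega> c p vs =
     (if c \<in> charts M \<and> p \<in> fst c
      then \<Sum>i<length vs. (-1) ^ i *
             chart_deriv M c (\<lambda>q. \<omega> c q (take i vs @ drop (Suc i) vs)) p (vs ! i)
      else 0)"

definition exact_odd_forms :: "('a, 'b::euclidean_space) corner_manifold \<Rightarrow> ('a, 'b) cform set" where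
  "exact_odd_forms M = ext_deriv M ` even_forms M"

section \<open>Matrices and matrix valued forms at a point\<close>

definition GL :: "nat \<Rightarrow> complex mat set" where
  "GL r = {A \<in> carrier_mat r r. invertible_mat A}"

definition minv :: "complex mat \<Rightarrow> complex mat" where
  "minv A = the (mat_inverse A)"

definition mat_trace :: "complex mat \<Rightarrow> complex" where
  "mat_trace A = (\<Sum>i<dim_row A. A $$ (i, i))"

definition mentry :: "complex mat \<Rightarrow> nat \<Rightarrow> nat \<Rightarrow> complex" where
  "mentry A i j = (if i < dim_row A \<and> j < dim_col A then A $$ (i, j) else 0)"

definition ventry :: "complex vec \<Rightarrow> nat \<Rightarrow> complex" where
  "ventry v i = (if i < dim_vec v then v $ i else 0)"

text \<open>The sign of the shuffle which lists \<open>S\<close> before its complement in \<open>{..<n}\<close>.\<close>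

definition shuffle_sign :: "nat \<Rightarrow> nat set \<Rightarrow> complex" where
  "shuffle_sign n S = (-1) ^ card {(i, j). i \<in> S \<and> j \<in> {..<n} - S \<and> j < i}"

text \<open>Wedge product of \<open>r \<times> r\<close>-matrix valued alternating forms at a point, normalized as a sum over
  shuffles: \<open>(\<Phi> \<and> \<Psi>)(v, w) = \<Phi>(v) \<Psi>(w) - \<Phi>(w) \<Psi>(v)\<close> for 1-forms.\<close>

definition mwedge ::
  "nat \<Rightarrow> ('b list \<Rightarrow> complex mat) \<Rightarrow> ('b list \<Rightarrow> complex mat) \<Rightarrow> 'b list \<Rightarrow> complex mat" where
  "mwedge r \<Phi> \<Psi> vs = mat r r (\<lambda>(i, j). \<Sum>S\<in>Pow {..<length vs}.
     shuffle_sign (length vs) S * (\<Phi> (nths vs S) * \<Psi> (nths vs (- S))) $$ (i, j))"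

primrec mwedge_power ::
  "nat \<Rightarrow> ('b list \<Rightarrow> complex mat) \<Rightarrow> nat \<Rightarrow> 'b list \<Rightarrow> complex mat" where
  "mwedge_power r \<Phi> 0 = (\<lambda>vs. if vs = [] then 1\<^sub>m r else 0\<^sub>m r r)"
| "mwedge_power r \<Phi> (Suc k) = mwedge r \<Phi> (mwedge_power r \<Phi> k)"

definition smooth_mat ::
  "('a, 'b::euclidean_space) corner_manifold \<Rightarrow> 'a set \<Rightarrow> ('a \<Rightarrow> complex mat) \<Rightarrow> bool" where
  "smooth_mat M W A \<longleftrightarrow> (\<forall>i j. smooth_fun M W (\<lambda>p. mentry (A p) i j))"

definition smooth_vec ::
  "('a, 'b::euclidean_space) corner_manifold \<Rightarrow> 'a set \<Rightarrow> ('a \<Rightarrow> complex vec) \<Rightarrow> bool" where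
  "smooth_vec M W s \<longleftrightarrow> (\<forall>i. smooth_fun M W (\<lambda>p. ventry (s p) i))"

section \<open>Complex vector bundles\<close>

text \<open>Up to isomorphism, the fibre over \<open>p\<close> may be taken to be \<open>\<complex>\<^sup>r\<close> as a bare vector space, where
  \<open>r = rk V p\<close>. The standard basis of the fibre has no meaning; the smooth structure is given by the
  local trivializations \<open>(W, \<psi>)\<close>, where \<open>\<psi> p\<close>, for \<open>p \<in> W\<close>, is a linear isomorphism from the fibre
  over \<open>p\<close> to \<open>\<complex>\<^sup>r\<close>. The rank may differ between components of the base.\<close>

record 'a vbundle =
  rk :: "'a \<Rightarrow> nat"
  trivs :: "('a set \<times> ('a \<Rightarrow> complex mat)) set"

definition vector_bundle ::
  "('a::topological_space, 'b::euclidean_space) corner_manifold \<Rightarrow> 'a vbundle \<Rightarrow> bool" where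
  "vector_bundle M V \<longleftrightarrow>
     (\<Union>\<tau>\<in>trivs V. fst \<tau>) = UNIV \<and>
     (\<forall>(W, \<psi>)\<in>trivs V. open W \<and> (\<forall>p\<in>W. \<psi> p \<in> GL (rk V p)) \<and> (\<forall>p\<in>W. \<forall>q\<in>W. rk V p = rk V q)) \<and>
     (\<forall>(W, \<psi>)\<in>trivs V. \<forall>(W', \<psi>')\<in>trivs V. smooth_mat M (W \<inter> W') (\<lambda>p. \<psi>' p * minv (\<psi> p)))"

definition bundle_iso ::
  "('a, 'b::euclidean_space) corner_manifold \<Rightarrow> 'a vbundle \<Rightarrow> 'a vbundle \<Rightarrow>
     ('a \<Rightarrow> complex mat) \<Rightarrow> bool" where
  "bundle_iso M V V' f \<longleftrightarrow>
     (\<forall>p. rk V' p = rk V p \<and> f p \<in> GL (rk V p)) \<and>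
     (\<forall>(W, \<psi>)\<in>trivs V. \<forall>(W', \<psi>')\<in>trivs V'.
        smooth_mat M (W \<inter> W') (\<lambda>p. \<psi>' p * f p * minv (\<psi> p)))"

definition product_bundle :: "nat \<Rightarrow> 'a vbundle" where
  "product_bundle n = \<lparr>rk = (\<lambda>p. n), trivs = {(UNIV, \<lambda>p. 1\<^sub>m n)}\<rparr>"

definition trivial_bundle ::
  "('a::topological_space, 'b::euclidean_space) corner_manifold \<Rightarrow> 'a vbundle \<Rightarrow> bool" where
  "trivial_bundle M V \<longleftrightarrow> vector_bundle M V \<and> (\<exists>n f. bundle_iso M (product_bundle n) V f)"

definition bundle_sum :: "'a vbundle \<Rightarrow> 'a vbundle \<Rightarrow> 'a vbundle" where
  "bundle_sum V V' =
     \<lparr>rk = (\<lambda>p. rk V p + rk V' p),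
      trivs = {(W \<inter> W', \<lambda>p. four_block_mat (\<psi> p) (0\<^sub>m (rk V p) (rk V' p))
                                           (0\<^sub>m (rk V' p) (rk V p)) (\<psi>' p)) | W \<psi> W' \<psi>'.
               (W, \<psi>) \<in> trivs V \<and> (W', \<psi>') \<in> trivs V'}\<rparr>"

definition stably_trivial ::
  "('a::topological_space, 'b::euclidean_space) corner_manifold \<Rightarrow> 'a vbundle \<Rightarrow> bool" where
  "stably_trivial M V \<longleftrightarrow> (\<exists>F. trivial_bundle M F \<and> trivial_bundle M (bundle_sum V F))"

type_synonym 'a vsection = "'a \<Rightarrow> complex vec"

definition sections ::
  "('a, 'b::euclidean_space) corner_manifold \<Rightarrow> 'a vbundle \<Rightarrow> 'a vsection set" where
  "sections M V = {s. (\<forall>p. s p \<in> carrier_vec (rk V p)) \<and>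
     (\<forall>(W, \<psi>)\<in>trivs V. smooth_vec M W (\<lambda>p. \<psi> p *\<^sub>v s p))}"

text \<open>Bundle valued and endomorphism valued \<open>k\<close>-forms. Being a field of alternating forms can be
  tested on entries with respect to an arbitrary basis of each fibre.\<close>

type_synonym ('a, 'b) vform = "('a, 'b) chart \<Rightarrow> 'a \<Rightarrow> 'b list \<Rightarrow> complex vec"
type_synonym ('a, 'b) endform = "('a, 'b) chart \<Rightarrow> 'a \<Rightarrow> 'b list \<Rightarrow> complex mat"

definition vforms ::
  "('a, 'b::euclidean_space) corner_manifold \<Rightarrow> 'a vbundle \<Rightarrow> nat \<Rightarrow> ('a, 'b) vform set" where
  "vforms M V k = {\<alpha>.
     (\<forall>c p vs. \<alpha> c p vs \<in> carrier_vec (rk V p)) \<and>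
     (\<forall>c p vs. length vs \<noteq> k \<longrightarrow> \<alpha> c p vs = 0\<^sub>v (rk V p)) \<and>
     (\<forall>i. tensorial M (\<lambda>c p vs. ventry (\<alpha> c p vs) i)) \<and>
     (\<forall>c\<in>charts M. \<forall>(W, \<psi>)\<in>trivs V. \<forall>vs. smooth_vec M (fst c \<inter> W) (\<lambda>p. \<psi> p *\<^sub>v \<alpha> c p vs))}"

definition endforms ::
  "('a, 'b::euclidean_space) corner_manifold \<Rightarrow> 'a vbundle \<Rightarrow> nat \<Rightarrow> ('a, 'b) endform set" where
  "endforms M V k = {\<Phi>.
     (\<forall>c p vs. \<Phi> c p vs \<in> carrier_mat (rk V p) (rk V p)) \<and>
     (\<forall>c p vs. length vs \<noteq> k \<longrightarrow> \<Phi> c p vs = 0\<^sub>m (rk V p) (rk V p)) \<and>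
     (\<forall>i j. tensorial M (\<lambda>c p vs. mentry (\<Phi> c p vs) i j)) \<and>
     (\<forall>c\<in>charts M. \<forall>(W, \<psi>)\<in>trivs V. \<forall>vs.
        smooth_mat M (fst c \<inter> W) (\<lambda>p. \<psi> p * \<Phi> c p vs * minv (\<psi> p)))}"

section \<open>Connections and curvature\<close>

type_synonym ('a, 'b) conn = "'a vsection \<Rightarrow> ('a, 'b) vform"

definition connection ::
  "('a, 'b::euclidean_space) corner_manifold \<Rightarrow> 'a vbundle \<Rightarrow> ('a, 'b) conn \<Rightarrow> bool" where
  "connection M V D \<longleftrightarrow>
     D \<in> sections M V \<rightarrow>\<^sub>E vforms M V 1 \<and>
     (\<forall>s\<in>sections M V. \<forall>s'\<in>sections M V. \<forall>c p vs.
        D (\<lambda>q. s q + s' q) c p vs = D s c p vs + D s' c p vs) \<and>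
     (\<forall>f::'a \<Rightarrow> complex. \<forall>s\<in>sections M V. smooth_fun M UNIV f \<longrightarrow>
        (\<forall>c\<in>charts M. \<forall>p\<in>fst c. \<forall>v.
           D (\<lambda>q. f q \<cdot>\<^sub>v s q) c p [v] = chart_deriv M c f p v \<cdot>\<^sub>v s p + f p \<cdot>\<^sub>v D s c p [v]))"

type_synonym ('a, 'b) vfield = "('a, 'b) chart \<Rightarrow> 'a \<Rightarrow> 'b"

definition vector_fields ::
  "('a, 'b::euclidean_space) corner_manifold \<Rightarrow> ('a, 'b) vfield set" where
  "vector_fields M = {Z.
     (\<forall>c p. c \<notin> charts M \<or> p \<notin> fst c \<longrightarrow> Z c p = 0) \<and>
     (\<forall>c p. model_proj M (Z c p) = Z c p) \<and>
     (\<forall>c\<in>charts M. smooth_fun M (fst c) (Z c)) \<and>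
     (\<forall>c\<in>charts M. \<forall>c'\<in>charts M. \<forall>p\<in>fst c \<inter> fst c'. Z c' p = chart_deriv M c (snd c') p (Z c p))}"

definition lie_bracket ::
  "('a, 'b::euclidean_space) corner_manifold \<Rightarrow> ('a, 'b) vfield \<Rightarrow> ('a, 'b) vfield \<Rightarrow>
     ('a, 'b) vfield" where
  "lie_bracket M Z W c p =
     (if c \<in> charts M \<and> p \<in> fst c
      then chart_deriv M c (W c) p (Z c p) - chart_deriv M c (Z c) p (W c p) else 0)"

definition chart_at :: "('a, 'b) corner_manifold \<Rightarrow> 'a \<Rightarrow> ('a, 'b) chart" where
  "chart_at M p = (SOME c. c \<in> charts M \<and> p \<in> fst c)"

definition cov_deriv ::
  "('a, 'b) corner_manifold \<Rightarrow> ('a, 'b) conn \<Rightarrow> ('a, 'b) vfield \<Rightarrow> 'a vsection \<Rightarrow> 'a vsection" where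
  "cov_deriv M D Z s p = D s (chart_at M p) p [Z (chart_at M p) p]"

definition curvature ::
  "('a, 'b::euclidean_space) corner_manifold \<Rightarrow> 'a vbundle \<Rightarrow> ('a, 'b) conn \<Rightarrow> ('a, 'b) endform" where
  "curvature M V D = (THE R. R \<in> endforms M V 2 \<and>
     (\<forall>Z\<in>vector_fields M. \<forall>W\<in>vector_fields M. \<forall>s\<in>sections M V. \<forall>c\<in>charts M. \<forall>p\<in>fst c.
        R c p [Z c p, W c p] *\<^sub>v s p =
          cov_deriv M D Z (cov_deriv M D W s) p - cov_deriv M D W (cov_deriv M D Z s) p
          - cov_deriv M D (lie_bracket M Z W) s p))"

definition connection_sum ::
  "('a, 'b::euclidean_space) corner_manifold \<Rightarrow> 'a vbundle \<Rightarrow> 'a vbundle \<Rightarrow>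
     ('a, 'b) conn \<Rightarrow> ('a, 'b) conn \<Rightarrow> ('a, 'b) conn" where
  "connection_sum M V V' D D' = restrict
     (\<lambda>s c p vs. D (\<lambda>q. vec_first (s q) (rk V q)) c p vs @\<^sub>v D' (\<lambda>q. vec_last (s q) (rk V' q)) c p vs)
     (sections M (bundle_sum V V'))"

text \<open>The connection on \<open>V'\<close> to which an isomorphism \<open>f\<close> from \<open>V\<close> to \<open>V'\<close> carries \<open>D\<close>.\<close>

definition push_connection ::
  "('a, 'b::euclidean_space) corner_manifold \<Rightarrow> 'a vbundle \<Rightarrow> ('a \<Rightarrow> complex mat) \<Rightarrow>
     ('a, 'b) conn \<Rightarrow> ('a, 'b) conn" where
  "push_connection M V' f D = restrict
     (\<lambda>s c p vs. f p *\<^sub>v D (\<lambda>q. minv (f q) *\<^sub>v s q) c p vs) (sections M V')"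

section \<open>Flat connections\<close>

definition smooth_path ::
  "('a::topological_space, 'b::euclidean_space) corner_manifold \<Rightarrow> (real \<Rightarrow> 'a) \<Rightarrow> bool" where
  "smooth_path M x \<longleftrightarrow> continuous_on {0..1} x \<and>
     (\<forall>(U, \<phi>)\<in>charts M. smooth_on_set {t\<in>{0..1}. x t \<in> U} (\<phi> \<circ> x))"

text \<open>Parallel lifts of a path \<open>x\<close>: near each time, the lift is a combination
  \<open>\<Sum>\<^sub>j f\<^sub>j(t) e\<^sub>j(x(t))\<close> of smooth sections \<open>e\<^sub>j\<close>, whose covariant derivative
  \<open>\<Sum>\<^sub>j f\<^sub>j'(t) e\<^sub>j(x(t)) + f\<^sub>j(t) (\<nabla> e\<^sub>j)(x'(t))\<close> along the path vanishes.\<close>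

definition parallel_along ::
  "('a, 'b::euclidean_space) corner_manifold \<Rightarrow> 'a vbundle \<Rightarrow> ('a, 'b) conn \<Rightarrow>
     (real \<Rightarrow> 'a) \<Rightarrow> (real \<Rightarrow> complex vec) \<Rightarrow> bool" where
  "parallel_along M V D x \<sigma> \<longleftrightarrow>
     (\<forall>t\<in>{0..1}. \<sigma> t \<in> carrier_vec (rk V (x t))) \<and>
     (\<forall>t0\<in>{0..1}. \<exists>\<epsilon>>0. \<exists>(m::nat) e f f'. (\<forall>j<m. e j \<in> sections M V) \<and>
        (\<forall>t\<in>{0..1}. \<bar>t - t0\<bar> < \<epsilon> \<longrightarrow>
           (\<forall>j<m. (f j has_vector_derivative f' j t) (at t within {0..1})) \<and>
           (\<forall>i<rk V (x t). \<sigma> t $ i = (\<Sum>j<m. f j t * e j (x t) $ i)) \<and>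
           (\<forall>c\<in>charts M. x t \<in> fst c \<longrightarrow> (\<forall>i<rk V (x t).
              (\<Sum>j<m. f' j t * e j (x t) $ i + f j t *
                 D (e j) c (x t) [vector_derivative (snd c \<circ> x) (at t within {0..1})] $ i) = 0))))"

text \<open>Closed paths need not close up smoothly. As holonomy is invariant under reparametrization, and
  corners can be traversed with vanishing velocity, this covers piecewise smooth closed paths.\<close>

definition flat_connection ::
  "('a::topological_space, 'b::euclidean_space) corner_manifold \<Rightarrow> 'a vbundle \<Rightarrow>
     ('a, 'b) conn \<Rightarrow> bool" where
  "flat_connection M V D \<longleftrightarrow> connection M V D \<and>
     (\<forall>x \<sigma>. smooth_path M x \<and> x 0 = x 1 \<and> parallel_along M V D x \<sigma> \<longrightarrow> \<sigma> 0 = \<sigma> 1)"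

section \<open>Chern--Simons forms\<close>

definition connection_curve ::
  "('a, 'b::euclidean_space) corner_manifold \<Rightarrow> 'a vbundle \<Rightarrow> (real \<Rightarrow> ('a, 'b) conn) \<Rightarrow> bool" where
  "connection_curve M V \<gamma> \<longleftrightarrow>
     (\<forall>t\<in>{0..1}. connection M V (\<gamma> t)) \<and>
     (\<forall>s\<in>sections M V. \<forall>(U, \<phi>)\<in>charts M. \<forall>(W, \<psi>)\<in>trivs V. \<forall>v i.
        smooth_on_set ({0..1} \<times> \<phi> ` (U \<inter> W))
          (\<lambda>(t, y). let p = inv_into U \<phi> y in ventry (\<psi> p *\<^sub>v \<gamma> t s (U, \<phi>) p [v]) i))"

definition curve_deriv ::
  "('a, 'b::euclidean_space) corner_manifold \<Rightarrow> 'a vbundle \<Rightarrow> (real \<Rightarrow> ('a, 'b) conn) \<Rightarrow> real \<Rightarrow>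
     ('a, 'b) endform" where
  "curve_deriv M V \<gamma> t = (THE A. A \<in> endforms M V 1 \<and>
     (\<forall>s\<in>sections M V. \<forall>c\<in>charts M. \<forall>p\<in>fst c. \<forall>v. \<forall>i<rk V p.
        ((\<lambda>u. \<gamma> u s c p [v] $ i) has_vector_derivative (A c p [v] *\<^sub>v s p) $ i) (at t within {0..1})))"

text \<open>The summation index is shifted: the term for \<open>j\<close> involves \<open>R\<^sup>j\<close> and \<open>(1 / 2\<pi>i)\<^sup>j\<^sup>+\<^sup>1\<close>.
  Only finitely many terms are nonzero.\<close>

definition cs ::
  "('a, 'b::euclidean_space) corner_manifold \<Rightarrow> 'a vbundle \<Rightarrow> (real \<Rightarrow> ('a, 'b) conn) \<Rightarrow>
     ('a, 'b) cform" where
  "cs M V \<gamma> c p vs = integral {0..1} (\<lambda>t. \<Sum>j. 1 / fact j * (1 / (2 * of_real pi * \<i>)) ^ (j + 1) *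
     mat_trace (mwedge (rk V p) (curve_deriv M V \<gamma> t c p)
       (mwedge_power (rk V p) (curvature M V (\<gamma> t) c p) j) vs))"

text \<open>The class \<open>CS(\<nabla>\<^sup>0, \<nabla>\<^sup>1)\<close> modulo exact forms, as the set of its representatives.\<close>

definition CS ::
  "('a, 'b::euclidean_space) corner_manifold \<Rightarrow> 'a vbundle \<Rightarrow> ('a, 'b) conn \<Rightarrow> ('a, 'b) conn \<Rightarrow>
     ('a, 'b) cform set" where
  "CS M V D0 D1 = {add_form (cs M V \<gamma>) \<eta> | \<gamma> \<eta>.
     connection_curve M V \<gamma> \<and> \<gamma> 0 = D0 \<and> \<gamma> 1 = D1 \<and> \<eta> \<in> exact_odd_forms M}"

section \<open>Structured bundles\<close>

definition conn_class ::
  "('a, 'b::euclidean_space) corner_manifold \<Rightarrow> 'a vbundle \<Rightarrow> ('a, 'b) conn \<Rightarrow> ('a, 'b) conn set" where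
  "conn_class M V D = {D'. connection M V D' \<and> zero_form \<in> CS M V D D'}"

type_synonym ('a, 'b) structured = "'a vbundle \<times> ('a, 'b) conn set"

definition structured_bundles ::
  "('a::topological_space, 'b::euclidean_space) corner_manifold \<Rightarrow> ('a, 'b) structured set" where
  "structured_bundles M =
     {(V, conn_class M V D) | V D. vector_bundle M V \<and> connection M V D}"

definition structured_iso ::
  "('a::topological_space, 'b::euclidean_space) corner_manifold \<Rightarrow> ('a, 'b) structured rel" where
  "structured_iso M = {((V, C), (V', C')).
     (V, C) \<in> structured_bundles M \<and> (V', C') \<in> structured_bundles M \<and>
     (\<exists>f. bundle_iso M V V' f \<and> push_connection M V' f ` C = C')}"

definition Struct ::
  "('a::topological_space, 'b::euclidean_space) corner_manifold \<Rightarrow> ('a, 'b) structured set set" where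
  "Struct M = structured_bundles M // structured_iso M"

definition Struct_ST ::
  "('a::topological_space, 'b::euclidean_space) corner_manifold \<Rightarrow> ('a, 'b) structured set set" where
  "Struct_ST M = {\<V>\<in>Struct M. \<exists>(V, C)\<in>\<V>. stably_trivial M V}"

section \<open>The subgroup \<open>\<and>\<^bsub>GL\<^esub>\<close> and the map \<open>CS_hat\<close>\<close>

text \<open>Smooth maps from the compact space \<open>X\<close> to \<open>GL\<close>, the union of the groups \<open>GL(n, \<complex>)\<close>,
  are smooth maps to some \<open>GL(n, \<complex>)\<close>.\<close>

definition smooth_GL_map ::
  "('a, 'b::euclidean_space) corner_manifold \<Rightarrow> nat \<Rightarrow> ('a \<Rightarrow> complex mat) \<Rightarrow> bool" where
  "smooth_GL_map M n g \<longleftrightarrow> (\<forall>p. g p \<in> GL n) \<and> smooth_mat M UNIV g"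

definition pullback_theta ::
  "('a, 'b::euclidean_space) corner_manifold \<Rightarrow> nat \<Rightarrow> ('a \<Rightarrow> complex mat) \<Rightarrow> ('a, 'b) endform" where
  "pullback_theta M n g c p vs =
     (if c \<in> charts M \<and> p \<in> fst c \<and> length vs = 1
      then minv (g p) * mat n n (\<lambda>(i, j). chart_deriv M c (\<lambda>q. g q $$ (i, j)) p (vs ! 0))
      else 0\<^sub>m n n)"

definition b_coeff :: "nat \<Rightarrow> complex" where
  "b_coeff j = 1 / fact (j - 1) * (1 / (2 * of_real pi * \<i>)) ^ j *
     of_real (integral {0..1} (\<lambda>t::real. (t\<^sup>2 - t) ^ (j - 1)))"

definition pullback_Theta ::
  "('a, 'b::euclidean_space) corner_manifold \<Rightarrow> nat \<Rightarrow> ('a \<Rightarrow> complex mat) \<Rightarrow> ('a, 'b) cform" where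
  "pullback_Theta M n g c p vs =
     (\<Sum>j. b_coeff (Suc j) *
        mat_trace (mwedge_power n (pullback_theta M n g c p) (2 * Suc j - 1) vs))"

definition GL_forms :: "('a, 'b::euclidean_space) corner_manifold \<Rightarrow> ('a, 'b) cform set" where
  "GL_forms M = {add_form (pullback_Theta M n g) \<eta> | n g \<eta>.
     smooth_GL_map M n g \<and> \<eta> \<in> exact_odd_forms M}"

definition odd_forms_mod_GL ::
  "('a, 'b::euclidean_space) corner_manifold \<Rightarrow> ('a, 'b) cform set set" where
  "odd_forms_mod_GL M = odd_forms M //
     {(\<omega>, \<omega>'). \<omega> \<in> odd_forms M \<and> \<omega>' \<in> odd_forms M \<and> diff_form \<omega>' \<omega> \<in> GL_forms M}"

text \<open>The graph of the homomorphism: the value at a class of structured bundles is the class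
  modulo \<open>\<and>\<^bsub>GL\<^esub>\<close> of \<open>CS(\<nabla>\<^sup>H, \<nabla> \<oplus> \<nabla>\<^sup>F)\<close>, for a choice of trivial bundles \<open>F\<close> and \<open>H = V \<oplus> F\<close> with
  flat connections. That this does not depend on the choices is a theorem, so it is not built
  into the definition.\<close>

definition CS_hat ::
  "('a::topological_space, 'b::euclidean_space) corner_manifold \<Rightarrow>
     (('a, 'b) structured set \<times> ('a, 'b) cform set) set" where
  "CS_hat M = {(\<V>, \<kappa>). \<V> \<in> Struct_ST M \<and> \<kappa> \<in> odd_forms_mod_GL M \<and>
     (\<exists>V C D F DF H DH \<omega>. (V, C) \<in> \<V> \<and> D \<in> C \<and>
        trivial_bundle M F \<and> trivial_bundle M H \<and> bundle_sum V F = H \<and>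
        flat_connection M F DF \<and> flat_connection M H DH \<and>
        \<omega> \<in> CS M H DH (connection_sum M V F D DF) \<and> \<omega> \<in> \<kappa>)}"

end

theory Submission
  imports Defs "HOL-Library.Function_Algebras"
begin

text \<open>
  Every odd form is, exactly and not only modulo \<open>\<and>\<^bsub>GL\<^esub>\<close>, the Chern--Simons form of a curve of
  diagonal connections on a product bundle that starts at the product connection. For a line bundle
  connection \<open>d + a\<^sub>t\<close> the integrand is a combination of the forms \<open>a'\<^sub>t \<and> (da\<^sub>t)\<^sup>j\<close>. By a partition of
  unity an odd form is a finite sum of terms \<open>u dg \<and> da\<^sub>1 \<and> db\<^sub>1 \<and> \<dots> \<and> da\<^sub>K \<and> db\<^sub>K\<close> with global functions.
  Put \<open>a\<^sub>t = w(t) u dg + t \<Sum> a\<^sub>i db\<^sub>i\<close>. The direct sum of the line bundles with \<open>z a\<^sub>t\<close>, where \<open>z\<close> runs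
  through the roots of unity of order \<open>K + 1\<close>, has no contribution of degree \<open>j < K\<close>; those with
  \<open>j > K\<close> vanish because the square of a decomposable 2-form is zero; and for a suitable polynomial
  \<open>w\<close> the contribution with \<open>j = K\<close> integrates to a multiple of the given term.
\<close>

text \<open>Scaling the connection form by z multiplies a' \<and> (da)^j by z^(j+1), so the sum over
  the roots of unity of order K + 1 keeps only those j with j + 1 divisible by K + 1. As u dg and du
  \<and> dg share dg, and each a_i db_i shares db_i with da_i \<and> db_i, a product with j > K
  repeats a differential. The case j = K has two parts: K! w' t^K times the wanted term, and K w
  t^(K-1) times terms in which du \<and> dg comes from the curvature and some a_i db_i from the time
  derivative. For w(t) = t the second part agrees with a multiple of the wanted term only modulo
  exact forms. If w(0) = 0, integration by parts turns the integral of w' t^K into w(1) minus K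
  times that of w t^(K-1); so the unwanted part disappears and the wanted one gets weight K! once
  w(1) = 1 and w is orthogonal to t^(K-1), as (K+2) t^2 - (K+1) t is. A second obstacle is that
  curvature and time derivative are given by definite descriptions tested on global objects: they
  are found by exhibiting a diagonal form and proving uniqueness, which requires enough global
  vector fields and sections.\<close>

no_notation scalar_prod (infix "\<bullet>" 70)

section \<open>Smooth maps between normed spaces, mixed second derivatives and plateau
  functions\<close>

section \<open>Calculus of smooth maps\<close>

lemma Ck_on_SucE:
  assumes "Ck_on (Suc k) W f"
  obtains f' where "\<And>x. x \<in> W \<Longrightarrow> (f has_derivative f' x) (at x)" "\<And>v. Ck_on k W (\<lambda>x. f' x v)"
  using assms by auto

lemma Ck_on_SucI:
  assumes "\<And>x. x \<in> W \<Longrightarrow> (f has_derivative f' x) (at x)" "\<And>v. Ck_on k W (\<lambda>x. f' x v)"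
  shows "Ck_on (Suc k) W f"
  using assms by auto

lemma Ck_on_subset: "Ck_on k W f \<Longrightarrow> V \<subseteq> W \<Longrightarrow> Ck_on k V f"
proof (induction k arbitrary: f)
  case 0
  then show ?case by (auto intro: continuous_on_subset)
next
  case (Suc k)
  then show ?case unfolding Ck_on.simps by (meson subsetD)
qed

lemma Ck_on_cong:
  assumes "open W" "\<And>x. x \<in> W \<Longrightarrow> f x = g x" "Ck_on k W f"
  shows "Ck_on k W g"
proof (cases k)
  case 0
  then show ?thesis using assms by (simp cong: continuous_on_cong)
next
  case (Suc m)
  with assms(3) obtain f' where f': "\<And>x. x \<in> W \<Longrightarrow> (f has_derivative f' x) (at x)"
    and C: "\<And>v. Ck_on m W (\<lambda>x. f' x v)" by auto
  have "(g has_derivative f' x) (at x)" if "x \<in> W" for x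
    using has_derivative_transform_within_open[OF f'[OF that] assms(1) that assms(2)] .
  with C Suc show ?thesis by auto
qed

lemma Ck_on_Suc_imp: "Ck_on (Suc k) W f \<Longrightarrow> Ck_on k W f"
proof (induction k arbitrary: f)
  case 0
  then obtain f' where "\<And>x. x \<in> W \<Longrightarrow> (f has_derivative f' x) (at x)"
    unfolding Ck_on.simps by blast
  then show ?case
    unfolding Ck_on.simps by (intro continuous_at_imp_continuous_on ballI has_derivative_continuous)
next
  case (Suc k)
  from Suc.prems obtain f' where f': "\<And>x. x \<in> W \<Longrightarrow> (f has_derivative f' x) (at x)" and
    "\<And>v. Ck_on (Suc k) W (\<lambda>x. f' x v)" unfolding Ck_on.simps(2)[of "Suc k"] by blast
  then have "\<And>v. Ck_on k W (\<lambda>x. f' x v)" using Suc.IH by blast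
  with f' show ?case unfolding Ck_on.simps(2) by blast
qed

lemma Ck_on_const: "Ck_on k W (\<lambda>x. c)"
proof (induction k arbitrary: c)
  case (Suc k)
  show ?case by (simp, rule exI[of _ "\<lambda>x v. 0"]) (simp add: Suc)
qed simp

lemma Ck_on_bounded_linear:
  assumes "bounded_linear L" "Ck_on k W f"
  shows "Ck_on k W (\<lambda>x. L (f x))"
  using assms(2)
proof (induction k arbitrary: f)
  case 0
  then show ?case using bounded_linear.continuous_on[OF assms(1)] by simp
next
  case (Suc k)
  from Suc.prems obtain f' where f': "\<And>x. x \<in> W \<Longrightarrow> (f has_derivative f' x) (at x)"
    "\<And>v. Ck_on k W (\<lambda>x. f' x v)" by auto
  show ?case
    by (rule Ck_on_SucI[of _ _ "\<lambda>x v. L (f' x v)"])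
      (intro bounded_linear.has_derivative[OF assms(1)] f' Suc.IH; assumption)+
qed

lemma Ck_on_add: "Ck_on k W f \<Longrightarrow> Ck_on k W g \<Longrightarrow> Ck_on k W (\<lambda>x. f x + g x)"
proof (induction k arbitrary: f g)
  case 0
  then show ?case by (simp add: continuous_on_add)
next
  case (Suc k)
  obtain f' where f': "\<And>x. x \<in> W \<Longrightarrow> (f has_derivative f' x) (at x)"
    "\<And>v. Ck_on k W (\<lambda>x. f' x v)" using Ck_on_SucE[OF Suc.prems(1)] by blast
  obtain g' where g': "\<And>x. x \<in> W \<Longrightarrow> (g has_derivative g' x) (at x)"
    "\<And>v. Ck_on k W (\<lambda>x. g' x v)" using Ck_on_SucE[OF Suc.prems(2)] by blast
  show ?case
    by (rule Ck_on_SucI[of _ _ "\<lambda>x v. f' x v + g' x v"])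
      (intro has_derivative_add f' g' Suc.IH; assumption)+
qed

lemma Ck_on_bilinear:
  assumes "bounded_bilinear B" "Ck_on k W f" "Ck_on k W g"
  shows "Ck_on k W (\<lambda>x. B (f x) (g x))"
  using assms(2,3)
proof (induction k arbitrary: f g)
  case 0
  then show ?case by (simp add: bounded_bilinear.continuous_on[OF assms(1)])
next
  case (Suc k)
  obtain f' where f': "\<And>x. x \<in> W \<Longrightarrow> (f has_derivative f' x) (at x)"
    "\<And>v. Ck_on k W (\<lambda>x. f' x v)" using Ck_on_SucE[OF Suc.prems(1)] by blast
  obtain g' where g': "\<And>x. x \<in> W \<Longrightarrow> (g has_derivative g' x) (at x)"
    "\<And>v. Ck_on k W (\<lambda>x. g' x v)" using Ck_on_SucE[OF Suc.prems(2)] by blast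
  have fg: "Ck_on k W f" "Ck_on k W g" using Suc.prems Ck_on_Suc_imp by blast+
  show ?case
    unfolding Ck_on.simps
  proof (intro exI[of _ "\<lambda>x v. B (f x) (g' x v) + B (f' x v) (g x)"] conjI ballI allI)
    fix x assume "x \<in> W"
    then show "((\<lambda>x. B (f x) (g x)) has_derivative (\<lambda>v. B (f x) (g' x v) + B (f' x v) (g x))) (at x)"
      using bounded_bilinear.FDERIV[OF assms(1) f'(1) g'(1)] by simp
  next
    fix v
    show "Ck_on k W (\<lambda>x. B (f x) (g' x v) + B (f' x v) (g x))"
      by (intro Ck_on_add Suc.IH fg f'(2) g'(2))
  qed
qed

lemma Ck_on_id: "Ck_on k W (\<lambda>x. x)"
proof (cases k)
  case (Suc m)
  then show ?thesis by (simp, intro exI[of _ "\<lambda>x v. v"]) (simp add: Ck_on_const)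
qed simp

lemma Ck_on_sum:
  "(\<And>i. i \<in> I \<Longrightarrow> Ck_on k W (f i)) \<Longrightarrow> Ck_on k W (\<lambda>x. \<Sum>i\<in>I. f i x)"
  by (induction I rule: infinite_finite_induct) (simp_all add: Ck_on_const Ck_on_add)

text \<open>The chain rule yields \<open>g' (f x) (f' x v)\<close>, whose vector argument moves with
  x, whereas \<open>Ck_on\<close> controls \<open>g' y b\<close> for fixed b only. Expanding
  \<open>f' x v\<close> in the standard basis gives a sum of products to which the induction
  applies; this is why the intermediate space is Euclidean.\<close>

lemma Ck_on_compose:
  fixes f :: "'v::real_normed_vector \<Rightarrow> 'w::euclidean_space" and g :: "'w \<Rightarrow> 'z::real_normed_vector"
  assumes "Ck_on k W f" "Ck_on k W' g" "f ` W \<subseteq> W'"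
  shows "Ck_on k W (\<lambda>x. g (f x))"
  using assms
proof (induction k arbitrary: g)
  case 0
  then show ?case by (auto intro: continuous_on_compose2)
next
  case (Suc k)
  obtain f' where f': "\<And>x. x \<in> W \<Longrightarrow> (f has_derivative f' x) (at x)"
    "\<And>v. Ck_on k W (\<lambda>x. f' x v)" using Ck_on_SucE[OF Suc.prems(1)] by blast
  obtain g' where g': "\<And>x. x \<in> W' \<Longrightarrow> (g has_derivative g' x) (at x)"
    "\<And>v. Ck_on k W' (\<lambda>x. g' x v)" using Ck_on_SucE[OF Suc.prems(2)] by blast
  have Cf: "Ck_on k W f" using Suc.prems Ck_on_Suc_imp by blast
  have eq: "g' (f x) (f' x v) = (\<Sum>b\<in>Basis. (f' x v \<bullet> b) *\<^sub>R g' (f x) b)" if "x \<in> W" for x v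
  proof -
    have "f x \<in> W'" using that Suc.prems by auto
    then have lin: "linear (g' (f x))"
      using g'(1) has_derivative_linear by blast
    have "g' (f x) (f' x v) = g' (f x) (\<Sum>b\<in>Basis. (f' x v \<bullet> b) *\<^sub>R b)"
      by (simp add: euclidean_representation)
    also have "\<dots> = (\<Sum>b\<in>Basis. (f' x v \<bullet> b) *\<^sub>R g' (f x) b)"
      by (simp add: linear_sum[OF lin] linear_scale[OF lin])
    finally show ?thesis .
  qed
  show ?case
    unfolding Ck_on.simps
  proof (intro exI[of _ "\<lambda>x v. if x \<in> W then g' (f x) (f' x v) else (\<Sum>b\<in>Basis. (f' x v \<bullet> b) *\<^sub>R g' (f x) b)"] conjI ballI allI)
    fix x assume x: "x \<in> W"
    then have "((\<lambda>x. g (f x)) has_derivative (\<lambda>v. g' (f x) (f' x v))) (at x)"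
      using has_derivative_compose[OF f'(1)[OF x], of g "g' (f x)"] g'(1) Suc.prems(3) by auto
    with x show "((\<lambda>x. g (f x)) has_derivative (\<lambda>v. if x \<in> W then g' (f x) (f' x v) else (\<Sum>b\<in>Basis. (f' x v \<bullet> b) *\<^sub>R g' (f x) b))) (at x)" by simp
  next
    fix v
    have "(\<lambda>x. if x \<in> W then g' (f x) (f' x v) else (\<Sum>b\<in>Basis. (f' x v \<bullet> b) *\<^sub>R g' (f x) b))
      = (\<lambda>x. \<Sum>b\<in>Basis. (f' x v \<bullet> b) *\<^sub>R g' (f x) b)"
      using eq by auto
    moreover have "Ck_on k W (\<lambda>x. \<Sum>b\<in>Basis. (f' x v \<bullet> b) *\<^sub>R g' (f x) b)"
      by (intro Ck_on_sum Ck_on_bilinear[OF bounded_bilinear_scaleR]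
        Ck_on_bounded_linear[OF bounded_linear_inner_left] f'(2) Suc.IH Cf g'(2) Suc.prems(3))
    ultimately show "Ck_on k W (\<lambda>x. if x \<in> W then g' (f x) (f' x v) else (\<Sum>b\<in>Basis. (f' x v \<bullet> b) *\<^sub>R g' (f x) b))"
      by simp
  qed
qed

definition Cinf :: "'v::real_normed_vector set \<Rightarrow> ('v \<Rightarrow> 'w::real_normed_vector) \<Rightarrow> bool" where
  "Cinf W f \<longleftrightarrow> (\<forall>k. Ck_on k W f)"

lemma Cinf_subset: "Cinf W f \<Longrightarrow> V \<subseteq> W \<Longrightarrow> Cinf V f"
  unfolding Cinf_def using Ck_on_subset by blast

lemma Cinf_const [simp]: "Cinf W (\<lambda>x. c)"
  by (simp add: Cinf_def Ck_on_const)

lemma Cinf_id [simp]: "Cinf W (\<lambda>x. x)"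
  by (simp add: Cinf_def Ck_on_id)

lemma Cinf_add: "Cinf W f \<Longrightarrow> Cinf W g \<Longrightarrow> Cinf W (\<lambda>x. f x + g x)"
  by (simp add: Cinf_def Ck_on_add)

lemma Cinf_bounded_linear: "bounded_linear L \<Longrightarrow> Cinf W f \<Longrightarrow> Cinf W (\<lambda>x. L (f x))"
  by (simp add: Cinf_def Ck_on_bounded_linear)

lemma Cinf_bilinear: "bounded_bilinear B \<Longrightarrow> Cinf W f \<Longrightarrow> Cinf W g \<Longrightarrow> Cinf W (\<lambda>x. B (f x) (g x))"
  by (simp add: Cinf_def Ck_on_bilinear)

lemma Cinf_compose:
  fixes f :: "'v::real_normed_vector \<Rightarrow> 'w::euclidean_space" and g :: "'w \<Rightarrow> 'z::real_normed_vector"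
  shows "Cinf W f \<Longrightarrow> Cinf W' g \<Longrightarrow> f ` W \<subseteq> W' \<Longrightarrow> Cinf W (\<lambda>x. g (f x))"
  unfolding Cinf_def using Ck_on_compose by blast

lemma Cinf_imp_continuous_on: "Cinf W f \<Longrightarrow> continuous_on W f"
  unfolding Cinf_def using Ck_on.simps(1) by blast

text \<open>\<open>Cinf\<close> provides a derivative for each order separately. On an open set the
  Frechet derivative is unique, so all of them agree with \<open>frechet_derivative\<close> and one
  \<open>f'\<close> serves every order.\<close>

lemma Cinf_derivativeE:
  assumes "open W" "Cinf W f"
  obtains f' where "\<And>x. x \<in> W \<Longrightarrow> (f has_derivative f' x) (at x)" "\<And>v. Cinf W (\<lambda>x. f' x v)"
proof -
  define F where "F x = frechet_derivative f (at x)" for x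
  have "Ck_on (Suc 0) W f" using assms unfolding Cinf_def by blast
  then obtain f0 where "\<And>x. x \<in> W \<Longrightarrow> (f has_derivative f0 x) (at x)" by auto
  then have F: "(f has_derivative F x) (at x)" if "x \<in> W" for x
    using that unfolding F_def by (metis frechet_derivative_at)
  have "Ck_on k W (\<lambda>x. F x v)" for k v
  proof -
    have "Ck_on (Suc k) W f" using assms unfolding Cinf_def by blast
    then obtain f' where f': "\<And>x. x \<in> W \<Longrightarrow> (f has_derivative f' x) (at x)" "Ck_on k W (\<lambda>x. f' x v)"
      by auto
    have "f' x v = F x v" if "x \<in> W" for x
      using has_derivative_unique[OF f'(1)[OF that] F[OF that]] by simp
    then show ?thesis using Ck_on_cong[OF assms(1) _ f'(2)] by simp
  qed
  with F that show ?thesis unfolding Cinf_def by blast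
qed

section \<open>Symmetry of second derivatives\<close>

text \<open>The mean value theorem is applied to the second difference over a parallelogram, once
  along v and then once along w. The order of these two steps decides which mixed derivative
  appears.\<close>

lemma mixed_difference_mean_value:
  fixes g :: "'v::real_normed_vector \<Rightarrow> real"
  assumes g': "\<And>y. y \<in> W \<Longrightarrow> (g has_derivative g' y) (at y)"
    and g'': "\<And>y. y \<in> W \<Longrightarrow> ((\<lambda>z. g' z v) has_derivative g'' y) (at y)"
    and t: "0 < t" and seg: "\<And>a b. 0 \<le> a \<Longrightarrow> a \<le> t \<Longrightarrow> 0 \<le> b \<Longrightarrow> b \<le> t \<Longrightarrow> x + a *\<^sub>R v + b *\<^sub>R w \<in> W"
  obtains a b where "0 \<le> a" "a \<le> t" "0 \<le> b" "b \<le> t"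
    "g (x + t *\<^sub>R v + t *\<^sub>R w) - g (x + t *\<^sub>R v) - g (x + t *\<^sub>R w) + g x = t\<^sup>2 * g'' (x + a *\<^sub>R v + b *\<^sub>R w) w"
proof -
  define h where "h s = g (x + s *\<^sub>R v + t *\<^sub>R w) - g (x + s *\<^sub>R v)" for s
  have W0: "x + s *\<^sub>R v \<in> W" if "0 \<le> s" "s \<le> t" for s
    using seg[of s 0] that t by simp
  have h': "(h has_real_derivative (g' (x + s *\<^sub>R v + t *\<^sub>R w) v - g' (x + s *\<^sub>R v) v)) (at s)"
    if "0 \<le> s" "s \<le> t" for s
  proof -
    have 1: "((\<lambda>s. x + s *\<^sub>R v + t *\<^sub>R w) has_derivative (\<lambda>r. r *\<^sub>R v)) (at s)"
      "((\<lambda>s. x + s *\<^sub>R v) has_derivative (\<lambda>r. r *\<^sub>R v)) (at s)"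
      by (auto intro!: derivative_eq_intros)
    have lin: "linear (g' (x + s *\<^sub>R v + t *\<^sub>R w))" "linear (g' (x + s *\<^sub>R v))"
      using has_derivative_linear[OF g'] seg[of s t] W0 that t by auto
    have "(h has_derivative (\<lambda>r. g' (x + s *\<^sub>R v + t *\<^sub>R w) (r *\<^sub>R v) - g' (x + s *\<^sub>R v) (r *\<^sub>R v))) (at s)"
      unfolding h_def
      by (intro has_derivative_diff has_derivative_compose[OF 1(1)] has_derivative_compose[OF 1(2)] g')
        (use seg[of s t] W0 that t in auto)
    then show ?thesis
      unfolding has_field_derivative_def
      by (rule has_derivative_eq_rhs) (simp only: fun_eq_iff linear_scale[OF lin(1)] linear_scale[OF lin(2)] real_scaleR_def right_diff_distrib mult.commute, simp)
  qed
  obtain a where a: "0 < a" "a < t" "h t - h 0 = t * (g' (x + a *\<^sub>R v + t *\<^sub>R w) v - g' (x + a *\<^sub>R v) v)"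
    using MVT2[OF t, of h "\<lambda>s. g' (x + s *\<^sub>R v + t *\<^sub>R w) v - g' (x + s *\<^sub>R v) v"] h' by auto
  define k where "k s = g' (x + a *\<^sub>R v + s *\<^sub>R w) v" for s
  have k': "(k has_real_derivative g'' (x + a *\<^sub>R v + s *\<^sub>R w) w) (at s)" if "0 \<le> s" "s \<le> t" for s
  proof -
    have 1: "((\<lambda>s. x + a *\<^sub>R v + s *\<^sub>R w) has_derivative (\<lambda>r. r *\<^sub>R w)) (at s)"
      by (auto intro!: derivative_eq_intros)
    have lin: "linear (g'' (x + a *\<^sub>R v + s *\<^sub>R w))"
      using has_derivative_linear[OF g''] seg[of a s] that a by auto
    have "(k has_derivative (\<lambda>r. g'' (x + a *\<^sub>R v + s *\<^sub>R w) (r *\<^sub>R w))) (at s)"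
      unfolding k_def
      by (intro has_derivative_compose[OF 1(1)] g'') (use seg[of a s] that a in auto)
    then show ?thesis
      unfolding has_field_derivative_def
      by (rule has_derivative_eq_rhs) (simp only: fun_eq_iff linear_scale[OF lin] real_scaleR_def mult.commute, simp)
  qed
  obtain b where b: "0 < b" "b < t" "k t - k 0 = t * g'' (x + a *\<^sub>R v + b *\<^sub>R w) w"
    using MVT2[OF t, of k "\<lambda>s. g'' (x + a *\<^sub>R v + s *\<^sub>R w) w"] k' by auto
  have "h t - h 0 = t * (k t - k 0)" using a(3) by (simp add: k_def)
  with b have "h t - h 0 = t\<^sup>2 * g'' (x + a *\<^sub>R v + b *\<^sub>R w) w" by (simp add: power2_eq_square)
  then show ?thesis using a b that[of a b] by (simp add: h_def algebra_simps)
qed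

text \<open>The second difference is symmetric in v and w, so exchanging the order in the mean value
  theorem equates a value of one mixed derivative with a value of the other, at two points near x.
  Continuity at x then excludes different values there.\<close>

lemma second_derivative_symmetric_real:
  fixes g :: "'v::real_normed_vector \<Rightarrow> real"
  assumes W: "open W" "x \<in> W"
    and g': "\<And>y. y \<in> W \<Longrightarrow> (g has_derivative g' y) (at y)"
    and gv: "\<And>y. y \<in> W \<Longrightarrow> ((\<lambda>z. g' z v) has_derivative gv y) (at y)"
    and gw: "\<And>y. y \<in> W \<Longrightarrow> ((\<lambda>z. g' z w) has_derivative gw y) (at y)"
    and cv: "continuous_on W (\<lambda>y. gv y w)" and cw: "continuous_on W (\<lambda>y. gw y v)"
  shows "gv x w = gw x v"
proof (rule ccontr)
  assume neq: "gv x w \<noteq> gw x v"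
  \<comment> \<open>Half the gap: a number at distance less than e from \<open>gv x w\<close> cannot
    also be at distance less than e from \<open>gw x v\<close>.\<close>
  define e where "e = \<bar>gv x w - gw x v\<bar> / 2"
  have e: "e > 0" using neq by (simp add: e_def)
  have "continuous (at x) (\<lambda>y. gv y w)" and cw': "continuous (at x) (\<lambda>y. gw y v)"
    using cv cw W by (simp_all add: continuous_on_eq_continuous_at)
  then obtain d1 where d1: "d1 > 0" "\<And>y. dist y x < d1 \<Longrightarrow> dist (gv y w) (gv x w) < e"
    using e unfolding continuous_at_eps_delta by blast
  obtain d2 where d2: "d2 > 0" "\<And>y. dist y x < d2 \<Longrightarrow> dist (gw y v) (gw x v) < e"
    using cw' e unfolding continuous_at_eps_delta by blast
  obtain d3 where d3: "d3 > 0" "ball x d3 \<subseteq> W"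
    using W open_contains_ball by blast
  define d where "d = min d1 (min d2 d3)"
  have d: "d > 0" using d1 d2 d3 by (simp add: d_def)
  \<comment> \<open>With this side length the whole parallelogram stays within d / 2 of x; the
    summand 1 covers the case v = w = 0.\<close>
  define t where "t = d / (2 * (norm v + norm w + 1))"
  have nz: "norm v + norm w + 1 > 0" by (simp add: add_nonneg_pos)
  then have t: "t > 0" using d by (simp add: t_def)
  have near: "norm (a *\<^sub>R v + b *\<^sub>R w) < d" if "0 \<le> a" "a \<le> t" "0 \<le> b" "b \<le> t" for a b
  proof -
    have "norm (a *\<^sub>R v + b *\<^sub>R w) \<le> a * norm v + b * norm w"
      using norm_triangle_ineq[of "a *\<^sub>R v" "b *\<^sub>R w"] that by simp
    also have "\<dots> \<le> t * norm v + t * norm w"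
      using that by (intro add_mono mult_right_mono) auto
    also have "\<dots> \<le> t * (norm v + norm w + 1)" using t by (simp add: algebra_simps)
    also have "\<dots> = d / 2" using nz by (simp add: t_def field_simps)
    also have "\<dots> < d" using d by simp
    finally show ?thesis .
  qed
  have seg: "x + a *\<^sub>R v + b *\<^sub>R w \<in> W" if "0 \<le> a" "a \<le> t" "0 \<le> b" "b \<le> t" for a b
  proof -
    have "x + a *\<^sub>R v + b *\<^sub>R w \<in> ball x d3"
      using near[OF that] dist_add_cancel[of x 0 "a *\<^sub>R v + b *\<^sub>R w"] by (simp add: d_def add.assoc)
    then show ?thesis using d3 by auto
  qed
  have seg': "x + a *\<^sub>R w + b *\<^sub>R v \<in> W" if "0 \<le> a" "a \<le> t" "0 \<le> b" "b \<le> t" for a b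
    using seg[of b a] that by (simp add: algebra_simps)
  obtain a b where ab: "0 \<le> a" "a \<le> t" "0 \<le> b" "b \<le> t"
    "g (x + t *\<^sub>R v + t *\<^sub>R w) - g (x + t *\<^sub>R v) - g (x + t *\<^sub>R w) + g x = t\<^sup>2 * gv (x + a *\<^sub>R v + b *\<^sub>R w) w"
    using mixed_difference_mean_value[of W g g' v gv t x w] g' gv t seg by blast
  obtain a' b' where ab': "0 \<le> a'" "a' \<le> t" "0 \<le> b'" "b' \<le> t"
    "g (x + t *\<^sub>R w + t *\<^sub>R v) - g (x + t *\<^sub>R w) - g (x + t *\<^sub>R v) + g x = t\<^sup>2 * gw (x + a' *\<^sub>R w + b' *\<^sub>R v) v"
    using mixed_difference_mean_value[of W g g' w gw t x v] g' gw t seg' by blast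
  have "t\<^sup>2 * gv (x + a *\<^sub>R v + b *\<^sub>R w) w = t\<^sup>2 * gw (x + a' *\<^sub>R w + b' *\<^sub>R v) v"
    using ab(5) ab'(5) by (simp add: algebra_simps)
  then have eq: "gv (x + a *\<^sub>R v + b *\<^sub>R w) w = gw (x + a' *\<^sub>R w + b' *\<^sub>R v) v" using t by simp
  have "dist (x + a *\<^sub>R v + b *\<^sub>R w) x < d" "dist (x + a' *\<^sub>R w + b' *\<^sub>R v) x < d"
    using near[OF ab(1-4)] near[OF ab'(3,4,1,2)] by (simp_all add: dist_norm algebra_simps)
  then have "dist (gv (x + a *\<^sub>R v + b *\<^sub>R w) w) (gv x w) < e"
    "dist (gw (x + a' *\<^sub>R w + b' *\<^sub>R v) v) (gw x v) < e"
    using d1 d2 by (simp_all add: d_def)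
  moreover have "dist (gv x w) (gw x v) = 2 * e" by (simp add: e_def dist_real_def)
  ultimately show False
    using eq dist_triangle3[of "gv x w" "gw x v" "gv (x + a *\<^sub>R v + b *\<^sub>R w) w"] by simp
qed

lemma second_derivative_symmetric:
  fixes g :: "'v::real_normed_vector \<Rightarrow> 'w::euclidean_space"
  assumes W: "open W" "x \<in> W" and "Cinf W g"
    and g': "\<And>y. y \<in> W \<Longrightarrow> (g has_derivative g' y) (at y)"
    and gv: "((\<lambda>z. g' z v) has_derivative gv) (at x)"
    and gw: "((\<lambda>z. g' z w) has_derivative gw) (at x)"
  shows "gv w = gw v"
proof (rule euclidean_eqI)
  fix b :: 'w assume "b \<in> Basis"
  obtain G where G: "\<And>y. y \<in> W \<Longrightarrow> (g has_derivative G y) (at y)" "\<And>v. Cinf W (\<lambda>x. G x v)"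
    using Cinf_derivativeE[OF W(1) assms(3)] by blast
  have eq: "g' y = G y" if "y \<in> W" for y
    using has_derivative_unique[OF g'[OF that] G(1)[OF that]] .
  obtain V where V: "\<And>y. y \<in> W \<Longrightarrow> ((\<lambda>z. G z v) has_derivative V y) (at y)" "\<And>u. Cinf W (\<lambda>x. V x u)"
    using Cinf_derivativeE[OF W(1) G(2)] by blast
  obtain U where U: "\<And>y. y \<in> W \<Longrightarrow> ((\<lambda>z. G z w) has_derivative U y) (at y)" "\<And>u. Cinf W (\<lambda>x. U x u)"
    using Cinf_derivativeE[OF W(1) G(2)] by blast
  have "gv = V x"
    by (rule has_derivative_unique[OF _ V(1)[OF W(2)]])
      (rule has_derivative_transform_within_open[OF gv W], simp add: eq)
  moreover have "gw = U x"
    by (rule has_derivative_unique[OF _ U(1)[OF W(2)]])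
      (rule has_derivative_transform_within_open[OF gw W], simp add: eq)
  moreover have "V x w \<bullet> b = U x v \<bullet> b"
    by (rule second_derivative_symmetric_real[OF W, of "\<lambda>y. g y \<bullet> b" "\<lambda>y u. G y u \<bullet> b" v "\<lambda>y u. V y u \<bullet> b" w "\<lambda>y u. U y u \<bullet> b"])
      (assumption | rule has_derivative_inner_left G(1) V(1) U(1) Cinf_imp_continuous_on
        Cinf_bounded_linear[OF bounded_linear_inner_left] V(2) U(2))+
  ultimately show "gv w \<bullet> b = gw v \<bullet> b" by simp
qed

section \<open>Bump functions\<close>

text \<open>exp(-1/x) times powers of 1/x, extended by 0. Up to linear combinations the family is
  closed under differentiation, so smoothness follows by one induction for all n
  simultaneously.\<close>

definition flat_fun :: "nat \<Rightarrow> real \<Rightarrow> real" where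
  "flat_fun n x = (if x > 0 then exp (- inverse x) * inverse x ^ n else 0)"

lemma flat_fun_tendsto: "(flat_fun n \<longlongrightarrow> 0) (at 0)"
proof -
  have "((\<lambda>x::real. exp (- inverse x) * inverse x ^ n) \<longlongrightarrow> 0) (at_right 0)"
  proof -
    have "((\<lambda>y::real. y ^ n / exp y) \<longlongrightarrow> 0) at_top" by (rule tendsto_power_div_exp_0)
    then have "((\<lambda>y::real. exp (- y) * y ^ n) \<longlongrightarrow> 0) at_top"
      by (simp add: exp_minus field_simps)
    from filterlim_compose[OF this filterlim_inverse_at_top_right] show ?thesis .
  qed
  then have R: "(flat_fun n \<longlongrightarrow> 0) (at_right 0)"
    by (rule Lim_transform_eventually)
      (auto simp: flat_fun_def eventually_at_filter)
  have L: "(flat_fun n \<longlongrightarrow> 0) (at_left 0)"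
    by (rule Lim_transform_eventually[OF tendsto_const])
      (auto simp: flat_fun_def eventually_at_filter)
  from L R show ?thesis by (simp add: filterlim_split_at)
qed

lemma flat_fun_deriv:
  "(flat_fun n has_real_derivative (flat_fun (n + 2) x - real n * flat_fun (Suc n) x)) (at x)"
proof (cases x "0::real" rule: linorder_cases)
  case less
  have "((\<lambda>x. 0) has_real_derivative 0) (at x)" by simp
  then have "(flat_fun n has_real_derivative 0) (at x)"
    by (rule has_field_derivative_transform_within_open[of _ _ _ "{..<0}"])
      (use less in \<open>auto simp: flat_fun_def\<close>)
  then show ?thesis using less by (simp add: flat_fun_def)
next
  case equal
  \<comment> \<open>At 0 the difference quotient of \<open>flat_fun n\<close> is
    \<open>flat_fun (Suc n)\<close>, so the limit known for every index gives the derivative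
    0.\<close>
  have "((\<lambda>h. flat_fun n h / h) \<longlongrightarrow> 0) (at 0)"
    by (rule Lim_transform_eventually[OF flat_fun_tendsto[of "Suc n"]])
      (auto simp: flat_fun_def eventually_at_filter field_simps)
  then have "(flat_fun n has_real_derivative 0) (at 0)"
    by (simp add: has_field_derivative_iff flat_fun_def[of _ 0])
  then show ?thesis using equal by (simp add: flat_fun_def)
next
  case greater
  have i: "(inverse has_real_derivative - (inverse x ^ 2)) (at x)"
    using DERIV_inverse[of x] greater by (simp add: power2_eq_square)
  have "((\<lambda>x. exp (- inverse x) * inverse x ^ n) has_real_derivative
      exp (- inverse x) * inverse x ^ 2 * inverse x ^ n
      + real n * - (inverse x ^ 2) * inverse x ^ (n - 1) * exp (- inverse x)) (at x)"
    by (rule DERIV_mult[OF DERIV_fun_exp[OF DERIV_minus[OF i], simplified] DERIV_power[OF i, of n, simplified], THEN DERIV_cong]) simp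
  moreover have "exp (- inverse x) * inverse x ^ 2 * inverse x ^ n
      + real n * - (inverse x ^ 2) * inverse x ^ (n - 1) * exp (- inverse x)
      = flat_fun (n + 2) x - real n * flat_fun (Suc n) x"
    using greater by (cases n) (simp_all add: flat_fun_def power2_eq_square algebra_simps)
  ultimately have "((\<lambda>x. exp (- inverse x) * inverse x ^ n) has_real_derivative
    (flat_fun (n + 2) x - real n * flat_fun (Suc n) x)) (at x)" by simp
  then show ?thesis
    by (rule has_field_derivative_transform_within_open[of _ _ _ "{0<..}"])
      (use greater in \<open>auto simp: flat_fun_def\<close>)
qed

lemma Cinf_flat_fun: "Cinf UNIV (flat_fun n)"
proof -
  have "Ck_on k UNIV (flat_fun n)" for k
  proof (induction k arbitrary: n)
    case 0
    then show ?case
      using DERIV_isCont[OF flat_fun_deriv] by (simp add: continuous_at_imp_continuous_on)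
  next
    case (Suc k)
    show ?case
    proof (rule Ck_on_SucI)
      show "(flat_fun n has_derivative (\<lambda>v. (flat_fun (n + 2) x + (- real n) * flat_fun (Suc n) x) * v)) (at x)" for x
        using flat_fun_deriv[of n x] by (simp add: has_field_derivative_def)
      show "Ck_on k UNIV (\<lambda>x. (flat_fun (n + 2) x + (- real n) * flat_fun (Suc n) x) * v)" for v
        by (intro Ck_on_bilinear[OF bounded_bilinear_mult] Ck_on_add Suc Ck_on_const)
    qed
  qed
  then show ?thesis by (simp add: Cinf_def)
qed

lemma Cinf_inverse: "Cinf {x::real. x \<noteq> 0} inverse"
proof -
  have "Ck_on k {x::real. x \<noteq> 0} inverse" for k
  proof (induction k)
    case 0
    then show ?case by (simp add: continuous_on_inverse)
  next
    case (Suc k)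
    show ?case
      by (rule Ck_on_SucI[of _ _ "\<lambda>x v. - (inverse x * v * inverse x)"])
        (auto intro!: has_derivative_inverse' Ck_on_bilinear[OF bounded_bilinear_mult] Suc Ck_on_const
          Ck_on_bounded_linear[OF bounded_linear_minus[OF bounded_linear_ident]])
  qed
  then show ?thesis by (simp add: Cinf_def)
qed

text \<open>The quotient A / (A + B), where A vanishes exactly at distance at least s and B exactly
  at distance at most r; as r < s, they have no common zero. The squared distance replaces the
  distance, which is not smooth at the centre.\<close>

lemma smooth_plateau:
  fixes x :: "'b::euclidean_space"
  assumes "0 < r" "r < s"
  obtains h :: "'b \<Rightarrow> real" where "Cinf UNIV h" "\<And>y. dist x y \<le> r \<Longrightarrow> h y = 1" "\<And>y. dist x y \<ge> s \<Longrightarrow> h y = 0"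
proof -
  define q where "q y = (y - x) \<bullet> (y - x)" for y
  have q: "q y = (dist x y)\<^sup>2" for y by (simp add: q_def dist_norm power2_norm_eq_inner inner_diff_left inner_diff_right inner_commute)
  define A where "A y = flat_fun 0 (s\<^sup>2 - q y)" for y
  define B where "B y = flat_fun 0 (q y - r\<^sup>2)" for y
  have rs: "r\<^sup>2 < s\<^sup>2" using assms by (simp add: power_strict_mono)
  have pos: "A y + B y > 0" for y
    using rs by (cases "q y < s\<^sup>2") (simp_all add: A_def B_def flat_fun_def add_pos_nonneg)
  have Cd: "Cinf UNIV (\<lambda>y. y - x)" using Cinf_add[OF Cinf_id Cinf_const[of UNIV "- x"]] by simp
  have Cq: "Cinf UNIV q" unfolding q_def by (intro Cinf_bilinear[OF bounded_bilinear_inner] Cd)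
  have C1: "Cinf UNIV (\<lambda>y. q y - r\<^sup>2)" using Cinf_add[OF Cq Cinf_const[of UNIV "- r\<^sup>2"]] by simp
  have C2: "Cinf UNIV (\<lambda>y. s\<^sup>2 - q y)"
    using Cinf_add[OF Cinf_const[of UNIV "s\<^sup>2"] Cinf_bounded_linear[OF bounded_linear_minus[OF bounded_linear_ident] Cq]] by simp
  have CA: "Cinf UNIV A" unfolding A_def by (rule Cinf_compose[OF C2 Cinf_flat_fun]) simp
  have CB: "Cinf UNIV B" unfolding B_def by (rule Cinf_compose[OF C1 Cinf_flat_fun]) simp
  have "A y + B y \<noteq> 0" for y using pos[of y] by simp
  then have "(\<lambda>y. A y + B y) ` UNIV \<subseteq> {x. x \<noteq> 0}" by auto
  from Cinf_compose[OF Cinf_add[OF CA CB] Cinf_inverse this]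
  have "Cinf UNIV (\<lambda>y. A y * inverse (A y + B y))"
    by (rule Cinf_bilinear[OF bounded_bilinear_mult CA])
  moreover have "A y * inverse (A y + B y) = 1" if "dist x y \<le> r" for y
  proof -
    have "q y \<le> r\<^sup>2" using that unfolding q by (simp add: power_mono)
    then have "B y = 0" by (simp add: B_def flat_fun_def)
    then show ?thesis using pos[of y] by simp
  qed
  moreover have "A y * inverse (A y + B y) = 0" if "dist x y \<ge> s" for y
  proof -
    have "s\<^sup>2 \<le> q y" using that assms unfolding q by (simp add: power_mono)
    then show ?thesis by (simp add: A_def flat_fun_def)
  qed
  ultimately show ?thesis using that by blast
qed

section \<open>Calculus in charts whose images are relatively open in sectors\<close>

section \<open>Local smoothness\<close>

definition smooth_near :: "'v::real_normed_vector set \<Rightarrow> ('v \<Rightarrow> 'w::real_normed_vector) \<Rightarrow> 'v \<Rightarrow> bool" where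
  "smooth_near S f x \<longleftrightarrow> (\<exists>W g. open W \<and> x \<in> W \<and> Cinf W g \<and> (\<forall>y\<in>S \<inter> W. g y = f y))"

lemma smooth_on_set_iff: "smooth_on_set S f \<longleftrightarrow> (\<forall>x\<in>S. smooth_near S f x)"
  by (simp add: smooth_on_set_def smooth_near_def Cinf_def)

lemma smooth_nearI:
  "open W \<Longrightarrow> x \<in> W \<Longrightarrow> Cinf W g \<Longrightarrow> (\<And>y. y \<in> S \<Longrightarrow> y \<in> W \<Longrightarrow> g y = f y) \<Longrightarrow> smooth_near S f x"
  unfolding smooth_near_def by blast

lemma smooth_nearE:
  assumes "smooth_near S f x"
  obtains W g where "open W" "x \<in> W" "Cinf W g" "\<And>y. y \<in> S \<Longrightarrow> y \<in> W \<Longrightarrow> g y = f y"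
  using assms unfolding smooth_near_def by blast

lemma smooth_near_Cinf: "open W \<Longrightarrow> x \<in> W \<Longrightarrow> Cinf W f \<Longrightarrow> smooth_near S f x"
  by (rule smooth_nearI) auto

lemma smooth_near_const [simp]: "smooth_near S (\<lambda>y. c) x"
  by (rule smooth_near_Cinf[of UNIV]) auto

lemma smooth_near_cong:
  assumes "smooth_near S f x" "open V" "x \<in> V" "\<And>y. y \<in> S' \<inter> V \<Longrightarrow> y \<in> S \<and> f y = g y"
  shows "smooth_near S' g x"
proof -
  obtain W h where "open W" "x \<in> W" "Cinf W h" "\<And>y. y \<in> S \<Longrightarrow> y \<in> W \<Longrightarrow> h y = f y"
    using smooth_nearE[OF assms(1)] by blast
  with assms show ?thesis
    by (intro smooth_nearI[of "W \<inter> V" x h]) (auto intro: Cinf_subset)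
qed

lemma smooth_near_bounded_linear:
  assumes "bounded_linear L" "smooth_near S f x"
  shows "smooth_near S (\<lambda>y. L (f y)) x"
proof -
  obtain W h where "open W" "x \<in> W" "Cinf W h" "\<And>y. y \<in> S \<Longrightarrow> y \<in> W \<Longrightarrow> h y = f y"
    using smooth_nearE[OF assms(2)] by blast
  then show ?thesis
    by (intro smooth_nearI[of W x "\<lambda>y. L (h y)"] Cinf_bounded_linear[OF assms(1)]) auto
qed

lemma smooth_near_bilinear:
  assumes "bounded_bilinear B" "smooth_near S f x" "smooth_near S g x"
  shows "smooth_near S (\<lambda>y. B (f y) (g y)) x"
proof -
  obtain W h where 1: "open W" "x \<in> W" "Cinf W h" "\<And>y. y \<in> S \<Longrightarrow> y \<in> W \<Longrightarrow> h y = f y"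
    using smooth_nearE[OF assms(2)] by blast
  obtain V k where 2: "open V" "x \<in> V" "Cinf V k" "\<And>y. y \<in> S \<Longrightarrow> y \<in> V \<Longrightarrow> k y = g y"
    using smooth_nearE[OF assms(3)] by blast
  show ?thesis
    by (rule smooth_nearI[of "W \<inter> V" x "\<lambda>y. B (h y) (k y)"], use 1 2 in auto)
      (intro Cinf_bilinear[OF assms(1)] Cinf_subset[OF 1(3)] Cinf_subset[OF 2(3)]; blast)
qed

lemma smooth_near_add:
  assumes "smooth_near S f x" "smooth_near S g x"
  shows "smooth_near S (\<lambda>y. f y + g y) x"
proof -
  obtain W h where 1: "open W" "x \<in> W" "Cinf W h" "\<And>y. y \<in> S \<Longrightarrow> y \<in> W \<Longrightarrow> h y = f y"
    using smooth_nearE[OF assms(1)] by blast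
  obtain V k where 2: "open V" "x \<in> V" "Cinf V k" "\<And>y. y \<in> S \<Longrightarrow> y \<in> V \<Longrightarrow> k y = g y"
    using smooth_nearE[OF assms(2)] by blast
  show ?thesis
    by (rule smooth_nearI[of "W \<inter> V" x "\<lambda>y. h y + k y"], use 1 2 in auto)
      (intro Cinf_add Cinf_subset[OF 1(3)] Cinf_subset[OF 2(3)]; blast)
qed

lemma smooth_near_compose:
  fixes f :: "'v::real_normed_vector \<Rightarrow> 'w::euclidean_space" and g :: "'w \<Rightarrow> 'z::real_normed_vector"
  assumes "smooth_near S f x" "smooth_near S' g (f x)" "x \<in> S" "f ` S \<subseteq> S'"
  shows "smooth_near S (\<lambda>y. g (f y)) x"
proof -
  obtain W h where 1: "open W" "x \<in> W" "Cinf W h" "\<And>y. y \<in> S \<Longrightarrow> y \<in> W \<Longrightarrow> h y = f y"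
    using smooth_nearE[OF assms(1)] by blast
  obtain V k where 2: "open V" "f x \<in> V" "Cinf V k" "\<And>y. y \<in> S' \<Longrightarrow> y \<in> V \<Longrightarrow> k y = g y"
    using smooth_nearE[OF assms(2)] by blast
  have o: "open (W \<inter> h -` V)"
    using continuous_open_preimage[OF Cinf_imp_continuous_on[OF 1(3)] 1(1) 2(1)] .
  show ?thesis
  proof (rule smooth_nearI[OF o, of x "\<lambda>y. k (h y)"])
    show "x \<in> W \<inter> h -` V" using 1 2 assms by auto
    show "Cinf (W \<inter> h -` V) (\<lambda>y. k (h y))"
      by (rule Cinf_compose[OF Cinf_subset[OF 1(3)] 2(3)]) auto
    show "k (h y) = g (f y)" if "y \<in> S" "y \<in> W \<inter> h -` V" for y
      using that 1(4)[of y] 2(4)[of "f y"] assms(4) by auto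
  qed
qed

section \<open>Calculus in charts\<close>

abbreviation ch_inv :: "('a, 'b) chart \<Rightarrow> 'b \<Rightarrow> 'a" where
  "ch_inv c \<equiv> inv_into (fst c) (snd c)"

abbreviation ch_img :: "('a, 'b) chart \<Rightarrow> 'b set" where
  "ch_img c \<equiv> snd c ` fst c"

lemma chart_deriv_eq:
  "chart_deriv M c f p v = frechet_derivative (f \<circ> ch_inv c) (at (snd c p) within ch_img c) (model_proj M v)"
  by (cases c) (simp add: chart_deriv_def)

locale corner_mfd =
  fixes X :: "('a::{t2_space, second_countable_topology}, 'b::euclidean_space) corner_manifold"
  assumes mfd: "manifold_with_corners X"
begin

abbreviation P :: "'b \<Rightarrow> 'b" where "P \<equiv> model_proj X"
abbreviation cd :: "('a, 'b) chart \<Rightarrow> ('a \<Rightarrow> 'w::real_normed_vector) \<Rightarrow> 'a \<Rightarrow> 'b \<Rightarrow> 'w"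
  where "cd \<equiv> chart_deriv X"

lemma coords_Basis: "coords X \<subseteq> Basis" and finite_coords: "finite (coords X)"
proof -
  show 1: "coords X \<subseteq> Basis" using mfd by (simp add: manifold_with_corners_def)
  show "finite (coords X)" by (rule finite_subset[OF 1]) simp
qed

lemma bounded_linear_P: "bounded_linear P"
proof -
  have "bounded_linear (\<lambda>v. \<Sum>b\<in>coords X. (v \<bullet> b) *\<^sub>R b)"
    by (intro bounded_linear_sum bounded_linear_scaleR_const bounded_linear_inner_left)
  then show ?thesis unfolding model_proj_def .
qed

lemmas linear_P = bounded_linear.linear[OF bounded_linear_P]

lemma P_coords: "b \<in> coords X \<Longrightarrow> P b = b"
proof -
  assume b: "b \<in> coords X"
  have "P b = (\<Sum>b'\<in>coords X. if b' = b then b else 0)"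
    unfolding model_proj_def
    by (rule sum.cong[OF refl]) (use b coords_Basis in \<open>auto simp: inner_Basis subset_eq\<close>)
  then show ?thesis using b by (simp add: finite_coords)
qed

lemma P_idem [simp]: "P (P v) = P v"
proof -
  have "P (P v) = (\<Sum>b\<in>coords X. (v \<bullet> b) *\<^sub>R P b)"
    by (subst model_proj_def[of X v]) (simp only: linear_sum[OF linear_P] linear_scale[OF linear_P])
  also have "\<dots> = P v"
    unfolding model_proj_def[of X v] by (rule sum.cong) (simp_all add: P_coords)
  finally show ?thesis .
qed

lemma ex_chart: "\<exists>c\<in>charts X. p \<in> fst c"
  using mfd by (auto simp: manifold_with_corners_def)

lemma is_chart: "c \<in> charts X \<Longrightarrow> is_chart X c"
  using mfd by (simp add: manifold_with_corners_def)

lemma ch_open: "c \<in> charts X \<Longrightarrow> open (fst c)"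
  using is_chart[of c] by (auto simp: is_chart_def split: prod.splits)

lemma ch_homeo: "c \<in> charts X \<Longrightarrow> homeomorphism (fst c) (ch_img c) (snd c) (ch_inv c)"
  using is_chart[of c] by (auto simp: is_chart_def split: prod.splits)

lemma ch_inv [simp]: "c \<in> charts X \<Longrightarrow> p \<in> fst c \<Longrightarrow> ch_inv c (snd c p) = p"
  using ch_homeo[of c] by (simp add: homeomorphism_def)

lemma ch_inv_mem: "y \<in> ch_img c \<Longrightarrow> ch_inv c y \<in> fst c" "y \<in> ch_img c \<Longrightarrow> snd c (ch_inv c y) = y"
  by (auto simp: inv_into_into f_inv_into_f)

lemma ch_sector:
  assumes "c \<in> charts X"
  obtains K where "K \<subseteq> coords X" "openin (top_of_set (sector X K)) (ch_img c)"
  using is_chart[OF assms] by (auto simp: is_chart_def split: prod.splits)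

lemma P_ch: "c \<in> charts X \<Longrightarrow> p \<in> fst c \<Longrightarrow> P (snd c p) = snd c p"
proof -
  assume c: "c \<in> charts X" "p \<in> fst c"
  obtain K where "openin (top_of_set (sector X K)) (ch_img c)" using ch_sector[OF c(1)] .
  then have "ch_img c \<subseteq> sector X K" using openin_subset by fastforce
  then show ?thesis using c by (auto simp: sector_def)
qed

lemma ch_transition:
  assumes "c \<in> charts X" "c' \<in> charts X" "p \<in> fst c" "p \<in> fst c'"
  shows "smooth_near (snd c ` (fst c \<inter> fst c')) (\<lambda>y. snd c' (ch_inv c y)) (snd c p)"
proof -
  have "smooth_on_set (snd c ` (fst c \<inter> fst c')) (snd c' \<circ> ch_inv c)"
    using mfd assms(1,2) unfolding manifold_with_corners_def by (auto split: prod.splits)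
  then show ?thesis using assms by (auto simp: smooth_on_set_iff comp_def)
qed

lemma ch_open_image:
  assumes "c \<in> charts X" "open W"
  obtains V where "open V" "snd c ` (fst c \<inter> W) = ch_img c \<inter> V"
proof -
  have "openin (top_of_set (fst c)) (fst c \<inter> W)" using assms(2) by (simp add: openin_open_Int)
  from homeomorphism_imp_open_map[OF ch_homeo[OF assms(1)] this] show ?thesis
    using that by (auto simp: openin_open)
qed

lemma ch_inv_open_image:
  assumes "c \<in> charts X" "snd c ` (fst c \<inter> W) = ch_img c \<inter> V" "y \<in> ch_img c" "y \<in> V"
  shows "ch_inv c y \<in> W"
proof -
  have "y \<in> snd c ` (fst c \<inter> W)" using assms by blast
  then show ?thesis using assms(1) by auto
qed

text \<open>Increasing a coordinate preserves all inequalities of a sector, so short forward steps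
  along a coordinate vector stay in the chart image even at a corner.\<close>

lemma ch_step:
  assumes "c \<in> charts X" "p \<in> fst c" "b \<in> coords X"
  obtains d where "d > 0" "\<And>t. 0 \<le> t \<Longrightarrow> t < d \<Longrightarrow> snd c p + t *\<^sub>R b \<in> ch_img c"
proof -
  obtain K where K: "K \<subseteq> coords X" "openin (top_of_set (sector X K)) (ch_img c)"
    using ch_sector[OF assms(1)] .
  then obtain V where V: "open V" "ch_img c = sector X K \<inter> V" by (auto simp: openin_open)
  have x: "snd c p \<in> sector X K" "snd c p \<in> V" using V assms by auto
  obtain d where d: "d > 0" "ball (snd c p) d \<subseteq> V" using V x open_contains_ball by blast
  have nb: "norm b = 1" using assms coords_Basis by auto
  show ?thesis
  proof (rule that[OF d(1)])
    fix t assume t: "0 \<le> t" "t < d"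
    have "snd c p + t *\<^sub>R b \<in> ball (snd c p) d" using t nb by (simp add: dist_norm)
    moreover have "snd c p + t *\<^sub>R b \<in> sector X K"
    proof -
      have "0 \<le> b \<bullet> b'" if "b' \<in> K" for b'
        using that assms K coords_Basis by (cases "b = b'") (auto simp: inner_Basis subset_eq)
      then show ?thesis
        using x t assms P_coords
        by (simp add: sector_def linear_add[OF linear_P] linear_scale[OF linear_P] inner_add_left)
    qed
    ultimately show "snd c p + t *\<^sub>R b \<in> ch_img c" using V d by auto
  qed
qed

text \<open>One-sided difference quotients in the coordinate directions determine a derivative
  within the chart image, since the coordinate vectors span the model space. Directions orthogonal
  to the model space remain undetermined, hence \<open>P v\<close>.\<close>

lemma ch_derivative_unique:
  assumes c: "c \<in> charts X" "p \<in> fst c"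
    and A: "(F has_derivative A) (at (snd c p) within ch_img c)"
    and B: "(F has_derivative B) (at (snd c p) within ch_img c)"
  shows "A (P v) = B (P v)"
proof -
  have lin: "linear A" "linear B" using A B has_derivative_linear by blast+
  have "A b = B b" if b: "b \<in> coords X" for b
  proof -
    obtain d where d: "d > 0" "\<And>t. 0 \<le> t \<Longrightarrow> t < d \<Longrightarrow> snd c p + t *\<^sub>R b \<in> ch_img c"
      using ch_step[OF c b] by blast
    have *: "((\<lambda>t. F (snd c p + t *\<^sub>R b)) has_vector_derivative C b) (at 0 within {0..<d})"
      if C: "(F has_derivative C) (at (snd c p) within ch_img c)" for C
    proof -
      have "(F \<circ> (\<lambda>t. snd c p + t *\<^sub>R b) has_derivative C \<circ> (\<lambda>t. t *\<^sub>R b)) (at 0 within {0..<d})"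
      proof (rule diff_chain_within)
        show "((\<lambda>t. snd c p + t *\<^sub>R b) has_derivative (\<lambda>t. t *\<^sub>R b)) (at 0 within {0..<d})"
          by (auto intro!: derivative_eq_intros)
        show "(F has_derivative C) (at (snd c p + 0 *\<^sub>R b) within (\<lambda>t. snd c p + t *\<^sub>R b) ` {0..<d})"
          using has_derivative_subset[OF C] d by (simp add: image_subset_iff)
      qed
      then show ?thesis
        using linear_scale[OF has_derivative_linear[OF C]]
        by (simp add: has_vector_derivative_def comp_def)
    qed
    have "at (0::real) within {0..<d} \<noteq> bot"
      using d by (auto simp: trivial_limit_within islimpt_Ico)
    then show ?thesis
      using vector_derivative_unique_within[OF _ *[OF A] *[OF B]] by blast
  qed
  then show ?thesis
    by (simp add: model_proj_def linear_sum[OF lin(1)] linear_sum[OF lin(2)]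
      linear_scale[OF lin(1)] linear_scale[OF lin(2)] cong: sum.cong)
qed

lemma cd_within:
  assumes c: "c \<in> charts X" "p \<in> fst c"
    and A: "((\<lambda>y. f (ch_inv c y)) has_derivative A) (at (snd c p) within ch_img c)"
  shows "cd c f p v = A (P v)"
proof -
  have "(f \<circ> ch_inv c) differentiable (at (snd c p) within ch_img c)"
    using A by (auto simp: differentiable_def comp_def)
  then have "(f \<circ> ch_inv c has_derivative frechet_derivative (f \<circ> ch_inv c) (at (snd c p) within ch_img c))
    (at (snd c p) within ch_img c)" by (simp add: frechet_derivative_works)
  from ch_derivative_unique[OF c this[unfolded comp_def] A] show ?thesis
    by (simp add: chart_deriv_eq comp_def)
qed

text \<open>Transfers derivatives within the chart image to two-sided derivatives of an extension to
  an open set, where ordinary calculus is available.\<close>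

lemma cd_ext:
  assumes c: "c \<in> charts X" "p \<in> fst c" and W: "open W" "snd c p \<in> W"
    and g: "(g has_derivative A) (at (snd c p))"
    and eq: "\<And>y. y \<in> ch_img c \<Longrightarrow> y \<in> W \<Longrightarrow> g y = f (ch_inv c y)"
  shows "cd c f p v = A (P v)"
proof (rule cd_within[OF c])
  obtain e where e: "e > 0" "ball (snd c p) e \<subseteq> W" using W open_contains_ball by blast
  have "(g has_derivative A) (at (snd c p) within ch_img c)"
    using g has_derivative_at_withinI by blast
  then show "((\<lambda>y. f (ch_inv c y)) has_derivative A) (at (snd c p) within ch_img c)"
    by (rule has_derivative_transform_within[OF _ e(1)]) (use c e eq in \<open>auto simp: dist_commute subset_eq\<close>)
qed

definition sm_at :: "('a \<Rightarrow> 'w::real_normed_vector) \<Rightarrow> 'a \<Rightarrow> bool" where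
  "sm_at f p \<longleftrightarrow> (\<exists>c\<in>charts X. p \<in> fst c \<and> smooth_near (ch_img c) (\<lambda>y. f (ch_inv c y)) (snd c p))"

text \<open>The definition of \<open>sm_at\<close> asks for one chart; the transition map, whose
  domain is open in the chart image, carries smoothness to any other chart.\<close>

lemma sm_at_chart:
  assumes "sm_at f p" "c \<in> charts X" "p \<in> fst c"
  shows "smooth_near (ch_img c) (\<lambda>y. f (ch_inv c y)) (snd c p)"
proof -
  obtain c' where c': "c' \<in> charts X" "p \<in> fst c'"
    "smooth_near (ch_img c') (\<lambda>y. f (ch_inv c' y)) (snd c' p)"
    using assms by (auto simp: sm_at_def)
  let ?S = "snd c ` (fst c \<inter> fst c')"
  obtain V where V: "open V" "?S = ch_img c \<inter> V"
    using ch_open_image[OF assms(2) ch_open[OF c'(1)]] .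
  have mem: "ch_inv c y \<in> fst c'" if "y \<in> ?S" for y using that assms(2) by auto
  have "smooth_near ?S (\<lambda>y. f (ch_inv c' (snd c' (ch_inv c y)))) (snd c p)"
    by (rule smooth_near_compose[OF ch_transition[OF assms(2) c'(1) assms(3) c'(2)], where S' = "ch_img c'"])
      (use c' assms mem in auto)
  then show ?thesis
    by (rule smooth_near_cong[OF _ V(1)]) (use V assms c' mem in auto)
qed

lemma smooth_fun_iff:
  assumes "open W"
  shows "smooth_fun X W f \<longleftrightarrow> (\<forall>p\<in>W. sm_at f p)"
proof
  assume f: "smooth_fun X W f"
  show "\<forall>p\<in>W. sm_at f p"
  proof
    fix p assume p: "p \<in> W"
    obtain c where c: "c \<in> charts X" "p \<in> fst c" using ex_chart by blast
    obtain V where V: "open V" "snd c ` (fst c \<inter> W) = ch_img c \<inter> V"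
      using ch_open_image[OF c(1) assms] .
    have "smooth_on_set (snd c ` (fst c \<inter> W)) (f \<circ> ch_inv c)"
      using f c(1) by (auto simp: smooth_fun_def split: prod.splits)
    then have "smooth_near (snd c ` (fst c \<inter> W)) (f \<circ> ch_inv c) (snd c p)"
      using c p by (auto simp: smooth_on_set_iff)
    then have "smooth_near (ch_img c) (\<lambda>y. f (ch_inv c y)) (snd c p)"
      by (rule smooth_near_cong[OF _ V(1)]) (use V c p in auto)
    with c show "sm_at f p" by (auto simp: sm_at_def)
  qed
next
  assume f: "\<forall>p\<in>W. sm_at f p"
  have "smooth_near (snd c ` (fst c \<inter> W)) (f \<circ> ch_inv c) (snd c p)"
    if "c \<in> charts X" "p \<in> fst c" "p \<in> W" for c p
    using sm_at_chart[of f p c] f that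
    by (auto intro!: smooth_near_cong[of "ch_img c" "\<lambda>y. f (ch_inv c y)" _ UNIV])
  then show "smooth_fun X W f"
    by (auto simp: smooth_fun_def smooth_on_set_iff)
qed

lemma sm_atI: "c \<in> charts X \<Longrightarrow> p \<in> fst c \<Longrightarrow> smooth_near (ch_img c) (\<lambda>y. f (ch_inv c y)) (snd c p) \<Longrightarrow> sm_at f p"
  by (auto simp: sm_at_def)

lemma sm_at_cong:
  assumes "sm_at f p" "open W" "p \<in> W" "\<And>q. q \<in> W \<Longrightarrow> f q = g q"
  shows "sm_at g p"
proof -
  obtain c where c: "c \<in> charts X" "p \<in> fst c" using ex_chart by blast
  obtain V where V: "open V" "snd c ` (fst c \<inter> W) = ch_img c \<inter> V"
    using ch_open_image[OF c(1) assms(2)] .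
  show ?thesis
  proof (rule sm_atI[OF c])
    show "smooth_near (ch_img c) (\<lambda>y. g (ch_inv c y)) (snd c p)"
      by (intro smooth_near_cong[OF sm_at_chart[OF assms(1) c] V(1)])
        (use V c assms ch_inv_open_image[OF c(1) V(2)] in auto)
  qed
qed

lemma sm_at_const [simp]: "sm_at (\<lambda>q. k) p"
  using ex_chart[of p] by (auto simp: sm_at_def)

lemma sm_at_bounded_linear: "bounded_linear L \<Longrightarrow> sm_at f p \<Longrightarrow> sm_at (\<lambda>q. L (f q)) p"
  unfolding sm_at_def using smooth_near_bounded_linear by blast

lemma sm_at_bilinear:
  assumes "bounded_bilinear B" "sm_at f p" "sm_at g p" shows "sm_at (\<lambda>q. B (f q) (g q)) p"
proof -
  obtain c where c: "c \<in> charts X" "p \<in> fst c" using ex_chart by blast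
  show ?thesis
    by (rule sm_atI[OF c smooth_near_bilinear[OF assms(1) sm_at_chart[OF assms(2) c] sm_at_chart[OF assms(3) c]]])
qed

lemma sm_at_add:
  assumes "sm_at f p" "sm_at g p" shows "sm_at (\<lambda>q. f q + g q) p"
proof -
  obtain c where c: "c \<in> charts X" "p \<in> fst c" using ex_chart by blast
  show ?thesis
    by (rule sm_atI[OF c smooth_near_add[OF sm_at_chart[OF assms(1) c] sm_at_chart[OF assms(2) c]]])
qed

lemma sm_at_sum: "(\<And>i. i \<in> I \<Longrightarrow> sm_at (f i) p) \<Longrightarrow> sm_at (\<lambda>q. \<Sum>i\<in>I. f i q) p"
  by (induction I rule: infinite_finite_induct) (simp_all add: sm_at_add)

lemma sm_at_sum_list: "(\<And>x. x \<in> set xs \<Longrightarrow> sm_at (f x) p) \<Longrightarrow> sm_at (\<lambda>q. \<Sum>x\<leftarrow>xs. f x q) p"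
  by (induction xs) (simp_all add: sm_at_add)

lemmas sm_at_mult = sm_at_bilinear[OF bounded_bilinear_mult]
lemmas sm_at_scaleR = sm_at_bilinear[OF bounded_bilinear_scaleR]

lemma sm_at_diff: "sm_at f p \<Longrightarrow> sm_at g p \<Longrightarrow> sm_at (\<lambda>q. f q - g q) p"
  using sm_at_add[of f p "\<lambda>q. - g q"] sm_at_bounded_linear[OF bounded_linear_minus[OF bounded_linear_ident], of g p] by simp

lemma sm_at_chart_map:
  assumes c: "c \<in> charts X" "p \<in> fst c"
  shows "sm_at (snd c) p"
  by (rule sm_atI[OF c], rule smooth_near_cong[OF smooth_near_Cinf[OF open_UNIV UNIV_I Cinf_id], of UNIV])
    (use c ch_inv_mem in auto)

lemma sm_at_compose_Cinf:
  fixes f :: "'a \<Rightarrow> 'w::euclidean_space"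
  assumes "sm_at f p" "Cinf UNIV h" shows "sm_at (\<lambda>q. h (f q)) p"
proof -
  obtain c where c: "c \<in> charts X" "p \<in> fst c" using ex_chart by blast
  show ?thesis
    by (rule sm_atI[OF c], rule smooth_near_compose[OF sm_at_chart[OF assms(1) c] smooth_near_Cinf[OF open_UNIV UNIV_I assms(2)]])
      (use c in auto)
qed

text \<open>A single extension g represents f at all points of the chart near p. Hence
  \<open>cd c f q v\<close>, as a function of q, extends to the smooth function
  \<open>g' y (P v)\<close>; smoothness and second derivatives of chart derivatives rest on
  this.\<close>

lemma sm_at_extension:
  assumes "sm_at f p" "c \<in> charts X" "p \<in> fst c"
  obtains W g g' where "open W" "snd c p \<in> W" "Cinf W g"
    "\<And>y. y \<in> ch_img c \<Longrightarrow> y \<in> W \<Longrightarrow> g y = f (ch_inv c y)"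
    "\<And>y. y \<in> W \<Longrightarrow> (g has_derivative g' y) (at y)" "\<And>v. Cinf W (\<lambda>y. g' y v)"
    "\<And>q v. q \<in> fst c \<Longrightarrow> snd c q \<in> W \<Longrightarrow> cd c f q v = g' (snd c q) (P v)"
proof -
  obtain W g where W: "open W" "snd c p \<in> W" "Cinf W g"
    "\<And>y. y \<in> ch_img c \<Longrightarrow> y \<in> W \<Longrightarrow> g y = f (ch_inv c y)"
    using smooth_nearE[OF sm_at_chart[OF assms]] by blast
  obtain g' where g': "\<And>y. y \<in> W \<Longrightarrow> (g has_derivative g' y) (at y)" "\<And>v. Cinf W (\<lambda>y. g' y v)"
    using Cinf_derivativeE[OF W(1,3)] by blast
  have "cd c f q v = g' (snd c q) (P v)" if "q \<in> fst c" "snd c q \<in> W" for q v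
    by (rule cd_ext[OF assms(2) that(1) W(1) that(2) g'(1)[OF that(2)] W(4)])
  then show ?thesis using that W g' by blast
qed

lemma cd_has_derivative:
  assumes "sm_at f p" "c \<in> charts X" "p \<in> fst c"
  obtains A where "((\<lambda>y. f (ch_inv c y)) has_derivative A) (at (snd c p) within ch_img c)"
    "\<And>v. cd c f p v = A (P v)"
proof -
  obtain W g g' where W: "open W" "snd c p \<in> W"
    "\<And>y. y \<in> ch_img c \<Longrightarrow> y \<in> W \<Longrightarrow> g y = f (ch_inv c y)"
    "\<And>y. y \<in> W \<Longrightarrow> (g has_derivative g' y) (at y)"
    using sm_at_extension[OF assms] by metis
  obtain e where e: "e > 0" "ball (snd c p) e \<subseteq> W" using W open_contains_ball by blast
  have "(g has_derivative g' (snd c p)) (at (snd c p) within ch_img c)"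
    using W has_derivative_at_withinI by blast
  then have *: "((\<lambda>y. f (ch_inv c y)) has_derivative g' (snd c p)) (at (snd c p) within ch_img c)"
    by (rule has_derivative_transform_within[OF _ e(1)]) (use assms e W in \<open>auto simp: dist_commute subset_eq\<close>)
  then show ?thesis using that cd_within[OF assms(2,3)] by blast
qed

lemma cd_const [simp]: "c \<in> charts X \<Longrightarrow> p \<in> fst c \<Longrightarrow> cd c (\<lambda>q. k) p v = 0"
  using cd_within[of c p "\<lambda>q. k" "\<lambda>v. 0" v] by simp

lemma cd_linear: "sm_at f p \<Longrightarrow> c \<in> charts X \<Longrightarrow> p \<in> fst c \<Longrightarrow> linear (cd c f p)"
proof -
  assume a: "sm_at f p" "c \<in> charts X" "p \<in> fst c"
  obtain A where A: "((\<lambda>y. f (ch_inv c y)) has_derivative A) (at (snd c p) within ch_img c)"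
    "\<And>v. cd c f p v = A (P v)"
    using cd_has_derivative[OF a] by metis
  have "linear A" using A has_derivative_linear by blast
  then have "linear (A \<circ> P)" using linear_P linear_compose by blast
  moreover have "cd c f p = A \<circ> P" using A(2) by (auto simp: fun_eq_iff)
  ultimately show ?thesis by simp
qed

lemma cd_P [simp]: "cd c f p (P v) = cd c f p v"
  by (simp add: chart_deriv_eq)

lemma cd_bounded_linear:
  assumes "bounded_linear L" "sm_at f p" "c \<in> charts X" "p \<in> fst c"
  shows "cd c (\<lambda>q. L (f q)) p v = L (cd c f p v)"
proof -
  obtain A where A: "((\<lambda>y. f (ch_inv c y)) has_derivative A) (at (snd c p) within ch_img c)"
    "\<And>v. cd c f p v = A (P v)"
    using cd_has_derivative[OF assms(2-4)] by metis
  show ?thesis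
    using cd_within[OF assms(3,4) bounded_linear.has_derivative[OF assms(1) A(1)]] A(2) by simp
qed

lemma cd_add:
  assumes "sm_at f p" "sm_at g p" "c \<in> charts X" "p \<in> fst c"
  shows "cd c (\<lambda>q. f q + g q) p v = cd c f p v + cd c g p v"
proof -
  obtain A where A: "((\<lambda>y. f (ch_inv c y)) has_derivative A) (at (snd c p) within ch_img c)"
    "\<And>v. cd c f p v = A (P v)"
    using cd_has_derivative[OF assms(1,3,4)] by metis
  obtain B where B: "((\<lambda>y. g (ch_inv c y)) has_derivative B) (at (snd c p) within ch_img c)"
    "\<And>v. cd c g p v = B (P v)"
    using cd_has_derivative[OF assms(2,3,4)] by metis
  show ?thesis
    using cd_within[OF assms(3,4) has_derivative_add[OF A(1) B(1)]] A(2) B(2) by simp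
qed

lemma cd_bilinear:
  assumes "bounded_bilinear M" "sm_at f p" "sm_at g p" "c \<in> charts X" "p \<in> fst c"
  shows "cd c (\<lambda>q. M (f q) (g q)) p v = M (f p) (cd c g p v) + M (cd c f p v) (g p)"
proof -
  obtain A where A: "((\<lambda>y. f (ch_inv c y)) has_derivative A) (at (snd c p) within ch_img c)"
    "\<And>v. cd c f p v = A (P v)"
    using cd_has_derivative[OF assms(2,4,5)] by metis
  obtain B where B: "((\<lambda>y. g (ch_inv c y)) has_derivative B) (at (snd c p) within ch_img c)"
    "\<And>v. cd c g p v = B (P v)"
    using cd_has_derivative[OF assms(3,4,5)] by metis
  show ?thesis
    using cd_within[OF assms(4,5), of "\<lambda>q. M (f q) (g q)", OF bounded_bilinear.FDERIV[OF assms(1) A(1) B(1)]] A(2) B(2) assms(4,5) by simp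
qed

lemmas cd_mult = cd_bilinear[OF bounded_bilinear_mult]
lemmas cd_scaleR = cd_bilinear[OF bounded_bilinear_scaleR]

lemma cd_sum:
  assumes "c \<in> charts X" "p \<in> fst c" "\<And>i. i \<in> I \<Longrightarrow> sm_at (f i) p"
  shows "cd c (\<lambda>q. \<Sum>i\<in>I. f i q) p v = (\<Sum>i\<in>I. cd c (f i) p v)"
  using assms(3)
  by (induction I rule: infinite_finite_induct) (simp_all add: cd_add sm_at_sum assms(1,2))

lemma cd_sum_list:
  assumes "c \<in> charts X" "p \<in> fst c" "\<And>x. x \<in> set xs \<Longrightarrow> sm_at (f x) p"
  shows "cd c (\<lambda>q. \<Sum>x\<leftarrow>xs. f x q) p v = (\<Sum>x\<leftarrow>xs. cd c (f x) p v)"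
  using assms(3)
  by (induction xs) (simp_all add: cd_add sm_at_sum_list assms(1,2))

lemma cd_cong:
  assumes "sm_at f p" "c \<in> charts X" "p \<in> fst c" "open W" "p \<in> W" "\<And>q. q \<in> W \<Longrightarrow> f q = g q"
  shows "cd c f p v = cd c g p v"
proof -
  have g: "sm_at g p" by (rule sm_at_cong[OF assms(1,4,5,6)])
  obtain U k k' where k: "open U" "snd c p \<in> U"
    "\<And>y. y \<in> ch_img c \<Longrightarrow> y \<in> U \<Longrightarrow> k y = f (ch_inv c y)"
    "\<And>y. y \<in> U \<Longrightarrow> (k has_derivative k' y) (at y)"
    "\<And>q v. q \<in> fst c \<Longrightarrow> snd c q \<in> U \<Longrightarrow> cd c f q v = k' (snd c q) (P v)"
    using sm_at_extension[OF assms(1-3)] by metis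
  obtain V where V: "open V" "snd c ` (fst c \<inter> W) = ch_img c \<inter> V"
    using ch_open_image[OF assms(2,4)] .
  note mem = ch_inv_open_image[OF assms(2) V(2)]
  have pV: "snd c p \<in> V" using V assms by blast
  have "cd c g p v = k' (snd c p) (P v)"
    by (rule cd_ext[OF assms(2,3), of "U \<inter> V" k]) (use k V pV mem assms(6) in auto)
  then show ?thesis using k(5)[OF assms(3) k(2)] by simp
qed

lemma cd_chart_map_P:
  assumes "c \<in> charts X" "c' \<in> charts X" "p \<in> fst c" "p \<in> fst c'"
  shows "P (cd c (snd c') p v) = cd c (snd c') p v"
proof -
  have "cd c (\<lambda>q. P (snd c' q)) p v = P (cd c (snd c') p v)"
    by (rule cd_bounded_linear[OF bounded_linear_P sm_at_chart_map[OF assms(2,4)] assms(1,3)])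
  moreover have "cd c (snd c') p v = cd c (\<lambda>q. P (snd c' q)) p v"
    by (rule cd_cong[OF sm_at_chart_map[OF assms(2,4)] assms(1,3) ch_open[OF assms(2)] assms(4)])
      (simp add: P_ch assms)
  ultimately show ?thesis by simp
qed

lemma cd_chart_map_self:
  assumes "c \<in> charts X" "p \<in> fst c"
  shows "cd c (snd c) p v = P v"
proof -
  have "((\<lambda>y. y) has_derivative (\<lambda>v. v)) (at (snd c p))" by simp
  from cd_ext[OF assms open_UNIV UNIV_I this, of "snd c"] show ?thesis
    using assms by (auto simp: ch_inv_mem(2))
qed

lemma cd_chain:
  assumes f: "sm_at f p" and c: "c \<in> charts X" "p \<in> fst c" and c': "c' \<in> charts X" "p \<in> fst c'"
  shows "cd c f p v = cd c' f p (cd c (snd c') p v)"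
proof -
  obtain W g g' where g: "open W" "snd c' p \<in> W"
    "\<And>y. y \<in> ch_img c' \<Longrightarrow> y \<in> W \<Longrightarrow> g y = f (ch_inv c' y)"
    "\<And>y. y \<in> W \<Longrightarrow> (g has_derivative g' y) (at y)"
    "\<And>q v. q \<in> fst c' \<Longrightarrow> snd c' q \<in> W \<Longrightarrow> cd c' f q v = g' (snd c' q) (P v)"
    using sm_at_extension[OF f c'] by metis
  obtain U t t' where t: "open U" "snd c p \<in> U" "Cinf U t"
    "\<And>y. y \<in> ch_img c \<Longrightarrow> y \<in> U \<Longrightarrow> t y = snd c' (ch_inv c y)"
    "\<And>y. y \<in> U \<Longrightarrow> (t has_derivative t' y) (at y)"
    "\<And>q v. q \<in> fst c \<Longrightarrow> snd c q \<in> U \<Longrightarrow> cd c (snd c') q v = t' (snd c q) (P v)"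
    using sm_at_extension[OF sm_at_chart_map[OF c'] c] by metis
  obtain V where V: "open V" "snd c ` (fst c \<inter> fst c') = ch_img c \<inter> V"
    using ch_open_image[OF c(1) ch_open[OF c'(1)]] .
  note mem = ch_inv_open_image[OF c(1) V(2)]
  have pV: "snd c p \<in> V" using V c c' by blast
  have tp: "t (snd c p) = snd c' p" using t c by auto
  let ?O = "(U \<inter> t -` W) \<inter> V"
  have o: "open ?O"
    using continuous_open_preimage[OF Cinf_imp_continuous_on[OF t(3)] t(1) g(1)] V by blast
  have d: "((\<lambda>y. g (t y)) has_derivative (\<lambda>v. g' (snd c' p) (t' (snd c p) v))) (at (snd c p))"
    using has_derivative_compose[OF t(5)[OF t(2)], of g "g' (snd c' p)"] g(4)[OF g(2)] tp by simp
  have "cd c f p v = g' (snd c' p) (t' (snd c p) (P v))"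
    by (rule cd_ext[OF c o _ d]) (use t pV tp g mem c' in auto)
  moreover have "cd c' f p (cd c (snd c') p v) = g' (snd c' p) (t' (snd c p) (P v))"
    using g(5)[OF c'(2) g(2)] cd_chart_map_P[OF c(1) c'(1) c(2) c'(2)] t(6)[OF c(2) t(2)] by simp
  ultimately show ?thesis by simp
qed

lemma sm_at_cd:
  assumes "sm_at f p" "c \<in> charts X" "p \<in> fst c"
  shows "sm_at (\<lambda>q. cd c f q v) p"
proof -
  obtain W g g' where g: "open W" "snd c p \<in> W"
    "\<And>v. Cinf W (\<lambda>y. g' y v)"
    "\<And>q v. q \<in> fst c \<Longrightarrow> snd c q \<in> W \<Longrightarrow> cd c f q v = g' (snd c q) (P v)"
    using sm_at_extension[OF assms] by metis
  show ?thesis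
    by (rule sm_atI[OF assms(2,3)], rule smooth_nearI[OF g(1,2) g(3)[of "P v"]])
      (use g(4) assms(2) in auto)
qed

text \<open>Symmetry holds at corners too, because both iterated chart derivatives are second
  derivatives of one extension that is smooth on a full neighbourhood.\<close>

lemma cd_commute:
  fixes f :: "'a \<Rightarrow> 'w::euclidean_space"
  assumes "sm_at f p" "c \<in> charts X" "p \<in> fst c"
  shows "cd c (\<lambda>q. cd c f q v) p w = cd c (\<lambda>q. cd c f q w) p v"
proof -
  obtain W g g' where g: "open W" "snd c p \<in> W" "Cinf W g"
    "\<And>y. y \<in> W \<Longrightarrow> (g has_derivative g' y) (at y)"
    "\<And>v. Cinf W (\<lambda>y. g' y v)"
    "\<And>q v. q \<in> fst c \<Longrightarrow> snd c q \<in> W \<Longrightarrow> cd c f q v = g' (snd c q) (P v)"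
    using sm_at_extension[OF assms] by metis
  have "\<exists>G. ((\<lambda>y. g' y (P v)) has_derivative G) (at (snd c p)) \<and> (\<forall>w. cd c (\<lambda>q. cd c f q v) p w = G (P w))" for v
  proof -
    obtain G where G: "((\<lambda>y. g' y (P v)) has_derivative G (snd c p)) (at (snd c p))"
      using Cinf_derivativeE[OF g(1) g(5)[of "P v"]] g(2) by metis
    have "cd c (\<lambda>q. cd c f q v) p w = G (snd c p) (P w)" for w
      by (rule cd_ext[OF assms(2,3) g(1,2) G]) (use g(6) assms(2) in auto)
    with G show ?thesis by blast
  qed
  then have "\<exists>G. \<forall>v. ((\<lambda>y. g' y (P v)) has_derivative G v) (at (snd c p)) \<and> (\<forall>w. cd c (\<lambda>q. cd c f q v) p w = G v (P w))"
    by (intro choice allI)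
  then obtain G where G: "\<And>v. ((\<lambda>y. g' y (P v)) has_derivative G v) (at (snd c p))"
    "\<And>v w. cd c (\<lambda>q. cd c f q v) p w = G v (P w)" by blast
  show ?thesis
    unfolding G(2) by (rule second_derivative_symmetric[OF g(1-4) G(1) G(1)])
qed

lemma cd_expand:
  assumes "sm_at f q" "c \<in> charts X" "q \<in> fst c"
  shows "cd c f q w = (\<Sum>b\<in>Basis. (w \<bullet> b) *\<^sub>R cd c f q b)"
proof -
  note lin = cd_linear[OF assms]
  have "cd c f q w = cd c f q (\<Sum>b\<in>Basis. (w \<bullet> b) *\<^sub>R b)" by (simp only: euclidean_representation)
  then show ?thesis by (simp only: linear_sum[OF lin] linear_scale[OF lin])
qed

text \<open>Product rule for the pairing of df with a vector field: the field is frozen at p in one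
  term and differentiated in the other. Expansion in the standard basis makes the pairing a sum of
  products.\<close>

lemma cd_cd_field:
  fixes f :: "'a \<Rightarrow> complex" and Z :: "'a \<Rightarrow> 'b"
  assumes f: "sm_at f p" and Z: "sm_at Z p" and c: "c \<in> charts X" "p \<in> fst c"
    and lin: "open W" "p \<in> W" "\<And>q. q \<in> W \<Longrightarrow> sm_at f q"
  shows "cd c (\<lambda>q. cd c f q (Z q)) p v = cd c (\<lambda>q. cd c f q (Z p)) p v + cd c f p (cd c Z p v)"
proof -
  let ?W = "W \<inter> fst c"
  have W: "open ?W" "p \<in> ?W" using lin c ch_open[OF c(1)] by auto
  have exp: "cd c f q w = (\<Sum>b\<in>Basis. (w \<bullet> b) *\<^sub>R cd c f q b)" if "q \<in> ?W" for q w
    using that by (intro cd_expand lin(3) c(1)) auto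
  have s1: "sm_at (\<lambda>q. cd c f q b) p" for b by (rule sm_at_cd[OF f c])
  have s2: "sm_at (\<lambda>q. Z q \<bullet> b) p" for b by (rule sm_at_bounded_linear[OF bounded_linear_inner_left Z])
  have s3: "sm_at (\<lambda>q. \<Sum>b\<in>Basis. (Z q \<bullet> b) *\<^sub>R cd c f q b) p"
    by (intro sm_at_sum sm_at_scaleR s1 s2)
  have "cd c (\<lambda>q. cd c f q (Z q)) p v = cd c (\<lambda>q. \<Sum>b\<in>Basis. (Z q \<bullet> b) *\<^sub>R cd c f q b) p v"
    by (rule cd_cong[OF s3 c W, symmetric]) (rule exp[symmetric])
  also have "\<dots> = (\<Sum>b\<in>Basis. (Z p \<bullet> b) *\<^sub>R cd c (\<lambda>q. cd c f q b) p v + (cd c Z p v \<bullet> b) *\<^sub>R cd c f p b)"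
    by (simp add: cd_sum[OF c] sm_at_scaleR s1 s2 cd_scaleR c
      cd_bounded_linear[OF bounded_linear_inner_left Z c])
  also have "\<dots> = (\<Sum>b\<in>Basis. (Z p \<bullet> b) *\<^sub>R cd c (\<lambda>q. cd c f q b) p v) + cd c f p (cd c Z p v)"
    by (simp add: sum.distrib exp[OF W(2), of "cd c Z p v"])
  also have "(\<Sum>b\<in>Basis. (Z p \<bullet> b) *\<^sub>R cd c (\<lambda>q. cd c f q b) p v) = cd c (\<lambda>q. \<Sum>b\<in>Basis. (Z p \<bullet> b) *\<^sub>R cd c f q b) p v"
    by (simp add: cd_sum[OF c] sm_at_scaleR s1 cd_scaleR c)
  also have "\<dots> = cd c (\<lambda>q. cd c f q (Z p)) p v"
    by (rule cd_cong[OF _ c W]) (auto intro!: sm_at_sum sm_at_scaleR s1 simp: exp)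
  finally show ?thesis .
qed

lemma cd_field_commutator:
  fixes f :: "'a \<Rightarrow> complex" and Y Z :: "'a \<Rightarrow> 'b"
  assumes f: "\<And>q. sm_at f q" and Y: "sm_at Y p" and Z: "sm_at Z p" and c: "c \<in> charts X" "p \<in> fst c"
  shows "cd c (\<lambda>q. cd c f q (Z q)) p (Y p) - cd c (\<lambda>q. cd c f q (Y q)) p (Z p)
    = cd c f p (cd c Z p (Y p) - cd c Y p (Z p))"
  using cd_cd_field[OF f Z c open_UNIV UNIV_I f] cd_cd_field[OF f Y c open_UNIV UNIV_I f]
    cd_commute[OF f c, of "Z p" "Y p"] linear_diff[OF cd_linear[OF f c]]
  by simp

end

section \<open>Bump functions pulled back from charts and a finite partition of unity\<close>

section \<open>Partitions of unity\<close>

context corner_mfd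
begin

text \<open>The closed support of f lies in U, phrased through neighbourhoods of the points outside
  U.\<close>

definition supp_in :: "('a \<Rightarrow> 'w::zero) \<Rightarrow> 'a set \<Rightarrow> bool" where
  "supp_in f U \<longleftrightarrow> (\<forall>q. q \<notin> U \<longrightarrow> (\<exists>V. open V \<and> q \<in> V \<and> (\<forall>q'\<in>V. f q' = 0)))"

lemma supp_in_zero: "supp_in f U \<Longrightarrow> q \<notin> U \<Longrightarrow> f q = 0"
  unfolding supp_in_def by blast

lemma sm_at_supp_in:
  assumes "supp_in f U" "\<And>q. q \<in> U \<Longrightarrow> sm_at f q"
  shows "sm_at f q"
proof (cases "q \<in> U")
  case False
  then obtain V where "open V" "q \<in> V" "\<forall>q'\<in>V. f q' = 0" using assms(1) by (auto simp: supp_in_def)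
  then show ?thesis by (intro sm_at_cong[OF sm_at_const[of 0]]) auto
qed (use assms in auto)

text \<open>Extension by zero: the values of g outside U are arbitrary, as are those of chart
  coordinates outside the chart.\<close>

lemma sm_at_scaleR_supp_in:
  fixes f :: "'a \<Rightarrow> real" and g :: "'a \<Rightarrow> 'w::real_normed_vector"
  assumes "supp_in f U" "\<And>q. sm_at f q" "\<And>q. q \<in> U \<Longrightarrow> sm_at g q"
  shows "sm_at (\<lambda>q. f q *\<^sub>R g q) q"
proof (rule sm_at_supp_in)
  show "supp_in (\<lambda>q. f q *\<^sub>R g q) U" using assms(1) unfolding supp_in_def by (metis scaleR_zero_left)
qed (intro sm_at_scaleR assms)

lemma closed_sector: "K \<subseteq> coords X \<Longrightarrow> closed (sector X K)"
proof -
  have "sector X K = {v. P v = v} \<inter> (\<Inter>b\<in>K. {v. 0 \<le> v \<bullet> b})" by (auto simp: sector_def)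
  moreover have "closed {v. P v = v}"
    by (intro closed_Collect_eq bounded_linear.continuous_on[OF bounded_linear_P] continuous_intros)
  moreover have "closed (\<Inter>b\<in>K. {v. 0 \<le> v \<bullet> b})"
    by (intro closed_INT ballI closed_Collect_le continuous_intros)
  ultimately show ?thesis by auto
qed

text \<open>The part of the sector inside the closed ball is compact and lies in the chart image;
  its preimage is compact, hence closed in the Hausdorff space. Off this closed set the function is
  0, so the extension by 0 is smooth also at the boundary of the chart domain.\<close>

lemma pull_back_bump:
  fixes h :: "'b \<Rightarrow> real"
  assumes c: "c \<in> charts X" and K: "K \<subseteq> coords X" "ch_img c \<subseteq> sector X K"
    and s: "sector X K \<inter> cball x s \<subseteq> ch_img c"
    and h: "Cinf UNIV h" "\<And>y. dist x y \<ge> s \<Longrightarrow> h y = 0"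
  shows "sm_at (\<lambda>q. if q \<in> fst c then h (snd c q) else 0) q" (is "sm_at ?f q")
    and "supp_in (\<lambda>q. if q \<in> fst c then h (snd c q) else 0) (fst c)"
proof -
  let ?K = "ch_inv c ` (sector X K \<inter> cball x s)"
  have "compact (sector X K \<inter> cball x s)" using closed_sector[OF K(1)] by (intro closed_Int_compact) auto
  moreover have "continuous_on (sector X K \<inter> cball x s) (ch_inv c)"
    using continuous_on_subset[OF homeomorphism_cont2[OF ch_homeo[OF c]] s] .
  ultimately have "closed ?K" by (intro compact_imp_closed compact_continuous_image)
  then have o: "open (- ?K)" by blast
  have z: "?f q' = 0" if "q' \<in> - ?K" for q'
  proof (cases "q' \<in> fst c")
    case True
    have "snd c q' \<notin> cball x s"
    proof
      assume "snd c q' \<in> cball x s"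
      then have "snd c q' \<in> sector X K \<inter> cball x s" using True K(2) by auto
      then have "ch_inv c (snd c q') \<in> ?K" by (rule imageI)
      then show False using that True c by simp
    qed
    then show ?thesis using h(2)[of "snd c q'"] by simp
  qed simp
  have sub: "?K \<subseteq> fst c" using s by (auto simp: inv_into_into)
  show sup: "supp_in ?f (fst c)"
    unfolding supp_in_def using o z sub by blast
  show "sm_at ?f q"
  proof (rule sm_at_supp_in[OF sup])
    fix q assume q: "q \<in> fst c"
    show "sm_at ?f q"
      by (rule sm_at_cong[OF sm_at_compose_Cinf[OF sm_at_chart_map[OF c q] h(1)] ch_open[OF c] q]) simp
  qed
qed

text \<open>H enters the partition of unity, while \<chi> cuts off the chart coordinates. As \<chi>
  is 1 near every point where H is nonzero, the cut-off coordinates have the true differentials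
  there.\<close>

definition bump_data :: "'a \<Rightarrow> ('a, 'b) chart \<Rightarrow> ('a \<Rightarrow> real) \<Rightarrow> ('a \<Rightarrow> real) \<Rightarrow> 'a set \<Rightarrow> bool" where
  "bump_data p c H \<chi> N \<longleftrightarrow> c \<in> charts X \<and> (\<forall>q. sm_at H q) \<and> (\<forall>q. sm_at \<chi> q)
    \<and> supp_in H (fst c) \<and> supp_in \<chi> (fst c) \<and> open N \<and> p \<in> N \<and> (\<forall>q\<in>N. H q = 1)
    \<and> (\<forall>q. H q \<noteq> 0 \<longrightarrow> (\<exists>V. open V \<and> q \<in> V \<and> (\<forall>q'\<in>V. \<chi> q' = 1)))"

lemma ex_bump_data:
  assumes c: "c \<in> charts X" "p \<in> fst c"
  shows "\<exists>H \<chi> N. bump_data p c H \<chi> N"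
proof -
  obtain K where K: "K \<subseteq> coords X" "openin (top_of_set (sector X K)) (ch_img c)"
    using ch_sector[OF c(1)] .
  then obtain V where V: "open V" "ch_img c = sector X K \<inter> V" by (auto simp: openin_open)
  define x where "x = snd c p"
  have "x \<in> V" using V c by (auto simp: x_def)
  then obtain e where e: "e > 0" "cball x e \<subseteq> V" using V(1) open_contains_cball by blast
  have img: "ch_img c \<subseteq> sector X K" using V by blast
  have ball_open: "open (fst c \<inter> snd c -` ball x r)" for r
    using continuous_open_preimage[OF homeomorphism_cont1[OF ch_homeo[OF c(1)]] ch_open[OF c(1)]] by blast
  \<comment> \<open>The radii leave a margin: H vanishes from distance e/3 on, while \<chi> is 1 up
    to distance e/2.\<close>
  obtain h where h: "Cinf UNIV h" "\<And>y. dist x y \<le> e / 4 \<Longrightarrow> h y = (1::real)" "\<And>y. dist x y \<ge> e / 3 \<Longrightarrow> h y = 0"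
    using smooth_plateau[of "e / 4" "e / 3" x] e by auto
  obtain k where k: "Cinf UNIV k" "\<And>y. dist x y \<le> e / 2 \<Longrightarrow> k y = (1::real)" "\<And>y. dist x y \<ge> e \<Longrightarrow> k y = 0"
    using smooth_plateau[of "e / 2" e x] e by auto
  have s1: "sector X K \<inter> cball x (e / 3) \<subseteq> ch_img c" and s2: "sector X K \<inter> cball x e \<subseteq> ch_img c"
    using e V by (auto simp: subset_eq)
  let ?H = "\<lambda>q. if q \<in> fst c then h (snd c q) else 0"
  let ?C = "\<lambda>q. if q \<in> fst c then k (snd c q) else 0"
  have "bump_data p c ?H ?C (fst c \<inter> snd c -` ball x (e / 4))"
    unfolding bump_data_def
  proof (intro conjI allI ballI impI)
    show "sm_at ?H q" for q by (rule pull_back_bump(1)[OF c(1) K(1) img s1 h(1,3)])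
    show "sm_at ?C q" for q by (rule pull_back_bump(1)[OF c(1) K(1) img s2 k(1,3)])
    show "supp_in ?H (fst c)" by (rule pull_back_bump(2)[OF c(1) K(1) img s1 h(1,3)])
    show "supp_in ?C (fst c)" by (rule pull_back_bump(2)[OF c(1) K(1) img s2 k(1,3)])
    show "p \<in> fst c \<inter> snd c -` ball x (e / 4)" using c e by (simp add: x_def)
    show "?H q = 1" if "q \<in> fst c \<inter> snd c -` ball x (e / 4)" for q
      using that h(2)[of "snd c q"] by simp
    show "\<exists>V. open V \<and> q \<in> V \<and> (\<forall>q'\<in>V. ?C q' = 1)" if "?H q \<noteq> 0" for q
    proof (intro exI[of _ "fst c \<inter> snd c -` ball x (e / 2)"] conjI ballI)
      have q: "q \<in> fst c" "h (snd c q) \<noteq> 0" using that by (auto split: if_splits)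
      then have "dist x (snd c q) < e / 3" using h(3) not_less by blast
      with q e show "q \<in> fst c \<inter> snd c -` ball x (e / 2)" by simp
      show "?C q' = 1" if "q' \<in> fst c \<inter> snd c -` ball x (e / 2)" for q'
        using that k(2)[of "snd c q'"] by simp
    qed (rule ball_open)
  qed (rule c(1) ball_open)+
  then show ?thesis by blast
qed

lemma one_minus_prod_telescope:
  fixes H :: "nat \<Rightarrow> real"
  shows "(\<Sum>i<m. H i * (\<Prod>j<i. 1 - H j)) = 1 - (\<Prod>j<m. 1 - H j)"
  by (induction m) (simp_all add: algebra_simps)

lemma sm_at_prod:
  fixes f :: "'i \<Rightarrow> 'a \<Rightarrow> real"
  shows "(\<And>i. i \<in> I \<Longrightarrow> sm_at (f i) p) \<Longrightarrow> sm_at (\<lambda>q. \<Prod>i\<in>I. f i q) p"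
  by (induction I rule: infinite_finite_induct) (simp_all add: sm_at_mult)

text \<open>The functions H_i (1 - H_0) ... (1 - H_(i-1)) telescope to 1 minus the product of all 1
  - H_j, and that product is 0 because each point lies in a neighbourhood on which some H_j is 1.
  Each of them is nonzero only where H_i is, so the same \<chi> still fits.\<close>

lemma partition_of_unity:
  assumes "compact (UNIV :: 'a set)"
  shows "\<exists>(m::nat) c (\<rho> :: nat \<Rightarrow> 'a \<Rightarrow> real) (\<chi> :: nat \<Rightarrow> 'a \<Rightarrow> real).
    (\<forall>i<m. c i \<in> charts X \<and> (\<forall>q. sm_at (\<rho> i) q) \<and> (\<forall>q. sm_at (\<chi> i) q)
      \<and> supp_in (\<rho> i) (fst (c i)) \<and> supp_in (\<chi> i) (fst (c i))
      \<and> (\<forall>q. \<rho> i q \<noteq> 0 \<longrightarrow> (\<exists>V. open V \<and> q \<in> V \<and> (\<forall>q'\<in>V. \<chi> i q' = 1))))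
    \<and> (\<forall>q. (\<Sum>i<m. \<rho> i q) = 1)"
proof -
  have "\<forall>p. \<exists>y. bump_data p (fst y) (fst (snd y)) (fst (snd (snd y))) (snd (snd (snd y)))"
  proof
    fix p
    obtain c where c: "c \<in> charts X" "p \<in> fst c" using ex_chart by blast
    obtain H \<chi> N where "bump_data p c H \<chi> N" using ex_bump_data[OF c] by blast
    then show "\<exists>y. bump_data p (fst y) (fst (snd y)) (fst (snd (snd y))) (snd (snd (snd y)))"
      by (intro exI[of _ "(c, H, \<chi>, N)"]) simp
  qed
  from choice[OF this] obtain F where
    F: "\<And>p. bump_data p (fst (F p)) (fst (snd (F p))) (fst (snd (snd (F p)))) (snd (snd (snd (F p))))" by blast
  define cc where "cc p = fst (F p)" for p
  define H where "H p = fst (snd (F p))" for p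
  define C where "C p = fst (snd (snd (F p)))" for p
  define N where "N p = snd (snd (snd (F p)))" for p
  have G: "cc p \<in> charts X" "sm_at (H p) q" "sm_at (C p) q" "supp_in (H p) (fst (cc p))" "supp_in (C p) (fst (cc p))"
    "open (N p)" "p \<in> N p" "q \<in> N p \<Longrightarrow> H p q = 1" "H p q \<noteq> 0 \<Longrightarrow> \<exists>V. open V \<and> q \<in> V \<and> (\<forall>q'\<in>V. C p q' = 1)" for p q
    using F[of p] by (simp_all add: bump_data_def cc_def H_def C_def N_def)
  obtain D where D: "finite D" "UNIV \<subseteq> (\<Union>p\<in>D. N p)"
  proof (rule compactE_image[OF assms, of UNIV N])
    show "UNIV \<subseteq> (\<Union>p\<in>UNIV. N p)" using G(7) by auto
  qed (use G(6) in simp_all)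
  obtain ps where ps: "set ps = D" using finite_list[OF D(1)] by blast
  define m where "m = length ps"
  define h where "h i = H (ps ! i)" for i
  define r where "r i q = h i q * (\<Prod>j<i. 1 - h j q)" for i q
  have 1: "sm_at (r i) q" for i q
    unfolding r_def h_def by (intro sm_at_mult sm_at_prod sm_at_diff sm_at_const G)
  have 2: "supp_in (r i) (fst (cc (ps ! i)))" for i
    using G(4)[of "ps ! i"] unfolding supp_in_def r_def h_def by (metis mult_zero_left)
  have 3: "\<exists>V. open V \<and> q \<in> V \<and> (\<forall>q'\<in>V. C (ps ! i) q' = 1)" if "r i q \<noteq> 0" for i q
    using that by (intro G(9)) (auto simp: r_def h_def)
  have 4: "(\<Sum>i<m. r i q) = 1" for q
  proof -
    obtain i where "i < m" "q \<in> N (ps ! i)"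
      using D(2) ps by (auto simp: m_def set_conv_nth)
    then have "(\<Prod>j<m. 1 - h j q) = 0"
      using G(8) by (intro prod_zero) (auto simp: h_def)
    then show ?thesis unfolding r_def one_minus_prod_telescope[of "\<lambda>i. h i q" m] by simp
  qed
  show ?thesis
    by (rule exI[of _ m], rule exI[of _ "\<lambda>i. cc (ps ! i)"], rule exI[of _ r], rule exI[of _ "\<lambda>i. C (ps ! i)"])
      (simp add: 1 2 3 4 G)
qed

end

section \<open>Exterior algebra at a point, on functions of argument lists\<close>

section \<open>Exterior multiplication by 1-forms\<close>

text \<open>The wedge product of \<alpha> with g, computed by contraction with the first argument:
  contraction is an antiderivation, so x contracted into \<alpha> \<and> g is \<alpha>(x) g minus
  the wedge of \<alpha> with x contracted into g.\<close>

fun ext_mult :: "('b \<Rightarrow> complex) \<Rightarrow> ('b list \<Rightarrow> complex) \<Rightarrow> 'b list \<Rightarrow> complex" where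
  "ext_mult \<alpha> g [] = 0"
| "ext_mult \<alpha> g (x # xs) = \<alpha> x * g xs - ext_mult \<alpha> (\<lambda>ys. g (x # ys)) xs"

definition sc :: "complex \<Rightarrow> ('c \<Rightarrow> complex) \<Rightarrow> 'c \<Rightarrow> complex" where
  "sc k g = (\<lambda>x. k * g x)"

definition unit_form :: "'b list \<Rightarrow> complex" where
  "unit_form vs = (if vs = [] then 1 else 0)"

lemma sc_simps [simp]:
  "sc k 0 = 0" "sc 0 g = 0" "sc 1 g = g" "sc k (sc l g) = sc (k * l) g"
  "sc k (g + h) = sc k g + sc k h" "sc k (- g) = - sc k g"
  by (simp_all add: sc_def fun_eq_iff algebra_simps)

lemma sc_apply: "sc k g x = k * g x"
  by (simp add: sc_def)

lemma sc_add_left: "sc (k + l) g = sc k g + sc l g"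
  by (simp add: sc_def fun_eq_iff algebra_simps)

lemma ext_mult_add: "ext_mult \<alpha> (g + h) = ext_mult \<alpha> g + ext_mult \<alpha> h"
proof
  show "ext_mult \<alpha> (g + h) vs = (ext_mult \<alpha> g + ext_mult \<alpha> h) vs" for vs
  proof (induction vs arbitrary: g h)
    case (Cons x xs)
    have "(\<lambda>ys. (g + h) (x # ys)) = (\<lambda>ys. g (x # ys)) + (\<lambda>ys. h (x # ys))"
      by (simp add: fun_eq_iff)
    then show ?case by (simp only: ext_mult.simps Cons plus_fun_apply) (simp add: algebra_simps)
  qed simp
qed

lemma ext_mult_sc: "ext_mult \<alpha> (sc k g) = sc k (ext_mult \<alpha> g)"
proof
  show "ext_mult \<alpha> (sc k g) vs = sc k (ext_mult \<alpha> g) vs" for vs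
    by (induction vs arbitrary: g) (simp_all add: sc_def algebra_simps)
qed

lemma ext_mult_0 [simp]: "ext_mult \<alpha> 0 = 0"
  using ext_mult_sc[of \<alpha> 0 0] by simp

lemma ext_mult_sc_left: "ext_mult (sc k \<alpha>) g = sc k (ext_mult \<alpha> g)"
proof
  show "ext_mult (sc k \<alpha>) g vs = sc k (ext_mult \<alpha> g) vs" for vs
    by (induction vs arbitrary: g) (simp_all add: sc_def algebra_simps)
qed

lemma ext_mult_add_left: "ext_mult (\<alpha> + \<beta>) g = ext_mult \<alpha> g + ext_mult \<beta> g"
proof
  show "ext_mult (\<alpha> + \<beta>) g vs = (ext_mult \<alpha> g + ext_mult \<beta> g) vs" for vs
    by (induction vs arbitrary: g) (simp_all add: algebra_simps)
qed

lemma ext_mult_0_left [simp]: "ext_mult 0 g = 0"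
  using ext_mult_sc_left[of 0 0 g] by simp

lemma ext_mult_uminus: "ext_mult \<alpha> (- g) = - ext_mult \<alpha> g"
  using ext_mult_sc[of \<alpha> "-1" g] by (simp add: sc_def fun_eq_iff fun_Compl_def)

lemma ext_mult_Cons_fun:
  "ext_mult \<alpha> (\<lambda>ys. ext_mult \<beta> g (x # ys)) = sc (\<beta> x) (ext_mult \<alpha> g) - ext_mult \<alpha> (ext_mult \<beta> (\<lambda>ys. g (x # ys)))"
proof -
  have "(\<lambda>ys. ext_mult \<beta> g (x # ys)) = sc (\<beta> x) g + - ext_mult \<beta> (\<lambda>ys. g (x # ys))"
    by (simp add: fun_eq_iff sc_def)
  then show ?thesis by (simp only: ext_mult_add ext_mult_sc ext_mult_uminus) simp
qed

text \<open>Contraction with the first argument x leaves, on both sides, the terms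
  \<open>\<alpha> x * ext_mult \<beta> g xs\<close> and
  \<open>\<beta> x * ext_mult \<alpha> g xs\<close> with matching signs; the remainder is the
  induction hypothesis for the contracted g.\<close>

lemma ext_mult_anticommute: "ext_mult \<alpha> (ext_mult \<beta> g) = - ext_mult \<beta> (ext_mult \<alpha> g)"
proof
  show "ext_mult \<alpha> (ext_mult \<beta> g) vs = (- ext_mult \<beta> (ext_mult \<alpha> g)) vs" for vs
  proof (induction vs arbitrary: g)
    case (Cons x xs)
    show ?case
      using Cons[of "\<lambda>ys. g (x # ys)"] ext_mult_Cons_fun[of \<alpha> \<beta> g x] ext_mult_Cons_fun[of \<beta> \<alpha> g x] by (simp add: sc_apply del: ext_mult.simps(2)) (simp add: sc_apply)
  qed simp
qed

lemma ext_mult_self [simp]: "ext_mult \<alpha> (ext_mult \<alpha> g) = 0"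
proof
  fix x
  show "ext_mult \<alpha> (ext_mult \<alpha> g) x = 0 x"
    using fun_cong[OF ext_mult_anticommute[of \<alpha> \<alpha> g], of x] by simp
qed

declare plus_fun_apply [simp del] zero_fun_apply [simp del] \<comment> \<open>sums of forms are not to be evaluated pointwise\<close>

text \<open>A list of triples \<open>(u, a, b)\<close> encodes the 1-form \<open>\<Sum> u b\<close> and the 2-form \<open>\<Sum> a \<and> b\<close>.\<close>

type_synonym 'b triple = "complex \<times> ('b \<Rightarrow> complex) \<times> ('b \<Rightarrow> complex)"

definition wedge1 :: "'b triple list \<Rightarrow> ('b list \<Rightarrow> complex) \<Rightarrow> 'b list \<Rightarrow> complex" where
  "wedge1 xs g = foldr (\<lambda>x. (+) (sc (fst x) (ext_mult (snd (snd x)) g))) xs 0"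

definition wedge2 :: "'b triple list \<Rightarrow> ('b list \<Rightarrow> complex) \<Rightarrow> 'b list \<Rightarrow> complex" where
  "wedge2 xs g = foldr (\<lambda>x. (+) (ext_mult (fst (snd x)) (ext_mult (snd (snd x)) g))) xs 0"

lemma wedge1_simps [simp]:
  "wedge1 [] g = 0"
  "wedge1 (x # xs) g = sc (fst x) (ext_mult (snd (snd x)) g) + wedge1 xs g"
  by (simp_all add: wedge1_def)

lemma wedge2_simps [simp]:
  "wedge2 [] g = 0"
  "wedge2 (x # xs) g = ext_mult (fst (snd x)) (ext_mult (snd (snd x)) g) + wedge2 xs g"
  by (simp_all add: wedge2_def)

lemma wedge1_add: "wedge1 xs (g + h) = wedge1 xs g + wedge1 xs h"
  by (induction xs) (simp_all add: ext_mult_add add_ac)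

lemma wedge1_sc: "wedge1 xs (sc k g) = sc k (wedge1 xs g)"
  by (induction xs) (simp_all add: ext_mult_sc mult.commute)

lemma wedge1_0 [simp]: "wedge1 xs 0 = 0"
  by (induction xs) simp_all

lemma wedge2_add: "wedge2 xs (g + h) = wedge2 xs g + wedge2 xs h"
  by (induction xs) (simp_all add: ext_mult_add add_ac)

lemma wedge2_sc: "wedge2 xs (sc k g) = sc k (wedge2 xs g)"
  by (induction xs) (simp_all add: ext_mult_sc)

lemma wedge2_0 [simp]: "wedge2 xs 0 = 0"
  by (induction xs) simp_all

lemma ext_mult_2_commute: "ext_mult c (ext_mult a (ext_mult b g)) = ext_mult a (ext_mult b (ext_mult c g))"
  using ext_mult_anticommute[of c a "ext_mult b g"] ext_mult_anticommute[of c b g]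
  by (simp add: ext_mult_uminus)

lemma ext_mult_wedge2: "ext_mult c (wedge2 xs g) = wedge2 xs (ext_mult c g)"
  by (induction xs) (simp_all add: ext_mult_add ext_mult_2_commute[of c])

lemma wedge1_ext_mult_2: "wedge1 xs (ext_mult a (ext_mult b g)) = ext_mult a (ext_mult b (wedge1 xs g))"
  by (induction xs) (simp_all add: ext_mult_add ext_mult_sc ext_mult_2_commute)

text \<open>A binomial expansion that stops after the linear term: 2-forms commute, and the square
  of the decomposable form a \<and> b of the head is 0. For j = 0 the exponent \<open>j - 1\<close>
  is harmless because of the factor \<open>of_nat j\<close>.\<close>

lemma wedge2_power_Cons:
  "(wedge2 (x # xs) ^^ j) g = (wedge2 xs ^^ j) g
    + sc (of_nat j) (ext_mult (fst (snd x)) (ext_mult (snd (snd x)) ((wedge2 xs ^^ (j - 1)) g)))"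
proof (induction j)
  case (Suc j)
  let ?a = "fst (snd x)" and ?b = "snd (snd x)"
  have "sc (of_nat j) (wedge2 xs ((wedge2 xs ^^ (j - 1)) g)) = sc (of_nat j) ((wedge2 xs ^^ j) g)"
    by (cases j) simp_all
  then have *: "sc (of_nat j) (ext_mult ?a (ext_mult ?b (wedge2 xs ((wedge2 xs ^^ (j - 1)) g))))
    = sc (of_nat j) (ext_mult ?a (ext_mult ?b ((wedge2 xs ^^ j) g)))"
    by (simp flip: ext_mult_sc)
  have z: "ext_mult ?a (ext_mult ?b (ext_mult ?a (ext_mult ?b h))) = 0" for h
    using ext_mult_2_commute[of ?a ?a ?b "ext_mult ?b h"] by simp
  have "(wedge2 (x # xs) ^^ Suc j) g = wedge2 (x # xs) ((wedge2 xs ^^ j) g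
      + sc (of_nat j) (ext_mult ?a (ext_mult ?b ((wedge2 xs ^^ (j - 1)) g))))"
    by (simp only: funpow.simps comp_apply Suc)
  also have "\<dots> = ext_mult ?a (ext_mult ?b ((wedge2 xs ^^ j) g)) + (wedge2 xs ^^ Suc j) g
      + sc (of_nat j) (ext_mult ?a (ext_mult ?b (wedge2 xs ((wedge2 xs ^^ (j - 1)) g))))"
    by (simp only: wedge2_simps ext_mult_add ext_mult_sc wedge2_add wedge2_sc z sc_simps
      ext_mult_wedge2[symmetric] add_0_left add_0_right add.assoc funpow.simps comp_apply)
  also have "\<dots> = (wedge2 xs ^^ Suc j) g + sc (of_nat (Suc j)) (ext_mult ?a (ext_mult ?b ((wedge2 xs ^^ j) g)))"
    unfolding * by (simp add: sc_add_left add_ac)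
  finally show ?case by (simp only: diff_Suc_1)
qed simp

lemma wedge2_power_eq_0: "length xs < j \<Longrightarrow> (wedge2 xs ^^ j) g = 0"
proof (induction xs arbitrary: j)
  case Nil
  then show ?case by (cases j) simp_all
next
  case (Cons x xs)
  then show ?case by (simp only: wedge2_power_Cons) simp
qed

text \<open>In the top power every summand is used exactly once, in any of the
  \<open>fact (length xs)\<close> orders.\<close>

lemma wedge2_power_length:
  "(wedge2 xs ^^ length xs) g
    = sc (fact (length xs)) (foldr (\<lambda>x h. ext_mult (fst (snd x)) (ext_mult (snd (snd x)) h)) xs g)"
proof (induction xs)
  case (Cons x xs)
  show ?case
    unfolding wedge2_power_Cons
    by (simp add: wedge2_power_eq_0 Cons ext_mult_sc del: of_nat_Suc funpow.simps)
qed simp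

text \<open>A pigeonhole argument: the 1-form and the 2-form of a list share the factors b, so each
  product contains more factors b than the list has entries, and one of them repeats.\<close>

lemma wedge1_wedge2_power_eq_0: "length xs \<le> j \<Longrightarrow> wedge1 xs ((wedge2 xs ^^ j) g) = 0"
proof (induction xs arbitrary: j)
  case Nil
  then show ?case by simp
next
  case (Cons x xs)
  have "ext_mult b (ext_mult a (ext_mult b h)) = 0" for a b :: "'a \<Rightarrow> complex" and h
    using ext_mult_2_commute[of b a b h] by simp
  then show ?case
    using Cons
    by (simp only: wedge2_power_Cons)
      (simp add: ext_mult_add ext_mult_sc wedge1_add wedge1_sc wedge2_power_eq_0 wedge1_ext_mult_2)
qed

text \<open>Now each b must occur exactly once. If the 1-form supplies the b of x, the 2-forms come
  from xs alone; otherwise x contributes its a \<and> b to one of the 2-forms. The two cases are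
  kept apart because they receive different time weights in \<open>block_line_sum\<close>.\<close>

lemma wedge1_wedge2_power_top:
  "wedge1 (x # xs) ((wedge2 (x # xs) ^^ length xs) g)
    = sc (of_nat (length xs)) (wedge1 xs (ext_mult (fst (snd x)) (ext_mult (snd (snd x)) ((wedge2 xs ^^ (length xs - 1)) g))))
    + sc (fst x) (ext_mult (snd (snd x)) ((wedge2 xs ^^ length xs) g))"
proof -
  have "ext_mult b (ext_mult a (ext_mult b h)) = 0" for a b :: "'a \<Rightarrow> complex" and h
    using ext_mult_2_commute[of b a b h] by simp
  then show ?thesis
    by (simp only: wedge2_power_Cons)
      (simp add: ext_mult_add ext_mult_sc wedge1_add wedge1_sc wedge1_wedge2_power_eq_0 wedge1_ext_mult_2)
qed

lemma wedge2_scale: "wedge2 (map (\<lambda>x. (f x, sc z (fst (snd x)), snd (snd x))) xs) g = sc z (wedge2 xs g)"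
  by (induction xs) (simp_all add: ext_mult_sc_left)

lemma wedge2_power_scale:
  "(wedge2 (map (\<lambda>x. (f x, sc z (fst (snd x)), snd (snd x))) xs) ^^ j) g = sc (z ^ j) ((wedge2 xs ^^ j) g)"
  by (induction j) (simp_all add: wedge2_scale wedge2_sc mult.commute)

lemma wedge1_scale: "wedge1 (map (\<lambda>x. (z * fst x, h x, snd (snd x))) xs) g = sc z (wedge1 xs g)"
  by (induction xs) simp_all

declare plus_fun_apply [simp] zero_fun_apply [simp]

section \<open>The scalar wedge product\<close>

definition swedge :: "('b list \<Rightarrow> complex) \<Rightarrow> ('b list \<Rightarrow> complex) \<Rightarrow> 'b list \<Rightarrow> complex" where
  "swedge f g vs = (\<Sum>S\<in>Pow {..<length vs}. shuffle_sign (length vs) S * (f (nths vs S) * g (nths vs (- S))))"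

text \<open>The new first position belongs to the complement and forms an inversion with every
  element of the shifted S.\<close>

lemma shuffle_sign_Suc_image:
  assumes "S \<subseteq> {..<n}"
  shows "shuffle_sign (Suc n) (Suc ` S) = (-1) ^ card S * shuffle_sign n S"
proof -
  let ?A = "{(i, j). i \<in> S \<and> j \<in> {..<n} - S \<and> j < i}"
  have fin: "finite S" using assms finite_subset by blast
  have finA: "finite ?A" by (rule finite_subset[of _ "{..<n} \<times> {..<n}"]) (use assms in auto)
  have "{(i, j). i \<in> Suc ` S \<and> j \<in> {..<Suc n} - Suc ` S \<and> j < i} = (\<lambda>i. (Suc i, 0)) ` S \<union> map_prod Suc Suc ` ?A"
    (is "?L = ?R")
  proof
    show "?L \<subseteq> ?R"
    proof
      fix x assume "x \<in> ?L"
      then obtain i j where x: "x = (Suc i, j)" "i \<in> S" "j < Suc n" "j \<notin> Suc ` S" "j < Suc i" by auto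
      then show "x \<in> ?R" by (cases j) auto
    qed
  qed auto
  moreover have "card ((\<lambda>i. (Suc i, 0)) ` S \<union> map_prod Suc Suc ` ?A) = card S + card ?A"
    using fin finA
    by (subst card_Un_disjoint) (auto simp: card_image inj_on_def)
  ultimately show ?thesis by (simp add: shuffle_sign_def power_add)
qed

lemma shuffle_sign_insert_Suc_image:
  assumes "S \<subseteq> {..<n}"
  shows "shuffle_sign (Suc n) (insert 0 (Suc ` S)) = shuffle_sign n S"
proof -
  let ?A = "{(i, j). i \<in> S \<and> j \<in> {..<n} - S \<and> j < i}"
  have "{(i, j). i \<in> insert 0 (Suc ` S) \<and> j \<in> {..<Suc n} - insert 0 (Suc ` S) \<and> j < i} = map_prod Suc Suc ` ?A"
    (is "?L = ?R")
  proof
    show "?L \<subseteq> ?R"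
    proof
      fix x assume "x \<in> ?L"
      then obtain i j where x: "x = (Suc i, j)" "i \<in> S" "j < Suc n" "j \<notin> Suc ` S" "j < Suc i" "j \<noteq> 0" by auto
      then show "x \<in> ?R" by (cases j) auto
    qed
  qed auto
  moreover have "card (map_prod Suc Suc ` ?A) = card ?A"
    by (intro card_image) (auto simp: inj_on_def)
  ultimately show ?thesis by (simp add: shuffle_sign_def)
qed

lemma swedge_Nil: "swedge f g [] = f [] * g []"
  by (simp add: swedge_def shuffle_sign_def)

text \<open>The shuffles split according to whether the first argument goes to f or to g. In the
  second case it has to pass all arguments of f, which yields the sign. This is the recursion that
  connects shuffles with \<open>ext_mult\<close>.\<close>

lemma swedge_Cons:
  "swedge f g (x # xs) = swedge (\<lambda>ys. f (x # ys)) g xs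
    + swedge (\<lambda>ys. (-1) ^ length ys * f ys) (\<lambda>ys. g (x # ys)) xs"
proof -
  let ?n = "length xs"
  let ?F = "\<lambda>S. shuffle_sign (Suc ?n) S * (f (nths (x # xs) S) * g (nths (x # xs) (- S)))"
  have P: "Pow {..<Suc ?n} = image Suc ` Pow {..<?n} \<union> insert 0 ` (image Suc ` Pow {..<?n})"
    unfolding lessThan_Suc_eq_insert_0 Pow_insert by (simp add: image_Pow_surj)
  have i1: "inj_on (image Suc) (Pow {..<?n})" by (auto simp: inj_on_def inj_image_eq_iff)
  have i2: "inj_on (insert 0) (image Suc ` Pow {..<?n})"
    by (auto simp: inj_on_def)
  have "swedge f g (x # xs) = sum ?F (Pow {..<Suc ?n})" by (simp add: swedge_def)
  also have "\<dots> = sum ?F (image Suc ` Pow {..<?n}) + sum ?F (insert 0 ` (image Suc ` Pow {..<?n}))"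
    unfolding P by (rule sum.union_disjoint) auto
  also have "sum ?F (image Suc ` Pow {..<?n}) = (\<Sum>S\<in>Pow {..<?n}. ?F (Suc ` S))"
    by (rule sum.reindex[OF i1, unfolded comp_def])
  also have "\<dots> = swedge (\<lambda>ys. (-1) ^ length ys * f ys) (\<lambda>ys. g (x # ys)) xs"
    unfolding swedge_def
  proof (rule sum.cong[OF refl])
    fix S assume "S \<in> Pow {..<?n}"
    then have S: "S \<subseteq> {..<?n}" by simp
    have "{i. i < ?n \<and> i \<in> S} = S" using S by auto
    then have len: "length (nths xs S) = card S" by (simp add: length_nths)
    have "{j. Suc j \<in> - Suc ` S} = - S" "{j. Suc j \<in> Suc ` S} = S" by auto
    then show "?F (Suc ` S) = shuffle_sign ?n S * ((-1) ^ length (nths xs S) * f (nths xs S) * g (x # nths xs (- S)))"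
      using S by (simp add: nths_Cons shuffle_sign_Suc_image len)
  qed
  also have "sum ?F (insert 0 ` (image Suc ` Pow {..<?n})) = (\<Sum>S\<in>Pow {..<?n}. ?F (insert 0 (Suc ` S)))"
    by (simp add: sum.reindex[OF i2] sum.reindex[OF i1] comp_def)
  also have "\<dots> = swedge (\<lambda>ys. f (x # ys)) g xs"
    unfolding swedge_def
  proof (rule sum.cong[OF refl])
    fix S assume "S \<in> Pow {..<?n}"
    then have S: "S \<subseteq> {..<?n}" by simp
    have "{j. Suc j \<in> - insert 0 (Suc ` S)} = - S" "{j. Suc j \<in> insert 0 (Suc ` S)} = S" by auto
    then show "?F (insert 0 (Suc ` S)) = shuffle_sign ?n S * (f (x # nths xs S) * g (nths xs (- S)))"
      using S by (simp add: nths_Cons shuffle_sign_insert_Suc_image)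
  qed
  finally show ?thesis by simp
qed

lemma swedge_zero: "swedge (\<lambda>ys. 0) g vs = 0"
  by (simp add: swedge_def)

lemma swedge_deg0: "(\<And>ys. f ys = (if ys = [] then k else 0)) \<Longrightarrow> swedge f g vs = k * g vs"
  by (induction vs arbitrary: f g) (simp_all add: swedge_Nil swedge_Cons swedge_zero)

lemma swedge_deg1: "(\<And>ys. f ys = (if length ys = 1 then \<alpha> (hd ys) else 0)) \<Longrightarrow> swedge f g vs = ext_mult \<alpha> g vs"
proof (induction vs arbitrary: f g)
  case Nil
  then show ?case by (simp add: swedge_Nil)
next
  case (Cons x xs)
  have "swedge (\<lambda>ys. f (x # ys)) g xs = \<alpha> x * g xs"
    by (rule swedge_deg0) (simp add: Cons.prems)
  moreover have "swedge (\<lambda>ys. (-1) ^ length ys * f ys) (\<lambda>ys. g (x # ys)) xs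
    = - swedge f (\<lambda>ys. g (x # ys)) xs"
  proof -
    have "(\<lambda>ys. (-1) ^ length ys * f ys) = (\<lambda>ys. - f ys)" by (simp add: Cons.prems fun_eq_iff)
    then show ?thesis by (simp add: swedge_def sum_negf)
  qed
  ultimately show ?case using Cons.IH[OF Cons.prems] by (simp add: swedge_Cons)
qed

text \<open>Contraction of a \<and> b with x is the 1-form a(x) b - b(x) a. The second summand has
  no sign because a \<and> b has even degree.\<close>

lemma wedge2_Cons_arg:
  "wedge2 ls g (x # xs)
    = ext_mult (\<lambda>y. \<Sum>(u, a, b)\<leftarrow>ls. a x * b y - a y * b x) g xs + wedge2 ls (\<lambda>ys. g (x # ys)) xs"
proof (induction ls)
  case Nil
  have "(\<lambda>y. 0) = (0 :: 'a \<Rightarrow> complex)" by (simp add: fun_eq_iff)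
  then show ?case by simp
next
  case (Cons l ls)
  obtain u a b where l: "l = (u, a, b)" by (cases l)
  have "(\<lambda>y. \<Sum>(u, a, b)\<leftarrow>l # ls. a x * b y - a y * b x)
    = sc (a x) b + sc (- b x) a + (\<lambda>y. \<Sum>(u, a, b)\<leftarrow>ls. a x * b y - a y * b x)"
    by (simp add: l sc_def fun_eq_iff)
  then show ?case
    using Cons ext_mult.simps(2)[of a "ext_mult b g" x xs]
    by (simp add: l ext_mult_add_left ext_mult_sc_left ext_mult_Cons_fun sc_apply del: ext_mult.simps list.map sum_list.Cons)
qed

lemma swedge_deg2:
  "(\<And>ys. f ys = (if length ys = 2 then \<Sum>(u, a, b)\<leftarrow>ls. a (ys ! 0) * b (ys ! 1) - a (ys ! 1) * b (ys ! 0) else 0))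
    \<Longrightarrow> swedge f g vs = wedge2 ls g vs"
proof (induction vs arbitrary: f g)
  case Nil
  have "wedge2 ls g [] = 0" by (induction ls) simp_all
  with Nil show ?case by (simp add: swedge_Nil)
next
  case (Cons x xs)
  have "swedge (\<lambda>ys. f (x # ys)) g xs = ext_mult (\<lambda>y. \<Sum>(u, a, b)\<leftarrow>ls. a x * b y - a y * b x) g xs"
    by (rule swedge_deg1) (auto simp: Cons.prems length_Suc_conv)
  moreover have "(\<lambda>ys. (-1) ^ length ys * f ys) = f" by (simp add: Cons.prems fun_eq_iff)
  ultimately show ?case using Cons.IH[OF Cons.prems] by (simp add: swedge_Cons wedge2_Cons_arg)
qed

section \<open>Odd forms as finite sums of global monomials u dg_1 \<and> ... \<and> dg_k\<close>

section \<open>Odd forms are sums of decomposable forms\<close>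

lemma ext_mult_cong:
  "(\<And>ys. Suc (length ys) = length vs \<Longrightarrow> g ys = h ys) \<Longrightarrow> ext_mult \<alpha> g vs = ext_mult \<alpha> h vs"
proof (induction vs arbitrary: g h)
  case (Cons x xs)
  show ?case using Cons.IH[of "\<lambda>ys. g (x # ys)" "\<lambda>ys. h (x # ys)"] Cons.prems by simp
qed simp

lemma ext_mult_map: "ext_mult \<alpha> g (map A vs) = ext_mult (\<lambda>v. \<alpha> (A v)) (\<lambda>ys. g (map A ys)) vs"
  by (induction vs arbitrary: g) simp_all

lemma ext_mult_sum_list: "ext_mult \<alpha> (\<lambda>ys. \<Sum>i\<leftarrow>xs. k i * g i ys) vs = (\<Sum>i\<leftarrow>xs. k i * ext_mult \<alpha> (g i) vs)"
proof (induction xs)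
  case Nil
  have "(\<lambda>ys. 0) = (0 :: 'a list \<Rightarrow> complex)" by (simp add: fun_eq_iff)
  then show ?case by simp
next
  case (Cons x xs)
  have "(\<lambda>ys. \<Sum>i\<leftarrow>x # xs. k i * g i ys) = sc (k x) (g x) + (\<lambda>ys. \<Sum>i\<leftarrow>xs. k i * g i ys)"
    by (simp add: fun_eq_iff sc_def)
  then show ?case using Cons by (simp add: ext_mult_add ext_mult_sc sc_apply)
qed

abbreviation decomposable :: "('b \<Rightarrow> complex) list \<Rightarrow> 'b list \<Rightarrow> complex" where
  "decomposable as \<equiv> foldr ext_mult as unit_form"

lemma decomposable_map: "decomposable as (map A vs) = decomposable (map (\<lambda>\<alpha> v. \<alpha> (A v)) as) vs"
proof (induction as arbitrary: vs)
  case Nil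
  then show ?case by (simp add: unit_form_def)
next
  case (Cons \<alpha> as)
  then show ?case by (simp add: ext_mult_map)
qed

lemma decomposable_length: "length as \<noteq> length vs \<Longrightarrow> decomposable as vs = 0"
proof (induction as arbitrary: vs)
  case Nil
  then show ?case by (simp add: unit_form_def)
next
  case (Cons \<alpha> as)
  have "ext_mult \<alpha> (decomposable as) vs = ext_mult \<alpha> 0 vs"
    by (rule ext_mult_cong) (use Cons in auto)
  then show ?case by simp
qed

context corner_mfd
begin

lemma alternating_at_Cons:
  assumes "alternating_at X \<alpha>"
  shows "alternating_at X (\<lambda>ys. \<alpha> (x # ys))"
  unfolding alternating_at_def
proof (intro conjI allI impI)
  have L: "linear (\<lambda>w. \<alpha> (ws[j := w]))" if "j < length ws" for j ws
    using that assms by (simp add: alternating_at_def)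
  fix vs :: "'b list" and i assume "i < length vs"
  then show "linear (\<lambda>w. \<alpha> (x # vs[i := w]))" using L[of "Suc i" "x # vs"] by simp
next
  fix vs :: "'b list" assume "\<not> distinct vs"
  then have "\<not> distinct (x # vs)" by simp
  then show "\<alpha> (x # vs) = 0" using assms unfolding alternating_at_def by (elim conjE) simp
next
  fix vs :: "'b list"
  have P: "\<alpha> (map P ws) = \<alpha> ws" for ws using assms by (simp add: alternating_at_def)
  show "\<alpha> (x # map P vs) = \<alpha> (x # vs)"
    using P[of "x # map P vs"] P[of "x # vs"] by (simp add: comp_def)
qed

lemma alternating_at_linear:
  assumes "alternating_at X \<alpha>" shows "linear (\<lambda>w. \<alpha> (w # ys))"
proof -
  have L: "linear (\<lambda>w. \<alpha> (ws[j := w]))" if "j < length ws" for j ws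
    using that assms by (simp add: alternating_at_def)
  show ?thesis using L[of 0 "0 # ys"] by simp
qed

lemma alternating_at_swap:
  assumes "alternating_at X \<alpha>"
  shows "\<alpha> (x # y # ys) = - \<alpha> (y # x # ys)"
proof -
  note l1 = alternating_at_linear[OF assms]
  note l2 = alternating_at_linear[OF alternating_at_Cons[OF assms]]
  have z: "\<alpha> (w # w # ys) = 0" for w using assms by (simp add: alternating_at_def)
  have "\<alpha> ((x + y) # (x + y) # ys) = \<alpha> (x # x # ys) + \<alpha> (x # y # ys) + (\<alpha> (y # x # ys) + \<alpha> (y # y # ys))"
    using linear_add[OF l1, of x y] linear_add[OF l2, of _ x y] by simp
  then show ?thesis by (simp add: z eq_neg_iff_add_eq_0)
qed

lemma alternating_at_expand:
  assumes "alternating_at X \<alpha>"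
  shows "\<alpha> (x # ys) = (\<Sum>b\<in>coords X. of_real (x \<bullet> b) * \<alpha> (b # ys))"
proof -
  note lin = alternating_at_linear[OF assms]
  have P: "\<alpha> (map P ws) = \<alpha> ws" for ws using assms by (simp add: alternating_at_def)
  have "\<alpha> (x # ys) = \<alpha> (P x # ys)" using P[of "x # ys"] P[of "P x # ys"] by simp
  also have "\<dots> = (\<Sum>b\<in>coords X. \<alpha> (((x \<bullet> b) *\<^sub>R b) # ys))"
    unfolding model_proj_def by (rule linear_sum[OF lin])
  also have "\<dots> = (\<Sum>b\<in>coords X. of_real (x \<bullet> b) * \<alpha> (b # ys))"
    using linear_scale[OF lin] by (simp add: scaleR_conv_of_real)
  finally show ?thesis .
qed

text \<open>The number operator: wedging each dual basis vector with the corresponding contraction,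
  and summing, multiplies a form by its degree.\<close>

lemma sum_ext_mult_contract:
  assumes "alternating_at X \<alpha>"
  shows "(\<Sum>b\<in>coords X. ext_mult (\<lambda>v. of_real (v \<bullet> b)) (\<lambda>ys. \<alpha> (b # ys)) vs) = of_nat (length vs) * \<alpha> vs"
  using assms
proof (induction vs arbitrary: \<alpha>)
  case (Cons x xs)
  have "(\<Sum>b\<in>coords X. ext_mult (\<lambda>v. of_real (v \<bullet> b)) (\<lambda>ys. \<alpha> (b # ys)) (x # xs))
    = \<alpha> (x # xs) - (\<Sum>b\<in>coords X. ext_mult (\<lambda>v. of_real (v \<bullet> b)) (\<lambda>ys. \<alpha> (b # x # ys)) xs)"
    using alternating_at_expand[OF Cons.prems, of x xs] by (simp add: sum_subtractf)
  also have "(\<Sum>b\<in>coords X. ext_mult (\<lambda>v. of_real (v \<bullet> b)) (\<lambda>ys. \<alpha> (b # x # ys)) xs)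
    = - (\<Sum>b\<in>coords X. ext_mult (\<lambda>v. of_real (v \<bullet> b)) (\<lambda>ys. \<alpha> (x # b # ys)) xs)"
  proof -
    have "(\<lambda>ys. \<alpha> (b # x # ys)) = - (\<lambda>ys. \<alpha> (x # b # ys))" for b
      using alternating_at_swap[OF Cons.prems, of b x] by (simp only: fun_eq_iff uminus_apply simp_thms)
    then show ?thesis by (simp add: ext_mult_uminus sum_negf)
  qed
  also have "(\<Sum>b\<in>coords X. ext_mult (\<lambda>v. of_real (v \<bullet> b)) (\<lambda>ys. \<alpha> (x # b # ys)) xs) = of_nat (length xs) * \<alpha> (x # xs)"
    by (rule Cons.IH[OF alternating_at_Cons[OF Cons.prems]])
  finally show ?case by (simp add: algebra_simps)
qed simp

text \<open>Iterating \<open>sum_ext_mult_contract\<close> peels off one basis covector at a time.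
  Since I runs over all lists and not only the increasing ones, each basis monomial is counted
  \<open>fact m\<close> times.\<close>

lemma alternating_at_decomposable:
  assumes bs: "set bs = coords X" "distinct bs" and "alternating_at X \<alpha>" "length vs = m"
  shows "fact m * \<alpha> vs = (\<Sum>I\<leftarrow>List.n_lists m bs. \<alpha> I * decomposable (map (\<lambda>b v. of_real (v \<bullet> b)) I) vs)"
  using assms(3,4)
proof (induction m arbitrary: \<alpha> vs)
  case 0
  then show ?case by (simp add: unit_form_def)
next
  case (Suc m)
  let ?D = "\<lambda>I. decomposable (map (\<lambda>b v. of_real (v \<bullet> b)) I)"
  have swap: "(\<Sum>I\<leftarrow>Ls. \<Sum>b\<in>coords X. F b I) = (\<Sum>b\<in>coords X. \<Sum>I\<leftarrow>Ls. F b I)" for Ls and F :: "'b \<Rightarrow> 'b list \<Rightarrow> complex"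
    by (induction Ls) (simp_all add: sum.distrib)
  have conc: "(\<Sum>x\<leftarrow>concat (map (\<lambda>ys. map (\<lambda>y. y # ys) bs) Ls). F x) = (\<Sum>I\<leftarrow>Ls. \<Sum>b\<in>coords X. F (b # I))"
    for Ls and F :: "'b list \<Rightarrow> complex"
    by (induction Ls) (simp_all add: comp_def sum_list_distinct_conv_sum_set[OF bs(2)] bs(1))
  have "fact (Suc m) * \<alpha> vs = fact m * (of_nat (length vs) * \<alpha> vs)"
    using Suc.prems by (simp add: algebra_simps)
  also have "\<dots> = (\<Sum>b\<in>coords X. fact m * ext_mult (\<lambda>v. of_real (v \<bullet> b)) (\<lambda>ys. \<alpha> (b # ys)) vs)"
    by (simp add: sum_ext_mult_contract[OF Suc.prems(1), symmetric] sum_distrib_left)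
  also have "\<dots> = (\<Sum>b\<in>coords X. ext_mult (\<lambda>v. of_real (v \<bullet> b)) (\<lambda>ys. \<Sum>I\<leftarrow>List.n_lists m bs. \<alpha> (b # I) * ?D I ys) vs)"
  proof (rule sum.cong[OF refl])
    fix b
    have "fact m * ext_mult (\<lambda>v. of_real (v \<bullet> b)) (\<lambda>ys. \<alpha> (b # ys)) vs
      = ext_mult (\<lambda>v. of_real (v \<bullet> b)) (sc (fact m) (\<lambda>ys. \<alpha> (b # ys))) vs"
      by (simp add: ext_mult_sc sc_apply)
    also have "\<dots> = ext_mult (\<lambda>v. of_real (v \<bullet> b)) (\<lambda>ys. \<Sum>I\<leftarrow>List.n_lists m bs. \<alpha> (b # I) * ?D I ys) vs"
      by (rule ext_mult_cong)
        (simp add: sc_apply Suc.IH[OF alternating_at_Cons[OF Suc.prems(1)]] Suc.prems(2))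
    finally show "fact m * ext_mult (\<lambda>v. of_real (v \<bullet> b)) (\<lambda>ys. \<alpha> (b # ys)) vs
      = ext_mult (\<lambda>v. of_real (v \<bullet> b)) (\<lambda>ys. \<Sum>I\<leftarrow>List.n_lists m bs. \<alpha> (b # I) * ?D I ys) vs" .
  qed
  also have "\<dots> = (\<Sum>b\<in>coords X. \<Sum>I\<leftarrow>List.n_lists m bs. \<alpha> (b # I) * ?D (b # I) vs)"
    by (simp add: ext_mult_sum_list)
  also have "\<dots> = (\<Sum>I\<leftarrow>List.n_lists (Suc m) bs. \<alpha> I * ?D I vs)"
    by (simp only: n_lists.simps conc swap)
  finally show ?case .
qed

lemma bounded_linear_coordinate: "bounded_linear (\<lambda>x :: 'b. complex_of_real (x \<bullet> b))"
  by (rule bounded_linear_compose[OF bounded_linear_of_real bounded_linear_inner_left])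

lemma odd_forms_props:
  assumes "\<omega> \<in> odd_forms X"
  shows "c \<in> charts X \<Longrightarrow> p \<in> fst c \<Longrightarrow> alternating_at X (\<omega> c p)"
    and "c \<in> charts X \<Longrightarrow> c' \<in> charts X \<Longrightarrow> p \<in> fst c \<Longrightarrow> p \<in> fst c' \<Longrightarrow> \<omega> c p vs = \<omega> c' p (map (cd c (snd c') p) vs)"
    and "c \<in> charts X \<Longrightarrow> p \<in> fst c \<Longrightarrow> sm_at (\<lambda>q. \<omega> c q vs) p"
    and "c \<notin> charts X \<or> p \<notin> fst c \<Longrightarrow> \<omega> c p vs = 0"
    and "even (length vs) \<Longrightarrow> \<omega> c p vs = 0"
proof -
  have t: "tensorial X \<omega>" and s: "\<forall>c\<in>charts X. \<forall>vs. smooth_fun X (fst c) (\<lambda>p. \<omega> c p vs)"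
    and e: "\<forall>c p vs. even (length vs) \<longrightarrow> \<omega> c p vs = 0"
    using assms unfolding odd_forms_def forms_def mem_Collect_eq by blast+
  show "c \<in> charts X \<Longrightarrow> p \<in> fst c \<Longrightarrow> alternating_at X (\<omega> c p)"
    using t unfolding tensorial_def by blast
  show "c \<in> charts X \<Longrightarrow> c' \<in> charts X \<Longrightarrow> p \<in> fst c \<Longrightarrow> p \<in> fst c' \<Longrightarrow> \<omega> c p vs = \<omega> c' p (map (cd c (snd c') p) vs)"
    using t unfolding tensorial_def by blast
  show "\<omega> c p vs = 0" if "c \<notin> charts X \<or> p \<notin> fst c"
  proof -
    have "\<omega> c p = (\<lambda>vs. 0)" using t that unfolding tensorial_def by blast
    then show ?thesis by simp
  qed
  show "c \<in> charts X \<Longrightarrow> p \<in> fst c \<Longrightarrow> sm_at (\<lambda>q. \<omega> c q vs) p"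
    using s smooth_fun_iff[OF ch_open[of c], of "\<lambda>q. \<omega> c q vs"] by blast
  show "even (length vs) \<Longrightarrow> \<omega> c p vs = 0" using e by blast
qed

lemma sum_list_single:
  fixes f :: "nat \<Rightarrow> complex"
  assumes "distinct ks" "\<And>k. k \<noteq> n \<Longrightarrow> f k = 0"
  shows "(\<Sum>k\<leftarrow>ks. f k) = (if n \<in> set ks then f n else 0)"
  using assms(1) by (induction ks) (auto intro!: assms(2))

text \<open>Evaluation at \<open>vs\<close> selects the degree k = \<open>length vs\<close>. The
  restriction to odd k up to the dimension loses nothing: \<omega> is odd, and in higher degree
  every index list repeats a basis vector. The functions g are tied to the coordinates of
  \<open>c'\<close> through their differentials at p, which admits cut-off coordinates.\<close>

lemma local_decomposition:
  assumes \<omega>: "\<omega> \<in> odd_forms X" and bs: "set bs = coords X" "distinct bs"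
    and c: "c \<in> charts X" "p \<in> fst c" and c': "c' \<in> charts X" "p \<in> fst c'"
    and g: "\<And>b v. b \<in> coords X \<Longrightarrow> cd c (g b) p v = of_real (cd c (snd c') p v \<bullet> b)"
  shows "\<omega> c p vs = (\<Sum>k\<leftarrow>filter odd [0..<Suc (length bs)]. \<Sum>I\<leftarrow>List.n_lists k bs.
    \<omega> c' p I / fact (length I) * decomposable (map (\<lambda>g. cd c g p) (map g I)) vs)"
    (is "_ = (\<Sum>k\<leftarrow>_. ?f k)")
proof -
  let ?n = "length vs"
  have len: "length I = k" "set I \<subseteq> coords X" if "I \<in> set (List.n_lists k bs)" for I k
    using that bs by (auto simp: set_n_lists)
  have z: "?f k = 0" if "k \<noteq> ?n" for k
  proof -
    have "decomposable (map (\<lambda>g. cd c g p) (map g I)) vs = 0" if "I \<in> set (List.n_lists k bs)" for I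
      using len(1)[OF that] \<open>k \<noteq> ?n\<close> by (intro decomposable_length) simp
    then have "?f k = (\<Sum>I\<leftarrow>List.n_lists k bs. 0)" by (intro arg_cong[of _ _ sum_list] map_cong) auto
    then show ?thesis by simp
  qed
  have "fact ?n * \<omega> c p vs = fact ?n * \<omega> c' p (map (cd c (snd c') p) vs)"
    using odd_forms_props(2)[OF \<omega> c(1) c'(1) c(2) c'(2), of vs] by simp
  also have "\<dots> = (\<Sum>I\<leftarrow>List.n_lists ?n bs. \<omega> c' p I *
      decomposable (map (\<lambda>b v. of_real (v \<bullet> b)) I) (map (cd c (snd c') p) vs))"
    by (rule alternating_at_decomposable[OF bs odd_forms_props(1)[OF \<omega> c']]) simp
  also have "\<dots> = (\<Sum>I\<leftarrow>List.n_lists ?n bs. \<omega> c' p I * decomposable (map (\<lambda>g. cd c g p) (map g I)) vs)"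
  proof (intro arg_cong[of _ _ sum_list] map_cong refl)
    fix I assume "I \<in> set (List.n_lists ?n bs)"
    then have I: "set I \<subseteq> coords X" by (rule len)
    have "map ((\<lambda>\<alpha> v. \<alpha> (cd c (snd c') p v)) \<circ> (\<lambda>b v. complex_of_real (v \<bullet> b))) I = map ((\<lambda>g. cd c g p) \<circ> g) I"
      using I g by (intro map_cong) (auto simp: fun_eq_iff)
    then show "\<omega> c' p I * decomposable (map (\<lambda>b v. of_real (v \<bullet> b)) I) (map (cd c (snd c') p) vs)
      = \<omega> c' p I * decomposable (map (\<lambda>g. cd c g p) (map g I)) vs"
      by (simp only: decomposable_map map_map)
  qed
  also have "\<dots> = fact ?n * ?f ?n"
    unfolding sum_list_const_mult[symmetric]
    by (intro arg_cong[of _ _ sum_list] map_cong refl) (simp add: len(1))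
  finally have eq: "\<omega> c p vs = ?f ?n" by simp
  have S: "(\<Sum>k\<leftarrow>filter odd [0..<Suc (length bs)]. ?f k)
      = (if ?n \<in> set (filter odd [0..<Suc (length bs)]) then ?f ?n else 0)"
    by (rule sum_list_single[OF distinct_filter[OF distinct_upt] z])
  show ?thesis
  proof (cases "odd ?n \<and> ?n < Suc (length bs)")
    case True
    then have "?n \<in> set (filter odd [0..<Suc (length bs)])" by (simp del: upt_Suc)
    then show ?thesis unfolding S by (simp only: if_True eq)
  next
    case False
    have "\<omega> c p vs = 0"
    proof (cases "even ?n")
      case True
      then show ?thesis by (rule odd_forms_props(5)[OF \<omega>])
    next
      case odd: False
      with False have n: "length bs < ?n" by simp
      have "\<omega> c' p I = 0" if "I \<in> set (List.n_lists ?n bs)" for I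
      proof -
        have "card (set I) \<le> card (set bs)" using len(2)[OF that] bs finite_coords by (intro card_mono) auto
        also have "\<dots> < length I" using n len(1)[OF that] distinct_card[OF bs(2)] by simp
        finally have "\<not> distinct I" using distinct_card[of I] by linarith
        moreover have "\<forall>vs. \<not> distinct vs \<longrightarrow> \<omega> c' p vs = 0"
          using odd_forms_props(1)[OF \<omega> c'] unfolding alternating_at_def by (elim conjE)
        ultimately show ?thesis by simp
      qed
      then have "?f ?n = (\<Sum>I\<leftarrow>List.n_lists ?n bs. 0)" by (intro arg_cong[of _ _ sum_list] map_cong) auto
      with eq show ?thesis by simp
    qed
    moreover have "?n \<notin> set (filter odd [0..<Suc (length bs)])" using False by (auto simp del: upt_Suc)
    ultimately show ?thesis unfolding S by (simp only: if_False)
  qed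
qed

text \<open>The coordinates of each chart are multiplied by \<chi> and the coefficients of \<omega>
  by \<rho>, which makes both global. Where \<open>\<rho> i\<close> is nonzero,
  \<open>\<chi> i\<close> is 1 nearby and the cut-off coordinates have the right differentials;
  where it is zero, the i-th part vanishes on both sides.\<close>

lemma odd_form_decomposition:
  assumes "compact (UNIV :: 'a set)" and \<omega>: "\<omega> \<in> odd_forms X"
  shows "\<exists>ts. (\<forall>t\<in>set ts. (\<forall>p. sm_at (fst t) p) \<and> (\<forall>g\<in>set (snd t). \<forall>p. sm_at g p) \<and> odd (length (snd t)))
    \<and> (\<forall>c\<in>charts X. \<forall>p\<in>fst c. \<forall>vs.
      \<omega> c p vs = (\<Sum>t\<leftarrow>ts. fst t p * decomposable (map (\<lambda>g. cd c g p) (snd t)) vs))"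
proof -
  obtain m :: nat and c and \<rho> \<chi> :: "nat \<Rightarrow> 'a \<Rightarrow> real" where pu0:
    "(\<forall>i<m. c i \<in> charts X \<and> (\<forall>q. sm_at (\<rho> i) q) \<and> (\<forall>q. sm_at (\<chi> i) q)
      \<and> supp_in (\<rho> i) (fst (c i)) \<and> supp_in (\<chi> i) (fst (c i))
      \<and> (\<forall>q. \<rho> i q \<noteq> 0 \<longrightarrow> (\<exists>V. open V \<and> q \<in> V \<and> (\<forall>q'\<in>V. \<chi> i q' = 1))))
    \<and> (\<forall>q. (\<Sum>i<m. \<rho> i q) = 1)"
    using partition_of_unity[OF assms(1)] by (elim exE)
  then have pu: "\<And>i. i < m \<Longrightarrow> c i \<in> charts X" "\<And>i q. i < m \<Longrightarrow> sm_at (\<rho> i) q" "\<And>i q. i < m \<Longrightarrow> sm_at (\<chi> i) q"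
    "\<And>i. i < m \<Longrightarrow> supp_in (\<rho> i) (fst (c i))" "\<And>i. i < m \<Longrightarrow> supp_in (\<chi> i) (fst (c i))"
    "\<And>i q. i < m \<Longrightarrow> \<rho> i q \<noteq> 0 \<Longrightarrow> \<exists>V. open V \<and> q \<in> V \<and> (\<forall>q'\<in>V. \<chi> i q' = 1)"
    "\<And>q. (\<Sum>i<m. \<rho> i q) = 1"
    by simp_all
  obtain bs where bs: "set bs = coords X" "distinct bs"
    using finite_distinct_list[OF finite_coords] by blast
  define g where "g i b q = \<chi> i q *\<^sub>R complex_of_real (snd (c i) q \<bullet> b)" for i b q
  define u where "u i I q = \<rho> i q *\<^sub>R (\<omega> (c i) q I / fact (length I))" for i I q
  define ts where "ts = concat (map (\<lambda>i. concat (map (\<lambda>k. map (\<lambda>I. (u i I, map (g i) I)) (List.n_lists k bs))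
    (filter odd [0..<Suc (length bs)]))) [0..<m])"
  have ts_sum: "(\<Sum>t\<leftarrow>ts. F t) = (\<Sum>i<m. \<Sum>k\<leftarrow>filter odd [0..<Suc (length bs)]. \<Sum>I\<leftarrow>List.n_lists k bs. F (u i I, map (g i) I))"
    for F :: "_ \<Rightarrow> complex"
  proof -
    have conc: "(\<Sum>t\<leftarrow>concat xss. F t) = (\<Sum>xs\<leftarrow>xss. \<Sum>t\<leftarrow>xs. F t)" for xss
      by (induction xss) simp_all
    show ?thesis
      unfolding ts_def conc map_map comp_def
      by (simp only: interv_sum_list_conv_sum_set_nat set_upt atLeast0LessThan)
  qed
  show ?thesis
  proof (intro exI[of _ ts] conjI ballI allI)
    fix t assume "t \<in> set ts"
    then obtain i k I where I: "i < m" "odd k" "I \<in> set (List.n_lists k bs)" "t = (u i I, map (g i) I)"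
      by (auto simp: ts_def simp del: upt_Suc)
    have "sm_at (u i I) q" for q
    proof -
      have "sm_at (\<lambda>q. \<omega> (c i) q I / fact (length I)) q" if "q \<in> fst (c i)" for q
        by (rule sm_at_bounded_linear[OF bounded_linear_divide]) (rule odd_forms_props(3)[OF \<omega> pu(1)[OF I(1)] that])
      then show ?thesis unfolding u_def by (rule sm_at_scaleR_supp_in[OF pu(4)[OF I(1)] pu(2)[OF I(1)]])
    qed
    moreover have "sm_at (g i b) q" for b q
    proof -
      have "sm_at (\<lambda>q. complex_of_real (snd (c i) q \<bullet> b)) q" if "q \<in> fst (c i)" for q
        by (rule sm_at_bounded_linear[OF bounded_linear_coordinate sm_at_chart_map[OF pu(1)[OF I(1)] that]])
      then show ?thesis unfolding g_def by (rule sm_at_scaleR_supp_in[OF pu(5)[OF I(1)] pu(3)[OF I(1)]])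
    qed
    ultimately have "(\<forall>p. sm_at (fst t) p) \<and> (\<forall>g\<in>set (snd t). \<forall>p. sm_at g p) \<and> odd (length (snd t))"
      using I by (auto simp: set_n_lists)
    then show "\<And>p. sm_at (fst t) p" "\<And>h p. h \<in> set (snd t) \<Longrightarrow> sm_at h p" "odd (length (snd t))"
      by blast+
  next
    fix c0 p vs assume c0: "c0 \<in> charts X" "p \<in> fst c0"
    have summand: "of_real (\<rho> i p) * \<omega> c0 p vs = (\<Sum>k\<leftarrow>filter odd [0..<Suc (length bs)]. \<Sum>I\<leftarrow>List.n_lists k bs.
      u i I p * decomposable (map (\<lambda>g. cd c0 g p) (map (g i) I)) vs)" if i: "i < m" for i
    proof (cases "\<rho> i p = 0")
      case True
      then show ?thesis by (simp add: u_def)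
    next
      case False
      obtain V where V: "open V" "p \<in> V" "\<And>q. q \<in> V \<Longrightarrow> \<chi> i q = 1" using pu(6)[OF i False] by blast
      have ci: "c i \<in> charts X" "p \<in> fst (c i)"
        using pu(1)[OF i] supp_in_zero[OF pu(4)[OF i]] False by auto
      have g: "cd c0 (g i b) p v = of_real (cd c0 (snd (c i)) p v \<bullet> b)" for b v
      proof -
        have s: "sm_at (\<lambda>q. complex_of_real (snd (c i) q \<bullet> b)) p"
          by (rule sm_at_bounded_linear[OF bounded_linear_coordinate sm_at_chart_map[OF ci]])
        have "cd c0 (g i b) p v = cd c0 (\<lambda>q. complex_of_real (snd (c i) q \<bullet> b)) p v"
          by (rule cd_cong[OF s c0 V(1,2), symmetric]) (simp add: g_def V(3))
        then show ?thesis
          using cd_bounded_linear[OF bounded_linear_coordinate sm_at_chart_map[OF ci] c0] by simp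
      qed
      show ?thesis
        unfolding local_decomposition[OF \<omega> bs c0 ci g, of vs] sum_list_const_mult[symmetric]
        by (intro arg_cong[of _ _ sum_list] map_cong refl) (simp add: u_def scaleR_conv_of_real mult.assoc)
    qed
    have "\<omega> c0 p vs = (\<Sum>i<m. of_real (\<rho> i p) * \<omega> c0 p vs)"
      using pu(7)[of p] by (simp flip: sum_distrib_right of_real_sum)
    also have "\<dots> = (\<Sum>t\<leftarrow>ts. fst t p * decomposable (map (\<lambda>g. cd c0 g p) (snd t)) vs)"
      unfolding ts_sum by (rule sum.cong) (simp_all add: summand)
    finally show "\<omega> c0 p vs = (\<Sum>t\<leftarrow>ts. fst t p * decomposable (map (\<lambda>g. cd c0 g p) (snd t)) vs)" .
  qed
qed

end

section \<open>Product bundles with diagonal connections, and their curvature\<close>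

section \<open>Diagonal matrices of forms\<close>

definition dmat :: "nat \<Rightarrow> (nat \<Rightarrow> complex) \<Rightarrow> complex mat" where
  "dmat n f = mat n n (\<lambda>(i, j). if i = j then f i else 0)"

lemma dmat_carrier [simp]: "dmat n f \<in> carrier_mat n n"
  by (simp add: dmat_def)

lemma dmat_mult: "dmat n f * dmat n g = dmat n (\<lambda>i. f i * g i)"
proof (rule eq_matI)
  fix i j assume ij: "i < dim_row (dmat n (\<lambda>i. f i * g i))" "j < dim_col (dmat n (\<lambda>i. f i * g i))"
  have "(\<Sum>k = 0..<n. (if i = k then f i else 0) * (if k = j then g k else 0))
      = (\<Sum>k = 0..<n. if k = i then (if i = j then f i * g i else 0) else 0)"
    by (rule sum.cong) auto
  then show "(dmat n f * dmat n g) $$ (i, j) = dmat n (\<lambda>i. f i * g i) $$ (i, j)"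
    using ij by (simp add: dmat_def scalar_prod_def)
qed (simp_all add: dmat_def)

lemma dmat_mult_vec: "v \<in> carrier_vec n \<Longrightarrow> dmat n f *\<^sub>v v = vec n (\<lambda>i. f i * v $ i)"
proof (rule eq_vecI)
  fix i assume v: "v \<in> carrier_vec n" and i: "i < dim_vec (vec n (\<lambda>i. f i * v $ i))"
  have "(\<Sum>k = 0..<n. (if i = k then f i else 0) * v $ k) = (\<Sum>k = 0..<n. if k = i then f i * v $ i else 0)"
    by (rule sum.cong) auto
  then show "(dmat n f *\<^sub>v v) $ i = vec n (\<lambda>i. f i * v $ i) $ i"
    using v i by (simp add: dmat_def scalar_prod_def)
qed (simp_all add: dmat_def)

lemma mentry_dmat: "mentry (dmat n f) i j = (if i = j \<and> i < n then f i else 0)"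
  by (auto simp: mentry_def dmat_def)

lemma mat_trace_dmat: "mat_trace (dmat n f) = (\<Sum>i<n. f i)"
  by (auto simp: mat_trace_def dmat_def intro!: sum.cong)

text \<open>Diagonal matrix valued forms multiply entrywise, which reduces traces of wedge products
  to sums of scalar shuffle products.\<close>

lemma mwedge_dmat:
  "mwedge n (\<lambda>vs. dmat n (\<lambda>i. f i vs)) (\<lambda>vs. dmat n (\<lambda>i. g i vs)) vs = dmat n (\<lambda>i. swedge (f i) (g i) vs)"
  unfolding mwedge_def dmat_mult
  by (rule eq_matI) (simp_all add: dmat_def swedge_def)

lemma mwedge_power_dmat:
  "mwedge_power n (\<lambda>vs. dmat n (\<lambda>i. f i vs)) k vs = dmat n (\<lambda>i. (swedge (f i) ^^ k) unit_form vs)"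
proof (induction k arbitrary: vs)
  case 0
  show ?case by (rule eq_matI) (simp_all add: dmat_def unit_form_def)
next
  case (Suc k)
  then have "mwedge_power n (\<lambda>vs. dmat n (\<lambda>i. f i vs)) k = (\<lambda>vs. dmat n (\<lambda>i. (swedge (f i) ^^ k) unit_form vs))" by blast
  then show ?case by (simp add: mwedge_dmat)
qed

lemma mat_eq_mentryI:
  assumes "A \<in> carrier_mat n n" "B \<in> carrier_mat n n" "\<And>i j. mentry A i j = mentry B i j"
  shows "A = B"
proof (rule eq_matI)
  fix i j assume "i < dim_row B" "j < dim_col B"
  then show "A $$ (i, j) = B $$ (i, j)" using assms(3)[of i j] assms(1,2) by (simp add: mentry_def)
qed (use assms in auto)

lemma minv_one: "minv (1\<^sub>m n) = 1\<^sub>m n"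
proof (cases "mat_inverse (1\<^sub>m n :: complex mat)")
  \<comment> \<open>\<open>minv\<close> unwraps an option, so \<open>None\<close> has to be
    excluded: the identity is a unit of the matrix ring.\<close>
  case None
  have "(1\<^sub>m n :: complex mat) \<in> Units (ring_mat TYPE(complex) n ())"
    unfolding Units_def by (auto simp: ring_mat_simps intro!: bexI[of _ "1\<^sub>m n"])
  with mat_inverse(1)[OF one_carrier_mat None, where b = "()"] show ?thesis by blast
next
  case (Some B)
  from mat_inverse(2)[OF one_carrier_mat Some] have "B = 1\<^sub>m n" by auto
  with Some show ?thesis by (simp add: minv_def)
qed

context corner_mfd
begin

section \<open>Forms given by functions\<close>

text \<open>A list of pairs \<open>(u, g)\<close> of functions encodes the 1-form \<open>\<Sum> u dg\<close> and its derivative \<open>\<Sum> du \<and> dg\<close>.\<close>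

definition form1 :: "(('a \<Rightarrow> complex) \<times> ('a \<Rightarrow> complex)) list \<Rightarrow> ('a, 'b) cform" where
  "form1 B c p vs = (if c \<in> charts X \<and> p \<in> fst c \<and> length vs = 1
     then \<Sum>x\<leftarrow>B. fst x p * cd c (snd x) p (hd vs) else 0)"

definition form2 :: "(('a \<Rightarrow> complex) \<times> ('a \<Rightarrow> complex)) list \<Rightarrow> ('a, 'b) cform" where
  "form2 B c p vs = (if c \<in> charts X \<and> p \<in> fst c \<and> length vs = 2
     then \<Sum>x\<leftarrow>B. cd c (fst x) p (vs ! 0) * cd c (snd x) p (vs ! 1) - cd c (fst x) p (vs ! 1) * cd c (snd x) p (vs ! 0)
     else 0)"

definition smooth_pairs :: "(('a \<Rightarrow> complex) \<times> ('a \<Rightarrow> complex)) list \<Rightarrow> bool" where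
  "smooth_pairs B \<longleftrightarrow> (\<forall>x\<in>set B. \<forall>p. sm_at (fst x) p \<and> sm_at (snd x) p)"

lemma smooth_pairsD: "smooth_pairs B \<Longrightarrow> x \<in> set B \<Longrightarrow> sm_at (fst x) p" "smooth_pairs B \<Longrightarrow> x \<in> set B \<Longrightarrow> sm_at (snd x) p"
  by (auto simp: smooth_pairs_def)

lemma linear_sum_list:
  "(\<And>x. x \<in> set xs \<Longrightarrow> linear (f x)) \<Longrightarrow> linear (\<lambda>w. \<Sum>x\<leftarrow>xs. f x w)"
  by (induction xs) (auto intro: linear_compose_add linear_zero)

lemma linear_cmult_left: "linear (f :: 'c::real_vector \<Rightarrow> complex) \<Longrightarrow> linear (\<lambda>w. k * f w)"
  by (auto simp: linear_iff algebra_simps)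

lemma tensorial_form1:
  assumes "smooth_pairs B" shows "tensorial X (form1 B)"
  unfolding tensorial_def
proof (intro conjI ballI allI impI)
  show "form1 B c p = (\<lambda>vs. 0)" if "c \<notin> charts X \<or> p \<notin> fst c" for c p
    using that by (auto simp: form1_def fun_eq_iff)
  fix c p assume c: "c \<in> charts X" "p \<in> fst c"
  show "alternating_at X (form1 B c p)"
    unfolding alternating_at_def
  proof (intro conjI allI impI)
    fix vs :: "'b list" and i assume i: "i < length vs"
    show "linear (\<lambda>w. form1 B c p (vs[i := w]))"
    proof (cases "length vs = 1")
      case True
      then have "form1 B c p (vs[i := w]) = (\<Sum>x\<leftarrow>B. fst x p * cd c (snd x) p w)" for w
        using i c by (auto simp: form1_def length_Suc_conv)
      moreover have "linear (\<lambda>w. \<Sum>x\<leftarrow>B. fst x p * cd c (snd x) p w)"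
        by (intro linear_sum_list linear_cmult_left cd_linear c smooth_pairsD(2)[OF assms])
      ultimately show ?thesis by simp
    qed (simp add: form1_def linear_zero)
  next
    fix vs :: "'b list" assume "\<not> distinct vs"
    then show "form1 B c p vs = 0" by (auto simp: form1_def length_Suc_conv)
  next
    fix vs :: "'b list"
    show "form1 B c p (map P vs) = form1 B c p vs" by (cases vs) (auto simp: form1_def)
  qed
next
  fix c c' p vs assume c: "c \<in> charts X" "c' \<in> charts X" "p \<in> fst c \<inter> fst c'"
  have "cd c (snd x) p v = cd c' (snd x) p (cd c (snd c') p v)" if "x \<in> set B" for x v
    using c by (intro cd_chain smooth_pairsD(2)[OF assms that]) auto
  then have "(\<Sum>x\<leftarrow>B. fst x p * cd c (snd x) p v) = (\<Sum>x\<leftarrow>B. fst x p * cd c' (snd x) p (cd c (snd c') p v))" for v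
    by (intro arg_cong[of _ _ sum_list] map_cong refl) simp
  then show "form1 B c p vs = form1 B c' p (map (cd c (snd c') p) vs)"
    using c by (cases vs) (auto simp: form1_def)
qed

lemma tensorial_form2:
  assumes "smooth_pairs B" shows "tensorial X (form2 B)"
  unfolding tensorial_def
proof (intro conjI ballI allI impI)
  show "form2 B c p = (\<lambda>vs. 0)" if "c \<notin> charts X \<or> p \<notin> fst c" for c p
    using that by (auto simp: form2_def fun_eq_iff)
  fix c p assume c: "c \<in> charts X" "p \<in> fst c"
  have len2: "\<exists>x y. vs = [x, y]" if "length vs = 2" for vs :: "'b list"
    using that by (auto simp: length_Suc_conv numeral_2_eq_2)
  show "alternating_at X (form2 B c p)"
    unfolding alternating_at_def
  proof (intro conjI allI impI)
    fix vs :: "'b list" and i assume i: "i < length vs"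
    show "linear (\<lambda>w. form2 B c p (vs[i := w]))"
    proof (cases "length vs = 2")
      case True
      then obtain x y where vs: "vs = [x, y]" using len2 by blast
      let ?L = "\<lambda>y w. \<Sum>z\<leftarrow>B. cd c (snd z) p y * cd c (fst z) p w - cd c (fst z) p y * cd c (snd z) p w"
      let ?R = "\<lambda>x w. \<Sum>z\<leftarrow>B. cd c (fst z) p x * cd c (snd z) p w - cd c (snd z) p x * cd c (fst z) p w"
      have "linear (?L y)" "linear (?R x)"
        by (intro linear_sum_list linear_compose_sub linear_cmult_left cd_linear c smooth_pairsD[OF assms]; assumption)+
      moreover have "(\<lambda>w. form2 B c p (vs[i := w])) = ?L y \<or> (\<lambda>w. form2 B c p (vs[i := w])) = ?R x"
        using i c by (auto simp: form2_def vs less_Suc_eq mult.commute)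
      ultimately show ?thesis by (elim disjE) simp_all
    qed (simp add: form2_def linear_zero)
  next
    fix vs :: "'b list" assume d: "\<not> distinct vs"
    show "form2 B c p vs = 0"
    proof (cases "length vs = 2")
      case True
      then show ?thesis using len2[OF True] d by (auto simp: form2_def)
    qed (simp add: form2_def)
  next
    fix vs :: "'b list"
    show "form2 B c p (map P vs) = form2 B c p vs" by (simp add: form2_def cong: if_cong)
  qed
next
  fix c c' p and vs :: "'b list" assume c: "c \<in> charts X" "c' \<in> charts X" "p \<in> fst c \<inter> fst c'"
  have e: "cd c (snd x) p v = cd c' (snd x) p (cd c (snd c') p v)" "cd c (fst x) p v = cd c' (fst x) p (cd c (snd c') p v)"
    if "x \<in> set B" for x v
    using c by (auto intro!: cd_chain smooth_pairsD[OF assms that])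
  have "(\<Sum>x\<leftarrow>B. cd c (fst x) p v * cd c (snd x) p w - cd c (fst x) p w * cd c (snd x) p v)
    = (\<Sum>x\<leftarrow>B. cd c' (fst x) p (cd c (snd c') p v) * cd c' (snd x) p (cd c (snd c') p w)
        - cd c' (fst x) p (cd c (snd c') p w) * cd c' (snd x) p (cd c (snd c') p v))" for v w
    by (intro arg_cong[of _ _ sum_list] map_cong refl) (simp only: e)
  then show "form2 B c p vs = form2 B c' p (map (cd c (snd c') p) vs)"
    using c by (simp add: form2_def)
qed

lemma sm_at_form1:
  assumes "smooth_pairs B" "c \<in> charts X" "p \<in> fst c"
  shows "sm_at (\<lambda>q. form1 B c q vs) p"
proof (cases "length vs = 1")
  case True
  have "sm_at (\<lambda>q. \<Sum>x\<leftarrow>B. fst x q * cd c (snd x) q (hd vs)) p"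
    by (intro sm_at_sum_list sm_at_mult sm_at_cd assms smooth_pairsD[OF assms(1)])
  then show ?thesis
    by (rule sm_at_cong[OF _ ch_open[OF assms(2)] assms(3)]) (use True assms in \<open>simp add: form1_def\<close>)
qed (simp add: form1_def)

lemma sm_at_form2:
  assumes "smooth_pairs B" "c \<in> charts X" "p \<in> fst c"
  shows "sm_at (\<lambda>q. form2 B c q vs) p"
proof (cases "length vs = 2")
  case True
  have "sm_at (\<lambda>q. \<Sum>x\<leftarrow>B. cd c (fst x) q (vs ! 0) * cd c (snd x) q (vs ! 1) - cd c (fst x) q (vs ! 1) * cd c (snd x) q (vs ! 0)) p"
    by (intro sm_at_sum_list sm_at_diff sm_at_mult sm_at_cd assms smooth_pairsD[OF assms(1)])
  then show ?thesis
    by (rule sm_at_cong[OF _ ch_open[OF assms(2)] assms(3)]) (use True assms in \<open>simp add: form2_def\<close>)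
qed (simp add: form2_def)

lemma tensorial_zero: "tensorial X (\<lambda>c p vs. 0)"
  by (simp add: tensorial_def alternating_at_def linear_zero)

lemma tensorial_add_scaled:
  assumes "tensorial X f" "tensorial X g"
  shows "tensorial X (\<lambda>c p vs. f c p vs + g c p vs * h p)"
proof -
  have f: "\<And>c p. c \<notin> charts X \<or> p \<notin> fst c \<Longrightarrow> f c p = (\<lambda>vs. 0)" "\<And>c p. c \<in> charts X \<Longrightarrow> p \<in> fst c \<Longrightarrow> alternating_at X (f c p)"
    "\<And>c c' p vs. c \<in> charts X \<Longrightarrow> c' \<in> charts X \<Longrightarrow> p \<in> fst c \<inter> fst c' \<Longrightarrow> f c p vs = f c' p (map (cd c (snd c') p) vs)"
    using assms(1) unfolding tensorial_def by blast+
  have g: "\<And>c p. c \<notin> charts X \<or> p \<notin> fst c \<Longrightarrow> g c p = (\<lambda>vs. 0)" "\<And>c p. c \<in> charts X \<Longrightarrow> p \<in> fst c \<Longrightarrow> alternating_at X (g c p)"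
    "\<And>c c' p vs. c \<in> charts X \<Longrightarrow> c' \<in> charts X \<Longrightarrow> p \<in> fst c \<inter> fst c' \<Longrightarrow> g c p vs = g c' p (map (cd c (snd c') p) vs)"
    using assms(2) unfolding tensorial_def by blast+
  show ?thesis
    unfolding tensorial_def
  proof (intro conjI ballI allI impI)
    show "(\<lambda>vs. f c p vs + g c p vs * h p) = (\<lambda>vs. 0)" if "c \<notin> charts X \<or> p \<notin> fst c" for c p
      using f(1)[OF that] g(1)[OF that] by simp
    fix c p assume c: "c \<in> charts X" "p \<in> fst c"
    show "alternating_at X (\<lambda>vs. f c p vs + g c p vs * h p)"
    proof -
      have l: "linear (\<lambda>w. a w + b w * h p)" if "linear a" "linear b" for a b :: "'b \<Rightarrow> complex"
        using linear_compose_add[OF that(1) linear_cmult_left[OF that(2), of "h p"]] by (simp add: mult.commute)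
      show ?thesis
        using f(2)[OF c] g(2)[OF c] unfolding alternating_at_def by (auto intro!: l)
    qed
  next
    fix c c' p vs assume c: "c \<in> charts X" "c' \<in> charts X" "p \<in> fst c \<inter> fst c'"
    show "f c p vs + g c p vs * h p = f c' p (map (cd c (snd c') p) vs) + g c' p (map (cd c (snd c') p) vs) * h p"
      using f(3)[OF c, of vs] g(3)[OF c, of vs] by simp
  qed
qed

section \<open>The product bundle\<close>

lemma product_bundle_simps [simp]:
  "rk (product_bundle n) p = n" "trivs (product_bundle n) = {(UNIV, \<lambda>p. 1\<^sub>m n)}"
  by (simp_all add: product_bundle_def)

lemma smooth_fun_UNIV: "smooth_fun X UNIV f \<longleftrightarrow> (\<forall>p. sm_at f p)"
  using smooth_fun_iff[OF open_UNIV] by simp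

lemma sections_product_iff:
  "s \<in> sections X (product_bundle n) \<longleftrightarrow> (\<forall>p. s p \<in> carrier_vec n) \<and> (\<forall>i<n. \<forall>p. sm_at (\<lambda>q. s q $ i) p)"
proof (cases "\<forall>p. s p \<in> carrier_vec n")
  case True
  have v: "(\<lambda>q. ventry (s q) i) = (if i < n then \<lambda>q. s q $ i else (\<lambda>q. 0))" for i
  proof -
    have "dim_vec (s q) = n" for q using True by auto
    then show ?thesis by (auto simp: ventry_def fun_eq_iff)
  qed
  have e: "1\<^sub>m n *\<^sub>v s q = s q" for q using True by auto
  have "s \<in> sections X (product_bundle n) \<longleftrightarrow> (\<forall>i. smooth_fun X UNIV (\<lambda>q. ventry (s q) i))"
    using True by (simp add: sections_def smooth_vec_def e)
  also have "\<dots> \<longleftrightarrow> (\<forall>i<n. \<forall>p. sm_at (\<lambda>q. s q $ i) p)"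
    unfolding smooth_fun_UNIV v by auto
  finally show ?thesis using True by simp
qed (auto simp: sections_def)

lemma const_section: "v \<in> carrier_vec n \<Longrightarrow> (\<lambda>p. v) \<in> sections X (product_bundle n)"
  by (simp add: sections_product_iff)

lemma vforms_product_iff:
  "\<alpha> \<in> vforms X (product_bundle n) k \<longleftrightarrow> (\<forall>c p vs. \<alpha> c p vs \<in> carrier_vec n)
    \<and> (\<forall>c p vs. length vs \<noteq> k \<longrightarrow> \<alpha> c p vs = 0\<^sub>v n)
    \<and> (\<forall>i. tensorial X (\<lambda>c p vs. ventry (\<alpha> c p vs) i))
    \<and> (\<forall>c\<in>charts X. \<forall>p\<in>fst c. \<forall>vs i. sm_at (\<lambda>q. ventry (\<alpha> c q vs) i) p)"
proof (cases "\<forall>c p vs. \<alpha> c p vs \<in> carrier_vec n")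
  case True
  then have e: "1\<^sub>m n *\<^sub>v \<alpha> c q vs = \<alpha> c q vs" for c q vs by (intro one_mult_mat_vec) blast
  have "(\<forall>c\<in>charts X. \<forall>vs. smooth_vec X (fst c) (\<lambda>q. \<alpha> c q vs))
    \<longleftrightarrow> (\<forall>c\<in>charts X. \<forall>p\<in>fst c. \<forall>vs i. sm_at (\<lambda>q. ventry (\<alpha> c q vs) i) p)"
    unfolding smooth_vec_def using smooth_fun_iff[OF ch_open] by blast
  then show ?thesis unfolding vforms_def mem_Collect_eq by (simp only: product_bundle_simps e True) (auto simp: e)
qed (auto simp: vforms_def)

lemma diag_endform:
  assumes "\<And>i. i < n \<Longrightarrow> tensorial X (f i)" "\<And>i c p vs. length vs \<noteq> k \<Longrightarrow> f i c p vs = 0"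
    and "\<And>i c p vs. i < n \<Longrightarrow> c \<in> charts X \<Longrightarrow> p \<in> fst c \<Longrightarrow> sm_at (\<lambda>q. f i c q vs) p"
  shows "(\<lambda>c p vs. dmat n (\<lambda>i. f i c p vs)) \<in> endforms X (product_bundle n) k"
proof -
  have t: "tensorial X (\<lambda>c p vs. mentry (dmat n (\<lambda>i. f i c p vs)) i j)" for i j
  proof (cases "i = j \<and> i < n")
    case True
    then have "(\<lambda>c p vs. mentry (dmat n (\<lambda>i. f i c p vs)) i j) = f i" by (simp add: mentry_dmat)
    then show ?thesis using assms(1) True by simp
  next
    case False
    then have "(\<lambda>c p vs. mentry (dmat n (\<lambda>i. f i c p vs)) i j) = (\<lambda>c p vs. 0)" unfolding mentry_dmat by (simp only: if_False)
    then show ?thesis using tensorial_zero by simp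
  qed
  have s: "sm_at (\<lambda>q. mentry (dmat n (\<lambda>i. f i c q vs)) i j) p" if "c \<in> charts X" "p \<in> fst c" for c p vs i j
    unfolding mentry_dmat
    using assms(3)[of i, OF _ that] by (cases "i = j \<and> i < n") (simp, simp only: if_False sm_at_const)
  have e: "1\<^sub>m n * dmat n f * minv (1\<^sub>m n) = dmat n f" for f
    using left_mult_one_mat[OF dmat_carrier] right_mult_one_mat[OF dmat_carrier] by (simp add: minv_one)
  have z: "dmat n (\<lambda>i. f i c p vs) = 0\<^sub>m n n" if "length vs \<noteq> k" for c p vs
    using assms(2)[OF that] by (auto simp: dmat_def intro!: eq_matI)
  have "smooth_mat X (fst c) (\<lambda>p. dmat n (\<lambda>i. f i c p vs))" if "c \<in> charts X" for c vs
    unfolding smooth_mat_def using smooth_fun_iff[OF ch_open[OF that]] s[OF that] by blast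
  with t z show ?thesis
    unfolding endforms_def mem_Collect_eq by (simp add: e)
qed

section \<open>Vector fields\<close>

lemma vector_fieldsD:
  assumes "Z \<in> vector_fields X"
  shows "c \<in> charts X \<Longrightarrow> p \<in> fst c \<Longrightarrow> sm_at (Z c) p"
    and "c \<in> charts X \<Longrightarrow> c' \<in> charts X \<Longrightarrow> p \<in> fst c \<Longrightarrow> p \<in> fst c' \<Longrightarrow> Z c' p = cd c (snd c') p (Z c p)"
proof -
  have s: "\<forall>c\<in>charts X. smooth_fun X (fst c) (Z c)"
    and t: "\<forall>c\<in>charts X. \<forall>c'\<in>charts X. \<forall>p\<in>fst c \<inter> fst c'. Z c' p = cd c (snd c') p (Z c p)"
    using assms unfolding vector_fields_def mem_Collect_eq by blast+
  show "c \<in> charts X \<Longrightarrow> p \<in> fst c \<Longrightarrow> sm_at (Z c) p"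
    using s smooth_fun_iff[OF ch_open[of c], of "Z c"] by blast
  show "c \<in> charts X \<Longrightarrow> c' \<in> charts X \<Longrightarrow> p \<in> fst c \<Longrightarrow> p \<in> fst c' \<Longrightarrow> Z c' p = cd c (snd c') p (Z c p)"
    using t by blast
qed

text \<open>A field that is constant in the chart \<open>c0\<close>, multiplied by a bump function,
  extends to a global one. The curvature is tested on global vector fields, so this is what
  determines it at a point.\<close>

lemma ex_vector_field:
  assumes c0: "c0 \<in> charts X" "p0 \<in> fst c0" and v: "P v = v"
  obtains Z where "Z \<in> vector_fields X" "Z c0 p0 = v"
proof -
  obtain H \<chi> N where "bump_data p0 c0 H \<chi> N" using ex_bump_data[OF c0] by blast
  then have H: "\<And>q. sm_at H q" "supp_in H (fst c0)" "H p0 = 1" by (auto simp: bump_data_def)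
  define Z where "Z c q = (if c \<in> charts X \<and> q \<in> fst c \<and> q \<in> fst c0 then H q *\<^sub>R cd c0 (snd c) q v else 0)" for c q
  have sm: "sm_at (Z c) q" if c: "c \<in> charts X" "q \<in> fst c" for c q
  proof (cases "q \<in> fst c0")
    case True
    have "sm_at (\<lambda>q. H q *\<^sub>R cd c0 (snd c) q v) q"
      by (intro sm_at_scaleR H sm_at_cd sm_at_chart_map c0 c True)
    then show ?thesis
      by (rule sm_at_cong[of _ _ "fst c \<inter> fst c0"]) (use c c0 True ch_open[of c] ch_open[of c0] in \<open>auto simp: Z_def\<close>)
  next
    case False
    then obtain V where "open V" "q \<in> V" "\<forall>q'\<in>V. H q' = 0" using H(2) unfolding supp_in_def by blast
    then show ?thesis by (intro sm_at_cong[OF sm_at_const[of 0], of V]) (auto simp: Z_def)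
  qed
  have "Z \<in> vector_fields X"
    unfolding vector_fields_def mem_Collect_eq
  proof (intro conjI allI ballI impI)
    show "Z c p = 0" if "c \<notin> charts X \<or> p \<notin> fst c" for c p using that by (auto simp: Z_def)
    show "P (Z c p) = Z c p" for c p
      using cd_chart_map_P[OF c0(1), of c p v] by (auto simp: Z_def linear_scale[OF linear_P] linear_0[OF linear_P])
    show "smooth_fun X (fst c) (Z c)" if "c \<in> charts X" for c
      using smooth_fun_iff[OF ch_open[OF that]] sm[OF that] by blast
    fix c c' p assume c: "c \<in> charts X" "c' \<in> charts X" "p \<in> fst c \<inter> fst c'"
    then have s': "sm_at (snd c') p" by (intro sm_at_chart_map) auto
    have lin: "linear (cd c (snd c') p)" using c by (intro cd_linear s') auto
    show "Z c' p = cd c (snd c') p (Z c p)"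
    proof (cases "p \<in> fst c0")
      case True
      have "cd c0 (snd c') p v = cd c (snd c') p (cd c0 (snd c) p v)"
        using c by (intro cd_chain s' c0 True) auto
      then show ?thesis using True c by (simp add: Z_def linear_scale[OF lin])
    next
      case False
      then show ?thesis by (simp add: Z_def linear_0[OF lin])
    qed
  qed
  moreover have "Z c0 p0 = v" using c0 H(3) v by (simp add: Z_def cd_chart_map_self)
  ultimately show ?thesis using that by blast
qed

lemma chart_at: "chart_at X p \<in> charts X" "p \<in> fst (chart_at X p)"
proof -
  have "\<exists>c. c \<in> charts X \<and> p \<in> fst c" using ex_chart by blast
  from someI_ex[OF this] show "chart_at X p \<in> charts X" "p \<in> fst (chart_at X p)"
    unfolding chart_at_def by blast+
qed

section \<open>Diagonal connections\<close>

abbreviation eval1 :: "(('a \<Rightarrow> complex) \<times> ('a \<Rightarrow> complex)) list \<Rightarrow> ('a, 'b) chart \<Rightarrow> 'a \<Rightarrow> 'b \<Rightarrow> complex" where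
  "eval1 B c p v \<equiv> \<Sum>x\<leftarrow>B. fst x p * cd c (snd x) p v"

text \<open>The connection d + diag(a_i) with a_i encoded by \<open>B i\<close>. The differential of
  the i-th entry is also written as a \<open>form1\<close>, with coefficient 1, so that both
  summands are covered by the same lemmas on tensoriality and smoothness. The restriction to
  sections matches the extensional function space in \<open>connection\<close>.\<close>

definition dconn :: "nat \<Rightarrow> (nat \<Rightarrow> (('a \<Rightarrow> complex) \<times> ('a \<Rightarrow> complex)) list) \<Rightarrow> ('a, 'b) conn" where
  "dconn n B = restrict (\<lambda>s c p vs. vec n (\<lambda>i. form1 [(\<lambda>q. 1, \<lambda>q. s q $ i)] c p vs + form1 (B i) c p vs * s p $ i))
     (sections X (product_bundle n))"

lemma sectionD:
  assumes "s \<in> sections X (product_bundle n)"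
  shows "s p \<in> carrier_vec n" "dim_vec (s p) = n" "i < n \<Longrightarrow> sm_at (\<lambda>q. s q $ i) p"
  using assms by (auto simp: sections_product_iff)

lemma smooth_pairs_entry: "s \<in> sections X (product_bundle n) \<Longrightarrow> i < n \<Longrightarrow> smooth_pairs [(\<lambda>q. 1, \<lambda>q. s q $ i)]"
  by (simp add: smooth_pairs_def sectionD)

lemma dconn_apply:
  "s \<in> sections X (product_bundle n) \<Longrightarrow>
    dconn n B s c p vs = vec n (\<lambda>i. form1 [(\<lambda>q. 1, \<lambda>q. s q $ i)] c p vs + form1 (B i) c p vs * s p $ i)"
  by (simp add: dconn_def)

lemma dconn_entry:
  assumes "s \<in> sections X (product_bundle n)" "c \<in> charts X" "p \<in> fst c" "i < n"
  shows "dconn n B s c p [v] $ i = cd c (\<lambda>q. s q $ i) p v + eval1 (B i) c p v * s p $ i"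
  using assms by (simp add: dconn_apply form1_def)

lemma dconn_vform:
  assumes B: "\<And>i. smooth_pairs (B i)" and s: "s \<in> sections X (product_bundle n)"
  shows "dconn n B s \<in> vforms X (product_bundle n) 1"
proof -
  let ?f = "\<lambda>i c p vs. form1 [(\<lambda>q. 1, \<lambda>q. s q $ i)] c p vs + form1 (B i) c p vs * s p $ i"
  have v: "(\<lambda>c p vs. ventry (dconn n B s c p vs) i) = (if i < n then ?f i else (\<lambda>c p vs. 0))" for i
    by (auto simp: dconn_apply[OF s] ventry_def fun_eq_iff)
  have t: "tensorial X (\<lambda>c p vs. ventry (dconn n B s c p vs) i)" for i
  proof (cases "i < n")
    case True
    then show ?thesis
      unfolding v using tensorial_add_scaled[OF tensorial_form1[OF smooth_pairs_entry[OF s True]] tensorial_form1[OF B]] by simp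
  qed (simp add: v tensorial_zero)
  have sm: "sm_at (\<lambda>q. ventry (dconn n B s c q vs) i) p" if c: "c \<in> charts X" "p \<in> fst c" for c p vs i
  proof (cases "i < n")
    case True
    have "sm_at (\<lambda>q. ?f i c q vs) p"
      by (intro sm_at_add sm_at_mult sm_at_form1 smooth_pairs_entry[OF s True] B c sectionD(3)[OF s True])
    then show ?thesis using True by (simp add: dconn_apply[OF s] ventry_def)
  qed (simp add: dconn_apply[OF s] ventry_def)
  have z: "dconn n B s c p vs = 0\<^sub>v n" if "length vs \<noteq> 1" for c p vs
    using that by (auto simp: dconn_apply[OF s] form1_def)
  have car: "dconn n B s c p vs \<in> carrier_vec n" for c p vs by (simp add: dconn_apply[OF s])
  show ?thesis unfolding vforms_product_iff using t sm z car by blast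
qed

lemma section_add:
  assumes s: "s \<in> sections X (product_bundle n)" "s' \<in> sections X (product_bundle n)"
  shows "(\<lambda>q. s q + s' q) \<in> sections X (product_bundle n)"
    and "i < n \<Longrightarrow> (\<lambda>q. (s q + s' q) $ i) = (\<lambda>q. s q $ i + s' q $ i)"
proof -
  show e: "i < n \<Longrightarrow> (\<lambda>q. (s q + s' q) $ i) = (\<lambda>q. s q $ i + s' q $ i)" for i
    using sectionD(2)[OF s(2)] by (simp add: fun_eq_iff)
  show "(\<lambda>q. s q + s' q) \<in> sections X (product_bundle n)"
    unfolding sections_product_iff
    by (intro conjI allI impI add_carrier_vec sectionD(1) s)
      (simp only: e, intro sm_at_add sectionD(3)[OF s(1)] sectionD(3)[OF s(2)])
qed

lemma section_smult:
  assumes s: "s \<in> sections X (product_bundle n)" and f: "\<And>p. sm_at f p"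
  shows "(\<lambda>q. f q \<cdot>\<^sub>v s q) \<in> sections X (product_bundle n)"
    and "i < n \<Longrightarrow> (\<lambda>q. (f q \<cdot>\<^sub>v s q) $ i) = (\<lambda>q. f q * s q $ i)"
proof -
  show e: "i < n \<Longrightarrow> (\<lambda>q. (f q \<cdot>\<^sub>v s q) $ i) = (\<lambda>q. f q * s q $ i)" for i
    using sectionD(2)[OF s] by (simp add: fun_eq_iff)
  show "(\<lambda>q. f q \<cdot>\<^sub>v s q) \<in> sections X (product_bundle n)"
    unfolding sections_product_iff
    by (intro conjI allI impI smult_carrier_vec[THEN iffD2] sectionD(1)[OF s])
      (simp only: e, intro sm_at_mult f sectionD(3)[OF s])
qed

lemma connection_dconn:
  assumes B: "\<And>i. smooth_pairs (B i)"
  shows "connection X (product_bundle n) (dconn n B)"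
  unfolding connection_def
proof (intro conjI ballI allI impI)
  show "dconn n B \<in> sections X (product_bundle n) \<rightarrow>\<^sub>E vforms X (product_bundle n) 1"
    using dconn_vform[OF B] by (auto simp: dconn_def)
next
  fix s s' c p vs assume s: "s \<in> sections X (product_bundle n)" "s' \<in> sections X (product_bundle n)"
  have f: "form1 [(\<lambda>q. 1, \<lambda>q. s q $ i + s' q $ i)] c p vs = form1 [(\<lambda>q. 1, \<lambda>q. s q $ i)] c p vs + form1 [(\<lambda>q. 1, \<lambda>q. s' q $ i)] c p vs"
    if "i < n" for i
    using that by (simp add: form1_def cd_add sectionD(3)[OF s(1)] sectionD(3)[OF s(2)])
  have "dconn n B (\<lambda>q. s q + s' q) c p vs $ i = (dconn n B s c p vs + dconn n B s' c p vs) $ i" if i: "i < n" for i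
  proof -
    have "dconn n B (\<lambda>q. s q + s' q) c p vs $ i
      = form1 [(\<lambda>q. 1, \<lambda>q. s q $ i + s' q $ i)] c p vs + form1 (B i) c p vs * (s p $ i + s' p $ i)"
      using i by (simp only: dconn_apply[OF section_add(1)[OF s]] index_vec section_add(2)[OF s i])
        (simp add: sectionD(2)[OF s(2)])
    then show ?thesis using i by (simp add: f dconn_apply s ring_distribs)
  qed
  then show "dconn n B (\<lambda>q. s q + s' q) c p vs = dconn n B s c p vs + dconn n B s' c p vs"
    by (intro eq_vecI) (simp_all add: dconn_apply section_add(1) s)
next
  fix f :: "'a \<Rightarrow> complex" and s c p v
  assume s: "s \<in> sections X (product_bundle n)" and f: "smooth_fun X UNIV f" and c: "c \<in> charts X" "p \<in> fst c"
  have f: "sm_at f q" for q using f by (simp add: smooth_fun_UNIV)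
  have "dconn n B (\<lambda>q. f q \<cdot>\<^sub>v s q) c p [v] $ i = (cd c f p v \<cdot>\<^sub>v s p + f p \<cdot>\<^sub>v dconn n B s c p [v]) $ i"
    if i: "i < n" for i
  proof -
    have "dconn n B (\<lambda>q. f q \<cdot>\<^sub>v s q) c p [v] $ i = cd c (\<lambda>q. f q * s q $ i) p v + eval1 (B i) c p v * (f p * s p $ i)"
      using i by (simp only: dconn_entry[OF section_smult(1)[OF s f] c i] section_smult(2)[OF s f i])
        (simp add: sectionD(2)[OF s])
    also have "cd c (\<lambda>q. f q * s q $ i) p v = f p * cd c (\<lambda>q. s q $ i) p v + cd c f p v * s p $ i"
      by (rule cd_mult[OF f sectionD(3)[OF s i] c])
    finally show ?thesis
      using i by (simp add: dconn_entry[OF s c i] sectionD(2)[OF s] dconn_apply[OF s] algebra_simps form1_def c)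
  qed
  then show "dconn n B (\<lambda>q. f q \<cdot>\<^sub>v s q) c p [v] = cd c f p v \<cdot>\<^sub>v s p + f p \<cdot>\<^sub>v dconn n B s c p [v]"
    by (intro eq_vecI) (simp_all add: dconn_apply s section_smult(1)[OF s f])
qed

section \<open>Curvature of a diagonal connection\<close>

lemma sm_at_cd_field:
  fixes f :: "'a \<Rightarrow> complex"
  assumes f: "\<And>q. sm_at f q" and Z: "sm_at Z p" and c: "c \<in> charts X" "p \<in> fst c"
  shows "sm_at (\<lambda>q. cd c f q (Z q)) p"
proof -
  have "sm_at (\<lambda>q. \<Sum>b\<in>Basis. (Z q \<bullet> b) *\<^sub>R cd c f q b) p"
    by (intro sm_at_sum sm_at_scaleR sm_at_cd[OF f c] sm_at_bounded_linear[OF bounded_linear_inner_left Z])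
  moreover have "(\<Sum>b\<in>Basis. (w \<bullet> b) *\<^sub>R cd c f q b) = cd c f q w" if "q \<in> fst c" for q w
    by (rule cd_expand[OF f c(1) that, symmetric])
  ultimately show ?thesis
    by (rule sm_at_cong[OF _ ch_open[OF c(1)] c(2)])
qed

lemma sm_at_eval1_field:
  assumes B: "smooth_pairs B" and Z: "sm_at Z p" and c: "c \<in> charts X" "p \<in> fst c"
  shows "sm_at (\<lambda>q. eval1 B c q (Z q)) p"
  by (intro sm_at_sum_list sm_at_mult sm_at_cd_field smooth_pairsD[OF B] Z c)

text \<open>Cartan's formula Y(a(Z)) - Z(a(Y)) = a([Y, Z]) + da(Y, Z) for a = \<Sum> u dg.\<close>

lemma eval1_commutator:
  assumes B: "smooth_pairs B" and Y: "sm_at Y p" and Z: "sm_at Z p" and c: "c \<in> charts X" "p \<in> fst c"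
  shows "cd c (\<lambda>q. eval1 B c q (Z q)) p (Y p) - cd c (\<lambda>q. eval1 B c q (Y q)) p (Z p)
    = eval1 B c p (cd c Z p (Y p) - cd c Y p (Z p))
      + (\<Sum>x\<leftarrow>B. cd c (fst x) p (Y p) * cd c (snd x) p (Z p) - cd c (fst x) p (Z p) * cd c (snd x) p (Y p))"
proof -
  have d: "cd c (\<lambda>q. eval1 B c q (W q)) p v
      = (\<Sum>x\<leftarrow>B. fst x p * cd c (\<lambda>q. cd c (snd x) q (W q)) p v + cd c (fst x) p v * cd c (snd x) p (W p))"
    if W: "sm_at W p" for W v
  proof -
    have "cd c (\<lambda>q. eval1 B c q (W q)) p v = (\<Sum>x\<leftarrow>B. cd c (\<lambda>q. fst x q * cd c (snd x) q (W q)) p v)"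
      by (intro cd_sum_list c sm_at_mult sm_at_cd_field smooth_pairsD[OF B] W)
    also have "\<dots> = (\<Sum>x\<leftarrow>B. fst x p * cd c (\<lambda>q. cd c (snd x) q (W q)) p v + cd c (fst x) p v * cd c (snd x) p (W p))"
      by (intro arg_cong[of _ _ sum_list] map_cong refl cd_mult sm_at_cd_field smooth_pairsD[OF B] W c)
    finally show ?thesis .
  qed
  show ?thesis
    unfolding d[OF Y] d[OF Z] sum_list_subtractf[symmetric] sum_list_addf[symmetric]
  proof (intro arg_cong[of _ _ sum_list] map_cong refl)
    fix x assume x: "x \<in> set B"
    have "fst x p * (cd c (\<lambda>q. cd c (snd x) q (Z q)) p (Y p) - cd c (\<lambda>q. cd c (snd x) q (Y q)) p (Z p))
        = fst x p * cd c (snd x) p (cd c Z p (Y p) - cd c Y p (Z p))"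
      by (subst cd_field_commutator[OF smooth_pairsD(2)[OF B x] Y Z c]) simp
    then show "fst x p * cd c (\<lambda>q. cd c (snd x) q (Z q)) p (Y p) + cd c (fst x) p (Y p) * cd c (snd x) p (Z p) -
         (fst x p * cd c (\<lambda>q. cd c (snd x) q (Y q)) p (Z p) + cd c (fst x) p (Z p) * cd c (snd x) p (Y p)) =
         fst x p * cd c (snd x) p (cd c Z p (Y p) - cd c Y p (Z p)) +
         (cd c (fst x) p (Y p) * cd c (snd x) p (Z p) - cd c (fst x) p (Z p) * cd c (snd x) p (Y p))"
      by (simp add: algebra_simps)
  qed
qed

text \<open>On a line bundle the curvature of d + a is da: the second derivatives of f give the
  bracket term, the products of a with df and the products a(Y) a(Z) f cancel, and Cartan's formula
  leaves da.\<close>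

lemma curvature_identity:
  fixes f :: "'a \<Rightarrow> complex"
  assumes f: "\<And>q. sm_at f q" and B: "smooth_pairs B"
    and Y: "sm_at Y p" and Z: "sm_at Z p" and c: "c \<in> charts X" "p \<in> fst c"
  defines "D W q \<equiv> cd c f q (W q) + eval1 B c q (W q) * f q"
  shows "cd c (D Z) p (Y p) + eval1 B c p (Y p) * D Z p - (cd c (D Y) p (Z p) + eval1 B c p (Z p) * D Y p)
      - (cd c f p (cd c Z p (Y p) - cd c Y p (Z p)) + eval1 B c p (cd c Z p (Y p) - cd c Y p (Z p)) * f p)
    = (\<Sum>x\<leftarrow>B. cd c (fst x) p (Y p) * cd c (snd x) p (Z p) - cd c (fst x) p (Z p) * cd c (snd x) p (Y p)) * f p"
proof -
  have d: "cd c (D W) p v = cd c (\<lambda>q. cd c f q (W q)) p v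
      + (eval1 B c p (W p) * cd c f p v + cd c (\<lambda>q. eval1 B c q (W q)) p v * f p)" if W: "sm_at W p" for W v
    unfolding D_def
    by (subst cd_add) (intro sm_at_cd_field sm_at_mult sm_at_eval1_field f B W c | subst cd_mult | rule refl)+
  have e: "(cd c (\<lambda>q. eval1 B c q (Z q)) p (Y p) - cd c (\<lambda>q. eval1 B c q (Y q)) p (Z p)) * f p
    = (eval1 B c p (cd c Z p (Y p) - cd c Y p (Z p))
      + (\<Sum>x\<leftarrow>B. cd c (fst x) p (Y p) * cd c (snd x) p (Z p) - cd c (fst x) p (Z p) * cd c (snd x) p (Y p))) * f p"
    by (simp only: eval1_commutator[OF B Y Z c])
  show ?thesis
    unfolding d[OF Y] d[OF Z]
    using e cd_field_commutator[OF f Y Z c] by (simp add: D_def algebra_simps)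
qed

text \<open>\<open>cov_deriv\<close> evaluates at p in the arbitrarily chosen chart
  \<open>chart_at X p\<close>. Tensoriality moves the value to any prescribed chart around
  p.\<close>

lemma cov_deriv_dconn:
  assumes B: "\<And>i. smooth_pairs (B i)" and Z: "Z \<in> vector_fields X" and s: "s \<in> sections X (product_bundle n)"
    and c: "c \<in> charts X" "p \<in> fst c" and i: "i < n"
  shows "cov_deriv X (dconn n B) Z s p $ i = cd c (\<lambda>q. s q $ i) p (Z c p) + eval1 (B i) c p (Z c p) * s p $ i"
proof -
  let ?c = "chart_at X p"
  have t: "form1 C ?c p [Z ?c p] = form1 C c p [Z c p]" if "smooth_pairs C" for C
  proof -
    have "form1 C ?c p [Z ?c p] = form1 C c p (map (cd ?c (snd c) p) [Z ?c p])"
      using tensorial_form1[OF that] c chart_at[of p] unfolding tensorial_def by blast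
    then show ?thesis using vector_fieldsD(2)[OF Z chart_at(1) c(1) chart_at(2) c(2)] by simp
  qed
  have "cov_deriv X (dconn n B) Z s p $ i
    = form1 [(\<lambda>q. 1, \<lambda>q. s q $ i)] ?c p [Z ?c p] + form1 (B i) ?c p [Z ?c p] * s p $ i"
    using i by (simp add: cov_deriv_def dconn_apply[OF s])
  also have "\<dots> = form1 [(\<lambda>q. 1, \<lambda>q. s q $ i)] c p [Z c p] + form1 (B i) c p [Z c p] * s p $ i"
    by (simp only: t[OF B] t[OF smooth_pairs_entry[OF s i]])
  finally show ?thesis using c by (simp add: form1_def)
qed

lemma cov_deriv_section:
  assumes B: "\<And>i. smooth_pairs (B i)" and Z: "Z \<in> vector_fields X" and s: "s \<in> sections X (product_bundle n)"
  shows "cov_deriv X (dconn n B) Z s \<in> sections X (product_bundle n)"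
  unfolding sections_product_iff
proof (intro conjI allI impI)
  show "cov_deriv X (dconn n B) Z s p \<in> carrier_vec n" for p by (simp add: cov_deriv_def dconn_apply[OF s])
  fix i p assume i: "i < n"
  obtain c where c: "c \<in> charts X" "p \<in> fst c" using ex_chart by blast
  note sm = sm_at_cd_field[OF sectionD(3)[OF s i] vector_fieldsD(1)[OF Z c] c]
  have "sm_at (\<lambda>q. cd c (\<lambda>q. s q $ i) q (Z c q) + eval1 (B i) c q (Z c q) * s q $ i) p"
    by (intro sm_at_add sm sm_at_mult sm_at_eval1_field B c sectionD(3)[OF s i] vector_fieldsD(1)[OF Z c])
  then show "sm_at (\<lambda>q. cov_deriv X (dconn n B) Z s q $ i) p"
    by (rule sm_at_cong[OF _ ch_open[OF c(1)] c(2)]) (simp add: cov_deriv_dconn[OF B Z s c(1) _ i])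
qed

lemma form2_vector_fields:
  assumes B: "smooth_pairs B" and Z: "Z \<in> vector_fields X" and W: "W \<in> vector_fields X"
    and c: "c \<in> charts X" "p \<in> fst c" and c': "c' \<in> charts X" "p \<in> fst c'"
  shows "form2 B c p [Z c p, W c p] = form2 B c' p [Z c' p, W c' p]"
proof -
  have "form2 B c p [Z c p, W c p] = form2 B c' p (map (cd c (snd c') p) [Z c p, W c p])"
    using tensorial_form2[OF B] c c' unfolding tensorial_def by blast
  then show ?thesis
    using vector_fieldsD(2)[OF Z c(1) c'(1) c(2) c'(2)] vector_fieldsD(2)[OF W c(1) c'(1) c(2) c'(2)] by simp
qed

lemma endforms_productD:
  assumes "R \<in> endforms X (product_bundle n) k"
  shows "R c p vs \<in> carrier_mat n n" "length vs \<noteq> k \<Longrightarrow> R c p vs = 0\<^sub>m n n"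
    "c \<notin> charts X \<or> p \<notin> fst c \<Longrightarrow> R c p vs = 0\<^sub>m n n"
    "c \<in> charts X \<Longrightarrow> p \<in> fst c \<Longrightarrow> R c p (map P vs) = R c p vs"
proof -
  have e: "\<forall>c p vs. R c p vs \<in> carrier_mat n n" "\<forall>c p vs. length vs \<noteq> k \<longrightarrow> R c p vs = 0\<^sub>m n n"
    "\<And>i j. tensorial X (\<lambda>c p vs. mentry (R c p vs) i j)"
    using assms unfolding endforms_def mem_Collect_eq product_bundle_simps by blast+
  show car: "R c p vs \<in> carrier_mat n n" for c p vs using e(1) by blast
  show "length vs \<noteq> k \<Longrightarrow> R c p vs = 0\<^sub>m n n" using e(2) by blast
  show "R c p vs = 0\<^sub>m n n" if "c \<notin> charts X \<or> p \<notin> fst c"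
  proof (rule mat_eq_mentryI[OF car zero_carrier_mat])
    fix i j
    have "(\<lambda>vs. mentry (R c p vs) i j) = (\<lambda>vs. 0)" using e(3)[of i j] that unfolding tensorial_def by blast
    then have "mentry (R c p vs) i j = 0" by (rule fun_cong)
    then show "mentry (R c p vs) i j = mentry (0\<^sub>m n n) i j" by (simp add: mentry_def)
  qed
  show "R c p (map P vs) = R c p vs" if "c \<in> charts X" "p \<in> fst c"
  proof (rule mat_eq_mentryI[OF car car])
    fix i j
    have "alternating_at X (\<lambda>vs. mentry (R c p vs) i j)" using e(3)[of i j] that unfolding tensorial_def by blast
    then show "mentry (R c p (map P vs)) i j = mentry (R c p vs) i j" unfolding alternating_at_def by (elim conjE) (erule allE[of _ vs])
  qed
qed

lemma mat_eq_on_unit_vecs: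
  assumes "A \<in> carrier_mat n n" "B \<in> carrier_mat n n" "\<And>j. j < n \<Longrightarrow> A *\<^sub>v unit_vec n j = B *\<^sub>v unit_vec n j"
  shows "A = (B :: complex mat)"
proof (rule eq_matI)
  fix i j assume ij: "i < dim_row B" "j < dim_col B"
  have "(A *\<^sub>v unit_vec n j) $ i = (B *\<^sub>v unit_vec n j) $ i" using assms(3)[of j] ij assms(2) by simp
  then show "A $$ (i, j) = B $$ (i, j)" using assms(1,2) ij by simp
qed (use assms in auto)

text \<open>The definite description needs existence and uniqueness. Two candidates agree because
  global fields with prescribed values at p and the constant sections \<open>unit_vec n j\<close>
  test every matrix entry. Invariance under P covers arguments outside the model space; for the
  wrong degree or outside the chart both candidates are 0.\<close>

lemma curvature_dconn:
  assumes B: "\<And>i. smooth_pairs (B i)"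
  shows "curvature X (product_bundle n) (dconn n B) = (\<lambda>c p vs. dmat n (\<lambda>i. form2 (B i) c p vs))"
  unfolding curvature_def
proof (rule the_equality)
  let ?R = "\<lambda>c p vs. dmat n (\<lambda>i. form2 (B i) c p vs)"
  let ?D = "dconn n B" and ?V = "product_bundle n :: 'a vbundle"
  let ?C = "\<lambda>Z W s p. cov_deriv X ?D Z (cov_deriv X ?D W s) p - cov_deriv X ?D W (cov_deriv X ?D Z s) p
    - cov_deriv X ?D (lie_bracket X Z W) s p"
  have R1: "?R \<in> endforms X ?V 2"
    by (rule diag_endform) (rule tensorial_form2[OF B], simp add: form2_def, rule sm_at_form2[OF B])
  have R2: "?R c p [Z c p, W c p] *\<^sub>v s p = ?C Z W s p"
    if Z: "Z \<in> vector_fields X" and W: "W \<in> vector_fields X" and s: "s \<in> sections X ?V"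
      and c: "c \<in> charts X" "p \<in> fst c" for Z W s c p
  proof (rule eq_vecI)
    let ?c = "chart_at X p"
    note c1 = chart_at[of p]
    have sW: "cov_deriv X ?D W s \<in> sections X ?V" and sZ: "cov_deriv X ?D Z s \<in> sections X ?V"
      by (rule cov_deriv_section[OF B _ s], fact)+
    have dims: "dim_vec (cov_deriv X ?D Y t p) = n" if "t \<in> sections X ?V" for Y t
      using that by (simp add: cov_deriv_def dconn_apply)
    show "dim_vec (?R c p [Z c p, W c p] *\<^sub>v s p) = dim_vec (?C Z W s p)"
      using dims[OF s] by (simp add: dmat_def)
    fix i assume "i < dim_vec (?C Z W s p)"
    then have i: "i < n" using dims[OF s] by simp
    note f = sectionD(3)[OF s i]
    let ?f = "\<lambda>q. s q $ i"
    let ?E = "\<lambda>Y q. cd ?c ?f q (Y ?c q) + eval1 (B i) ?c q (Y ?c q) * ?f q"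
    \<comment> \<open>The chart used by \<open>cov_deriv\<close> at q varies with q. Here the value
      is expressed in one chart for all q in its domain, so that the outer covariant derivative can
      differentiate it.\<close>
    have E: "cov_deriv X ?D Y s q $ i = ?E Y q" if "Y \<in> vector_fields X" "q \<in> fst ?c" for Y q
      by (rule cov_deriv_dconn[OF B that(1) s c1(1) that(2) i])
    have EE: "cov_deriv X ?D Y' (cov_deriv X ?D Y s) p $ i
        = cd ?c (?E Y) p (Y' ?c p) + eval1 (B i) ?c p (Y' ?c p) * ?E Y p"
      if Y: "Y \<in> vector_fields X" "Y' \<in> vector_fields X" for Y Y'
    proof -
      note t = cov_deriv_section[OF B Y(1) s]
      have "cd ?c (\<lambda>q. cov_deriv X ?D Y s q $ i) p (Y' ?c p) = cd ?c (?E Y) p (Y' ?c p)"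
        by (rule cd_cong[OF sectionD(3)[OF t i] c1 ch_open[OF c1(1)] c1(2)]) (rule E[OF Y(1)])
      then show ?thesis
        by (simp only: cov_deriv_dconn[OF B Y(2) t c1 i] E[OF Y(1) c1(2)])
    qed
    have L: "cov_deriv X ?D (lie_bracket X Z W) s p $ i
      = cd ?c ?f p (cd ?c (W ?c) p (Z ?c p) - cd ?c (Z ?c) p (W ?c p))
        + eval1 (B i) ?c p (cd ?c (W ?c) p (Z ?c p) - cd ?c (Z ?c) p (W ?c p)) * ?f p"
      unfolding cov_deriv_def dconn_entry[OF s c1 i] by (simp add: lie_bracket_def c1)
    have "(?R c p [Z c p, W c p] *\<^sub>v s p) $ i = form2 (B i) ?c p [Z ?c p, W ?c p] * ?f p"
      using i by (simp add: dmat_mult_vec[OF sectionD(1)[OF s]] form2_vector_fields[OF B Z W c c1])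
    also have "\<dots> = (\<Sum>x\<leftarrow>B i. cd ?c (fst x) p (Z ?c p) * cd ?c (snd x) p (W ?c p)
        - cd ?c (fst x) p (W ?c p) * cd ?c (snd x) p (Z ?c p)) * ?f p"
      using c1 by (simp add: form2_def)
    also have "\<dots> = cov_deriv X ?D Z (cov_deriv X ?D W s) p $ i - cov_deriv X ?D W (cov_deriv X ?D Z s) p $ i
        - cov_deriv X ?D (lie_bracket X Z W) s p $ i"
      unfolding EE[OF W Z] EE[OF Z W] L
      by (rule curvature_identity[OF f B vector_fieldsD(1)[OF Z c1] vector_fieldsD(1)[OF W c1] c1, symmetric])
    finally show "(?R c p [Z c p, W c p] *\<^sub>v s p) $ i = ?C Z W s p $ i"
      using i dims[OF s] dims[OF sZ] by simp
  qed
  show "?R \<in> endforms X ?V 2 \<and> (\<forall>Z\<in>vector_fields X. \<forall>W\<in>vector_fields X. \<forall>s\<in>sections X ?V. \<forall>c\<in>charts X. \<forall>p\<in>fst c.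
        ?R c p [Z c p, W c p] *\<^sub>v s p = ?C Z W s p)"
    using R1 R2 by blast
  fix R assume R: "R \<in> endforms X ?V 2 \<and> (\<forall>Z\<in>vector_fields X. \<forall>W\<in>vector_fields X. \<forall>s\<in>sections X ?V. \<forall>c\<in>charts X. \<forall>p\<in>fst c.
        R c p [Z c p, W c p] *\<^sub>v s p = ?C Z W s p)"
  then have Re: "R \<in> endforms X ?V 2" by blast
  show "R = ?R"
  proof (intro ext)
    fix c p and vs :: "'b list"
    show "R c p vs = ?R c p vs"
    proof (cases "c \<in> charts X \<and> p \<in> fst c \<and> length vs = 2")
      case False
      then have "R c p vs = 0\<^sub>m n n" "?R c p vs = 0\<^sub>m n n"
        using endforms_productD(2,3)[OF Re] endforms_productD(2,3)[OF R1] by blast+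
      then show ?thesis by simp
    next
      case True
      then obtain v w where vs: "vs = [v, w]" by (auto simp: length_Suc_conv numeral_2_eq_2)
      have c: "c \<in> charts X" "p \<in> fst c" using True by auto
      obtain Z where Z: "Z \<in> vector_fields X" "Z c p = P v" using ex_vector_field[OF c P_idem] by blast
      obtain W where W: "W \<in> vector_fields X" "W c p = P w" using ex_vector_field[OF c P_idem] by blast
      have "R c p [Z c p, W c p] = ?R c p [Z c p, W c p]"
      proof (rule mat_eq_on_unit_vecs[OF endforms_productD(1)[OF Re] endforms_productD(1)[OF R1]])
        fix j assume "j < n"
        have s: "(\<lambda>q. unit_vec n j) \<in> sections X ?V" by (rule const_section) simp
        from bspec[OF bspec[OF bspec[OF bspec[OF bspec[OF conjunct2[OF R] Z(1)] W(1)] s] c(1)] c(2)]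
          R2[OF Z(1) W(1) s c]
        show "R c p [Z c p, W c p] *\<^sub>v unit_vec n j = ?R c p [Z c p, W c p] *\<^sub>v unit_vec n j" by simp
      qed
      then have "R c p (map P vs) = ?R c p (map P vs)" by (simp add: vs Z W)
      then show ?thesis using endforms_productD(4)[OF Re c, of vs] endforms_productD(4)[OF R1 c, of vs] by simp
    qed
  qed
qed

end

section \<open>Isolating one degree by roots of unity and one term by time weights\<close>

section \<open>Sums over roots of unity\<close>

abbreviation root1 :: "nat \<Rightarrow> complex" where
  "root1 k \<equiv> exp (2 * of_real pi * \<i> / of_nat k)"

lemma sum_root_of_unity_powers:
  assumes "0 < l" "l \<le> k"
  defines "z \<equiv> root1 k"
  shows "(\<Sum>m<k. (z ^ m) ^ l) = (if l = k then of_nat k else 0)"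
proof -
  have k: "k > 0" using assms by simp
  have zl: "z ^ l = exp (2 * of_real pi * \<i> * of_nat l / of_nat k)" for l
    unfolding z_def exp_of_nat_mult[symmetric] by (simp add: mult_ac)
  have zk: "z ^ k = 1" unfolding zl using k by simp
  have sw: "(z ^ m) ^ l = (z ^ l) ^ m" for m by (simp add: power_mult[symmetric] mult.commute)
  show ?thesis
  proof (cases "l = k")
    case True
    then show ?thesis unfolding sw zk by (simp add: zk)
  next
    case False
    then have "\<not> k dvd l" using assms by (auto dest: dvd_imp_le)
    then have "z ^ l \<noteq> 1" unfolding zl using complex_root_unity_eq_1[of k l] k by simp
    moreover have "(z ^ l) ^ k = 1" using sw[of k] zk by simp
    ultimately show ?thesis unfolding sw using False by (simp add: geometric_sum)
  qed
qed

text \<open>The polynomial \<open>w = wgt K\<close> vanishes at \<open>0\<close> and is chosen such that, over \<open>[0, 1]\<close>,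
  \<open>\<integral> w' t\<^sup>K = 1\<close> and, if \<open>K > 0\<close>, \<open>\<integral> w t\<^sup>K\<^sup>-\<^sup>1 = 0\<close>.\<close>

definition wgt :: "nat \<Rightarrow> real \<Rightarrow> complex" where
  "wgt K t = of_real (real (K + 2) * t\<^sup>2 - real (K + 1) * t)"

definition wgt' :: "nat \<Rightarrow> real \<Rightarrow> complex" where
  "wgt' K t = of_real (2 * real (K + 2) * t - real (K + 1))"

text \<open>A triple (u, a, b) stores u for the time derivative of the connection form and a for its
  exterior derivative. Hence the first slots carry w' and 1, the second slots w and t: in the head
  for the summand with weight w, in the tail for those with weight t. The factor z of the connection
  form enters both slots.\<close>

definition block_line :: "complex \<Rightarrow> 'b triple \<Rightarrow> 'b triple list \<Rightarrow> real \<Rightarrow> 'b triple list" where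
  "block_line z x ls t = map (\<lambda>x. (z * fst x, sc z (fst (snd x)), snd (snd x)))
     ((wgt' (length ls) t * fst x, sc (wgt (length ls) t) (fst (snd x)), snd (snd x))
      # map (\<lambda>x. (fst x, sc (of_real t) (fst (snd x)), snd (snd x))) ls)"

lemma sum_sc: "(\<Sum>m\<in>A. sc (k m) g) = sc (\<Sum>m\<in>A. k m) g"
  by (induction A rule: infinite_finite_induct) (simp_all add: sc_add_left)

text \<open>Degree j is homogeneous of degree j + 1 in z, with one factor from the 1-form and j from
  the 2-forms. So j < K is removed by the sum over the roots and j > K by
  \<open>wedge1_wedge2_power_eq_0\<close>, while j = K is evaluated by
  \<open>wedge1_wedge2_power_top\<close>.\<close>

lemma block_line_sum:
  fixes ls :: "'b triple list"
  defines "K \<equiv> length ls"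
  defines "z \<equiv> root1 (Suc K)"
  shows "(\<Sum>m<Suc K. wedge1 (block_line (z ^ m) x ls t) ((wedge2 (block_line (z ^ m) x ls t) ^^ j) g))
    = (if j = K then sc (of_nat (Suc K)) (
          sc (wgt' K t * of_real t ^ K * fst x) (ext_mult (snd (snd x)) ((wedge2 ls ^^ K) g))
        + sc (of_nat K * wgt K t * of_real t ^ (K - 1))
            (wedge1 ls (ext_mult (fst (snd x)) (ext_mult (snd (snd x)) ((wedge2 ls ^^ (K - 1)) g))))) else 0)"
proof -
  define tl where "tl = map (\<lambda>x. (fst x, sc (of_real t) (fst (snd x)), snd (snd x))) ls"
  define B where "B = (wgt' K t * fst x, sc (wgt K t) (fst (snd x)), snd (snd x)) # tl"
  have len: "length tl = K" by (simp add: tl_def K_def)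
  have scale: "wedge1 (block_line (z ^ m) x ls t) ((wedge2 (block_line (z ^ m) x ls t) ^^ j) g)
      = sc ((z ^ m) ^ Suc j) (wedge1 B ((wedge2 B ^^ j) g))" for m
    unfolding block_line_def tl_def[symmetric] K_def[symmetric] B_def[symmetric]
    by (simp only: wedge1_scale wedge2_power_scale wedge1_sc sc_simps power_Suc) (simp only: mult.commute)
  have tot: "(\<Sum>m<Suc K. wedge1 (block_line (z ^ m) x ls t) ((wedge2 (block_line (z ^ m) x ls t) ^^ j) g))
      = sc (\<Sum>m<Suc K. (z ^ m) ^ Suc j) (wedge1 B ((wedge2 B ^^ j) g))"
    unfolding scale by (rule sum_sc)
  have t1: "wedge1 tl h = wedge1 ls h" for h
    using wedge1_scale[of 1 "\<lambda>x. sc (of_real t) (fst (snd x))" ls h] by (simp add: tl_def)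
  have t2: "(wedge2 tl ^^ i) h = sc (of_real t ^ i) ((wedge2 ls ^^ i) h)" for i h
    unfolding tl_def by (rule wedge2_power_scale)
  have rs: "(\<Sum>m<Suc K. (z ^ m) ^ Suc j) = (if j = K then of_nat (Suc K) else 0)" if "j \<le> K"
    using sum_root_of_unity_powers[of "Suc j" "Suc K"] that unfolding z_def by (simp only: Suc_inject) simp
  consider "j < K" | "j = K" | "j > K" by linarith
  then show ?thesis
  proof cases
    case 1
    then show ?thesis unfolding tot by (subst rs) simp_all
  next
    case 3
    then have "wedge1 B ((wedge2 B ^^ j) g) = 0"
      by (intro wedge1_wedge2_power_eq_0) (simp add: B_def len)
    then show ?thesis using 3 unfolding tot by simp
  next
    case 2
    have "wedge1 B ((wedge2 B ^^ K) g)
      = sc (of_nat K) (wedge1 tl (ext_mult (sc (wgt K t) (fst (snd x))) (ext_mult (snd (snd x)) ((wedge2 tl ^^ (K - 1)) g))))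
      + sc (wgt' K t * fst x) (ext_mult (snd (snd x)) ((wedge2 tl ^^ K) g))"
      using wedge1_wedge2_power_top[of "(wgt' K t * fst x, sc (wgt K t) (fst (snd x)), snd (snd x))" tl g]
      unfolding B_def len fst_conv snd_conv .
    also have "\<dots> = sc (of_nat K * wgt K t * of_real t ^ (K - 1))
            (wedge1 ls (ext_mult (fst (snd x)) (ext_mult (snd (snd x)) ((wedge2 ls ^^ (K - 1)) g))))
       + sc (wgt' K t * of_real t ^ K * fst x) (ext_mult (snd (snd x)) ((wedge2 ls ^^ K) g))"
      by (simp only: t1 t2 ext_mult_sc ext_mult_sc_left wedge1_sc sc_simps) (simp only: mult_ac)
    finally show ?thesis unfolding tot using rs by (simp only: 2 order_refl if_True simp_thms add.commute)
  qed
qed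

lemma wgt_integral:
  "((\<lambda>t. wgt' K t * of_real t ^ K * A + of_nat K * wgt K t * of_real t ^ (K - 1) * B) has_integral A) {0..1}"
proof -
  \<comment> \<open>An explicit antiderivative: its first coefficient rises from 0 to 1 over the
    unit interval, its second is 0 at both ends, so B drops out.\<close>
  define F where "F t = of_real (2 * t ^ (K + 2) - t ^ (K + 1)) * A + of_real (real K * (t ^ (K + 2) - t ^ (K + 1))) * B" for t :: real
  have d: "(F has_vector_derivative (wgt' K t * of_real t ^ K * A + of_nat K * wgt K t * of_real t ^ (K - 1) * B)) (at t within {0..1})" for t
  proof -
    have 1: "((\<lambda>t. 2 * t ^ (K + 2) - t ^ (K + 1)) has_real_derivative (2 * real (K + 2) * t - real (K + 1)) * t ^ K) (at t within {0..1})"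
      by (rule derivative_eq_intros refl)+ (simp add: algebra_simps)
    have 2: "((\<lambda>t. real K * (t ^ (K + 2) - t ^ (K + 1))) has_real_derivative real K * ((real (K + 2) * t\<^sup>2 - real (K + 1) * t) * t ^ (K - 1))) (at t within {0..1})"
      by (rule derivative_eq_intros refl)+ (cases K; simp add: algebra_simps power2_eq_square)
    have 3: "((\<lambda>t. of_real (h t)) has_vector_derivative complex_of_real h') (at t within {0..1})"
      if "(h has_real_derivative h') (at t within {0..1})" for h h' 
      using that by (simp add: has_real_derivative_iff_has_vector_derivative has_vector_derivative_of_real)
    have "(F has_vector_derivative (of_real ((2 * real (K + 2) * t - real (K + 1)) * t ^ K) * A
      + of_real (real K * ((real (K + 2) * t\<^sup>2 - real (K + 1) * t) * t ^ (K - 1))) * B)) (at t within {0..1})"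
      unfolding F_def
      by (intro has_vector_derivative_add has_vector_derivative_mult_left 3[OF 1] 3[OF 2])
    then show ?thesis by (simp only: wgt_def wgt'_def of_real_mult of_real_power of_real_of_nat_eq mult.assoc)
  qed
  have "((\<lambda>t. wgt' K t * of_real t ^ K * A + of_nat K * wgt K t * of_real t ^ (K - 1) * B) has_integral (F 1 - F 0)) {0..1}"
    by (rule fundamental_theorem_of_calculus) (simp, rule d)
  moreover have "F 1 - F 0 = A" by (simp add: F_def)
  ultimately show ?thesis by (simp only:)
qed

lemma sum_fun_apply: "(\<Sum>i\<in>A. f i) x = (\<Sum>i\<in>A. f i x :: complex)"
  by (induction A rule: infinite_finite_induct) simp_all

definition cs_coeff :: "nat \<Rightarrow> complex" where
  "cs_coeff j = 1 / fact j * (1 / (2 * of_real pi * \<i>)) ^ (j + 1)"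

lemma cs_coeff_nonzero: "cs_coeff j \<noteq> 0"
  by (simp add: cs_coeff_def)

text \<open>The first component of a pair in \<open>bl\<close> is the triple with weight \<open>wgt\<close>.\<close>

lemma blocks_integral:
  fixes bl :: "('b triple \<times> 'b triple list) list"
  shows "((\<lambda>t. \<Sum>j. cs_coeff j * (\<Sum>x\<leftarrow>bl. \<Sum>m<Suc (length (snd x)).
      wedge1 (block_line (root1 (Suc (length (snd x))) ^ m) (fst x) (snd x) t)
        ((wedge2 (block_line (root1 (Suc (length (snd x))) ^ m) (fst x) (snd x) t) ^^ j) g) vs))
    has_integral (\<Sum>x\<leftarrow>bl. cs_coeff (length (snd x)) * of_nat (Suc (length (snd x))) * fst (fst x)
      * ext_mult (snd (snd (fst x))) ((wedge2 (snd x) ^^ length (snd x)) g) vs)) {0..1}"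
proof -
  define A where "A x = fst (fst x) * ext_mult (snd (snd (fst x))) ((wedge2 (snd x) ^^ length (snd x)) g) vs"
    for x :: "'b triple \<times> 'b triple list"
  define B where "B x = wedge1 (snd x) (ext_mult (fst (snd (fst x))) (ext_mult (snd (snd (fst x)))
    ((wedge2 (snd x) ^^ (length (snd x) - 1)) g))) vs" for x :: "'b triple \<times> 'b triple list"
  define K where "K x = length (snd x)" for x :: "'b triple \<times> 'b triple list"
  define Y where "Y x t = of_nat (Suc (K x)) * (wgt' (K x) t * of_real t ^ K x * A x
    + of_nat (K x) * wgt (K x) t * of_real t ^ (K x - 1) * B x)" for x t
  define W where "W x t j = (\<lambda>m. wedge1 (block_line (root1 (Suc (K x)) ^ m) (fst x) (snd x) t)
        ((wedge2 (block_line (root1 (Suc (K x)) ^ m) (fst x) (snd x) t) ^^ j) g))" for x t j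
  have inner: "(\<Sum>m<Suc (K x). W x t j m vs) = (if j = K x then Y x t else 0)" for x j t
  proof -
    have "(\<Sum>m<Suc (K x). W x t j m vs) = (\<Sum>m<Suc (K x). W x t j m) vs" by (rule sum_fun_apply[symmetric])
    also have "(\<Sum>m<Suc (K x). W x t j m) = (if j = K x then sc (of_nat (Suc (K x))) (
          sc (wgt' (K x) t * of_real t ^ K x * fst (fst x)) (ext_mult (snd (snd (fst x))) ((wedge2 (snd x) ^^ K x) g))
        + sc (of_nat (K x) * wgt (K x) t * of_real t ^ (K x - 1))
            (wedge1 (snd x) (ext_mult (fst (snd (fst x))) (ext_mult (snd (snd (fst x))) ((wedge2 (snd x) ^^ (K x - 1)) g))))) else 0)"
      unfolding W_def K_def by (rule block_line_sum)
    also have "\<dots> vs = (if j = K x then Y x t else 0)"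
      by (simp add: Y_def A_def B_def sc_apply mult.assoc distrib_left flip: K_def)
    finally show ?thesis .
  qed
  \<comment> \<open>Each block contributes at the single index j = \<open>K x\<close>, so the series
    over j is a finite sum of series with one nonzero term.\<close>
  have "(\<lambda>j. cs_coeff j * (\<Sum>x\<leftarrow>bl. if j = K x then Y x t else 0)) sums (\<Sum>x\<leftarrow>bl. cs_coeff (K x) * Y x t)" for t
  proof (induction bl)
    case (Cons x bl)
    have "(\<lambda>j. if j = K x then cs_coeff (K x) * Y x t else 0) sums (cs_coeff (K x) * Y x t)"
      by (rule sums_single)
    moreover have "(\<lambda>j. if j = K x then cs_coeff (K x) * Y x t else 0) = (\<lambda>j. cs_coeff j * (if j = K x then Y x t else 0))"
      by (auto simp: fun_eq_iff)
    ultimately have "(\<lambda>j. cs_coeff j * (if j = K x then Y x t else 0)) sums (cs_coeff (K x) * Y x t)" by simp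
    from sums_add[OF this Cons] show ?case by (simp only: list.map sum_list.Cons distrib_left)
  qed simp
  then have eq: "(\<Sum>j. cs_coeff j * (\<Sum>x\<leftarrow>bl. if j = K x then Y x t else 0)) = (\<Sum>x\<leftarrow>bl. cs_coeff (K x) * Y x t)" for t
    by (simp only: sums_iff)
  have "((\<lambda>t. \<Sum>x\<leftarrow>bl. cs_coeff (K x) * Y x t) has_integral (\<Sum>x\<leftarrow>bl. cs_coeff (K x) * (of_nat (Suc (K x)) * A x))) {0..1}"
  proof (induction bl)
    case (Cons x bl)
    have "((\<lambda>t. cs_coeff (K x) * Y x t) has_integral cs_coeff (K x) * (of_nat (Suc (K x)) * A x)) {0..1}"
      unfolding Y_def by (intro has_integral_mult_right wgt_integral)
    from has_integral_add[OF this Cons] show ?case by (simp only: list.map sum_list.Cons)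
  qed simp
  then have "((\<lambda>t. \<Sum>j. cs_coeff j * (\<Sum>x\<leftarrow>bl. \<Sum>m<Suc (K x). W x t j m vs))
    has_integral (\<Sum>x\<leftarrow>bl. cs_coeff (K x) * (of_nat (Suc (K x)) * A x))) {0..1}"
    unfolding inner eq .
  then show ?thesis unfolding W_def A_def K_def by (simp only: mult.assoc)
qed

context corner_mfd
begin

section \<open>Chern-Simons forms of curves of sums of line bundle connections\<close>

section \<open>Curves of diagonal connections\<close>

text \<open>A list of quadruples \<open>(s, s', u, g)\<close> encodes the time-dependent 1-form \<open>\<Sum> s(t) u dg\<close>,
  where \<open>s'\<close> is the derivative of \<open>s\<close>.\<close>

type_synonym 'c tline = "((real \<Rightarrow> complex) \<times> (real \<Rightarrow> complex) \<times> ('c \<Rightarrow> complex) \<times> ('c \<Rightarrow> complex)) list"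

definition smooth_tline :: "'a tline \<Rightarrow> bool" where
  "smooth_tline l \<longleftrightarrow> (\<forall>(s, s', u, g)\<in>set l. Cinf UNIV s \<and> (\<forall>t. (s has_vector_derivative s' t) (at t))
     \<and> (\<forall>p. sm_at u p) \<and> (\<forall>p. sm_at g p))"

definition tpairs :: "'a tline \<Rightarrow> real \<Rightarrow> (('a \<Rightarrow> complex) \<times> ('a \<Rightarrow> complex)) list" where
  "tpairs l t = map (\<lambda>(s, s', u, g). (\<lambda>q. s t * u q, g)) l"

definition dpairs :: "'a tline \<Rightarrow> real \<Rightarrow> (('a \<Rightarrow> complex) \<times> ('a \<Rightarrow> complex)) list" where
  "dpairs l t = map (\<lambda>(s, s', u, g). (\<lambda>q. s' t * u q, g)) l"

text \<open>The data at p from which the integrand is built: \<open>wedge1\<close> of this list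
  multiplies by the time derivative of the connection form and \<open>wedge2\<close> by the
  curvature, as \<open>swedge_form1\<close> and \<open>swedge_form2\<close> show.\<close>

definition ttriples :: "'a tline \<Rightarrow> real \<Rightarrow> ('a, 'b) chart \<Rightarrow> 'a \<Rightarrow> 'b triple list" where
  "ttriples l t c p = map (\<lambda>(s, s', u, g). (s' t * u p, \<lambda>v. s t * cd c u p v, cd c g p)) l"

definition tcurve :: "nat \<Rightarrow> (nat \<Rightarrow> 'a tline) \<Rightarrow> real \<Rightarrow> ('a, 'b) conn" where
  "tcurve n L t = dconn n (\<lambda>i. tpairs (L i) t)"

lemma smooth_tlineD:
  assumes "smooth_tline l" "(s, s', u, g) \<in> set l"
  shows "Cinf UNIV s" "(s has_vector_derivative s' t) (at t)" "sm_at u p" "sm_at g p"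
  using assms unfolding smooth_tline_def by blast+

lemma smooth_pairs_tpairs: "smooth_tline l \<Longrightarrow> smooth_pairs (tpairs l t)"
  unfolding smooth_pairs_def tpairs_def by (auto intro!: sm_at_mult dest: smooth_tlineD)

lemma smooth_pairs_dpairs: "smooth_tline l \<Longrightarrow> smooth_pairs (dpairs l t)"
  unfolding smooth_pairs_def dpairs_def by (auto intro!: sm_at_mult dest: smooth_tlineD)

lemma connection_tcurve: "(\<And>i. smooth_tline (L i)) \<Longrightarrow> connection X (product_bundle n) (tcurve n L t)"
  unfolding tcurve_def by (intro connection_dconn smooth_pairs_tpairs)

lemma tcurve_entry:
  assumes "s \<in> sections X (product_bundle n)" "c \<in> charts X" "p \<in> fst c" "i < n"
  shows "tcurve n L t s c p [v] $ i
    = cd c (\<lambda>q. s q $ i) p v + (\<Sum>(f, f', u, g)\<leftarrow>L i. f t * (u p * cd c g p v)) * s p $ i"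
proof -
  have "eval1 (tpairs l t) c p v = (\<Sum>(f, f', u, g)\<leftarrow>l. f t * (u p * cd c g p v))" for l
    by (simp add: tpairs_def comp_def split_def mult.assoc)
  then show ?thesis by (simp add: tcurve_def dconn_entry[OF assms])
qed

lemma smooth_near_sum_list:
  "(\<And>x. x \<in> set xs \<Longrightarrow> smooth_near S (f x) y) \<Longrightarrow> smooth_near S (\<lambda>z. \<Sum>x\<leftarrow>xs. f x z) y"
  by (induction xs) (simp_all add: smooth_near_add)

lemma smooth_near_snd:
  fixes F :: "'b \<Rightarrow> complex"
  assumes "smooth_near S F y" "y \<in> S" "t \<in> T"
  shows "smooth_near (T \<times> S) (\<lambda>z. F (snd z)) (t :: real, y)"
proof (rule smooth_near_compose[where S' = S])
  show "smooth_near (T \<times> S) snd (t, y)"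
    using smooth_near_Cinf[OF open_UNIV UNIV_I Cinf_bounded_linear[OF bounded_linear_snd Cinf_id]] by blast
qed (use assms in auto)

lemma smooth_near_fst:
  fixes f :: "real \<Rightarrow> complex"
  assumes "Cinf UNIV f" "y \<in> S" "t \<in> T"
  shows "smooth_near (T \<times> S) (\<lambda>z. f (fst z)) (t, y :: 'b)"
  by (rule smooth_near_Cinf[OF open_UNIV UNIV_I])
    (rule Cinf_compose[OF Cinf_bounded_linear[OF bounded_linear_fst Cinf_id] assms(1)], simp)

text \<open>Every entry is a sum of products of functions of t alone and functions on the chart
  alone, whence joint smoothness.\<close>

lemma connection_curve_tcurve:
  assumes L: "\<And>i. smooth_tline (L i)"
  shows "connection_curve X (product_bundle n) (tcurve n L)"
proof -
  have main: "smooth_on_set ({0..1} \<times> ch_img c) (\<lambda>z. ventry (1\<^sub>m n *\<^sub>v tcurve n L (fst z) s c (ch_inv c (snd z)) [v]) i)"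
    if s: "s \<in> sections X (product_bundle n)" and c: "c \<in> charts X" for s c v i
    unfolding smooth_on_set_iff
  proof
    fix z :: "real \<times> 'b" assume z: "z \<in> {0..1} \<times> ch_img c"
    then obtain t p where z_eq: "z = (t, snd c p)" and t: "t \<in> {0..1}" and p: "p \<in> fst c" by auto
    have car: "tcurve n L t' s c' p' vs \<in> carrier_vec n" for t' c' p' vs by (simp add: tcurve_def dconn_apply[OF s])
    have e: "1\<^sub>m n *\<^sub>v tcurve n L t' s c' p' vs = tcurve n L t' s c' p' vs" for t' c' p' vs
      by (rule one_mult_mat_vec[OF car])
    have v: "ventry (tcurve n L t' s c' p' vs) i = (if i < n then tcurve n L t' s c' p' vs $ i else 0)" for t' c' p' vs
      using car[of t' c' p' vs] by (simp add: ventry_def)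
    show "smooth_near ({0..1} \<times> ch_img c) (\<lambda>z. ventry (1\<^sub>m n *\<^sub>v tcurve n L (fst z) s c (ch_inv c (snd z)) [v]) i) z"
    proof (cases "i < n")
      case False
      then show ?thesis by (simp add: e v)
    next
      case i: True
      have y: "snd c p \<in> ch_img c" using p by simp
      have sm: "smooth_near ({0..1} \<times> ch_img c) (\<lambda>z. F (ch_inv c (snd z))) (t, snd c p)" if "sm_at F p" for F :: "'a \<Rightarrow> complex"
        by (rule smooth_near_snd[OF sm_at_chart[OF that c p] y t])
      have "smooth_near ({0..1} \<times> ch_img c) (\<lambda>z. cd c (\<lambda>q. s q $ i) (ch_inv c (snd z)) v
        + (\<Sum>x\<leftarrow>L i. fst x (fst z) * (fst (snd (snd x)) (ch_inv c (snd z)) * cd c (snd (snd (snd x))) (ch_inv c (snd z)) v))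
          * s (ch_inv c (snd z)) $ i) (t, snd c p)"
      proof (intro smooth_near_add smooth_near_bilinear[OF bounded_bilinear_mult] smooth_near_sum_list)
        show "smooth_near ({0..1} \<times> ch_img c) (\<lambda>z. cd c (\<lambda>q. s q $ i) (ch_inv c (snd z)) v) (t, snd c p)"
          by (rule sm[OF sm_at_cd[OF sectionD(3)[OF s i] c p]])
        show "smooth_near ({0..1} \<times> ch_img c) (\<lambda>z. s (ch_inv c (snd z)) $ i) (t, snd c p)"
          by (rule sm[OF sectionD(3)[OF s i]])
        fix x assume "x \<in> set (L i)"
        then have x: "(fst x, fst (snd x), fst (snd (snd x)), snd (snd (snd x))) \<in> set (L i)" by simp
        show "smooth_near ({0..1} \<times> ch_img c) (\<lambda>z. fst x (fst z)) (t, snd c p)"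
          by (rule smooth_near_fst[OF smooth_tlineD(1)[OF L x] y t])
        show "smooth_near ({0..1} \<times> ch_img c) (\<lambda>z. fst (snd (snd x)) (ch_inv c (snd z))) (t, snd c p)"
          by (rule sm[OF smooth_tlineD(3)[OF L x]])
        show "smooth_near ({0..1} \<times> ch_img c) (\<lambda>z. cd c (snd (snd (snd x))) (ch_inv c (snd z)) v) (t, snd c p)"
          by (rule sm[OF sm_at_cd[OF smooth_tlineD(4)[OF L x] c p]])
      qed
      then show ?thesis
        unfolding z_eq
        by (rule smooth_near_cong[OF _ open_UNIV UNIV_I])
          (auto simp: e v i tcurve_entry[OF s c _ i] ch_inv_mem split_def c)
    qed
  qed
  show ?thesis
    unfolding connection_curve_def
  proof (intro conjI ballI)
    show "connection X (product_bundle n) (tcurve n L t)" for t by (rule connection_tcurve[OF L])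
    fix s c assume s: "s \<in> sections X (product_bundle n)" and c: "c \<in> charts X"
    obtain U \<phi> where c_eq: "c = (U, \<phi>)" by (cases c)
    show "case c of (U, \<phi>) \<Rightarrow> \<forall>(W, \<psi>)\<in>trivs (product_bundle n). \<forall>v i.
        smooth_on_set ({0..1} \<times> \<phi> ` (U \<inter> W))
          (\<lambda>(t, y). let p = inv_into U \<phi> y in ventry (\<psi> p *\<^sub>v tcurve n L t s (U, \<phi>) p [v]) i)"
      using main[OF s c] by (simp add: c_eq split_def Let_def)
  qed
qed

text \<open>As for the curvature, the constant sections \<open>unit_vec n j\<close> determine the
  endomorphism valued form. At the ends of the interval the derivatives are one-sided and still
  unique.\<close>

lemma curve_deriv_tcurve:
  assumes L: "\<And>i. smooth_tline (L i)" and t: "t \<in> {0..1}"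
  shows "curve_deriv X (product_bundle n) (tcurve n L) t = (\<lambda>c p vs. dmat n (\<lambda>i. form1 (dpairs (L i) t) c p vs))"
  unfolding curve_deriv_def
proof (rule the_equality)
  let ?A = "\<lambda>c p vs. dmat n (\<lambda>i. form1 (dpairs (L i) t) c p vs)"
  let ?V = "product_bundle n :: 'a vbundle"
  have A1: "?A \<in> endforms X ?V 1"
    by (rule diag_endform)
      (rule tensorial_form1[OF smooth_pairs_dpairs[OF L]], simp add: form1_def, rule sm_at_form1[OF smooth_pairs_dpairs[OF L]])
  have A2: "((\<lambda>u. tcurve n L u s c p [v] $ i) has_vector_derivative (?A c p [v] *\<^sub>v s p) $ i) (at t within {0..1})"
    if s: "s \<in> sections X ?V" and c: "c \<in> charts X" "p \<in> fst c" and i: "i < n" for s c p v i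
  proof -
    have e: "(\<Sum>(f, f', u, g)\<leftarrow>l. f r * (u p * cd c g p v)) = (\<Sum>x\<leftarrow>l. fst x r * (fst (snd (snd x)) p * cd c (snd (snd (snd x))) p v))" for l r
      by (simp add: split_def)
    have d: "((\<lambda>r. \<Sum>x\<leftarrow>l. fst x r * (fst (snd (snd x)) p * cd c (snd (snd (snd x))) p v)) has_vector_derivative
      (\<Sum>x\<leftarrow>l. fst (snd x) t * (fst (snd (snd x)) p * cd c (snd (snd (snd x))) p v))) (at t within {0..1})"
      if "smooth_tline l" for l
      using that
    proof (induction l)
      case (Cons x l)
      have "smooth_tline l" using Cons.prems by (simp add: smooth_tline_def)
      moreover have "(fst x has_vector_derivative fst (snd x) t) (at t within {0..1})"
        using smooth_tlineD(2)[OF Cons.prems, of "fst x" "fst (snd x)" "fst (snd (snd x))" "snd (snd (snd x))" t]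
        by (auto intro: has_vector_derivative_at_within)
      ultimately show ?case
        using Cons.IH by (simp, intro has_vector_derivative_add has_vector_derivative_mult_left)
    qed simp
    have "((\<lambda>r. cd c (\<lambda>q. s q $ i) p v + (\<Sum>(f, f', u, g)\<leftarrow>L i. f r * (u p * cd c g p v)) * s p $ i) has_vector_derivative
      (0 + (\<Sum>x\<leftarrow>L i. fst (snd x) t * (fst (snd (snd x)) p * cd c (snd (snd (snd x))) p v)) * s p $ i)) (at t within {0..1})"
      unfolding e by (intro has_vector_derivative_add has_vector_derivative_mult_left d L has_vector_derivative_const)
    moreover have "(?A c p [v] *\<^sub>v s p) $ i = (\<Sum>x\<leftarrow>L i. fst (snd x) t * (fst (snd (snd x)) p * cd c (snd (snd (snd x))) p v)) * s p $ i"
      using i c by (simp add: dmat_mult_vec[OF sectionD(1)[OF s]] form1_def dpairs_def comp_def split_def mult.assoc)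
    ultimately show ?thesis by (simp only: tcurve_entry[OF s c i] add_0_left)
  qed
  show "?A \<in> endforms X ?V 1 \<and> (\<forall>s\<in>sections X ?V. \<forall>c\<in>charts X. \<forall>p\<in>fst c. \<forall>v. \<forall>i<rk ?V p.
        ((\<lambda>u. tcurve n L u s c p [v] $ i) has_vector_derivative (?A c p [v] *\<^sub>v s p) $ i) (at t within {0..1}))"
    using A1 A2 by simp
  fix A assume A: "A \<in> endforms X ?V 1 \<and> (\<forall>s\<in>sections X ?V. \<forall>c\<in>charts X. \<forall>p\<in>fst c. \<forall>v. \<forall>i<rk ?V p.
        ((\<lambda>u. tcurve n L u s c p [v] $ i) has_vector_derivative (A c p [v] *\<^sub>v s p) $ i) (at t within {0..1}))"
  then have Ae: "A \<in> endforms X ?V 1" by blast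
  show "A = ?A"
  proof (intro ext)
    fix c p and vs :: "'b list"
    show "A c p vs = ?A c p vs"
    proof (cases "c \<in> charts X \<and> p \<in> fst c \<and> length vs = 1")
      case False
      then have "A c p vs = 0\<^sub>m n n" "?A c p vs = 0\<^sub>m n n"
        using endforms_productD(2,3)[OF Ae] endforms_productD(2,3)[OF A1] by blast+
      then show ?thesis by simp
    next
      case True
      then obtain v where vs: "vs = [v]" by (auto simp: length_Suc_conv)
      have c: "c \<in> charts X" "p \<in> fst c" using True by auto
      show ?thesis
        unfolding vs
      proof (rule mat_eq_on_unit_vecs[OF endforms_productD(1)[OF Ae] endforms_productD(1)[OF A1]])
        fix j assume j: "j < n"
        have s: "(\<lambda>q. unit_vec n j) \<in> sections X ?V" by (rule const_section) simp
        show "A c p [v] *\<^sub>v unit_vec n j = ?A c p [v] *\<^sub>v unit_vec n j"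
        proof (rule eq_vecI)
          fix i assume "i < dim_vec (?A c p [v] *\<^sub>v unit_vec n j)"
          then have i: "i < n" by (simp add: dmat_def)
          have "((\<lambda>u. tcurve n L u (\<lambda>q. unit_vec n j) c p [v] $ i) has_vector_derivative (A c p [v] *\<^sub>v unit_vec n j) $ i) (at t within {0..1})"
            using bspec[OF bspec[OF bspec[OF conjunct2[OF A] s] c(1)] c(2)] i by simp
          moreover have "at t within {0..1} \<noteq> bot"
            using t by (simp add: trivial_limit_within islimpt_Icc)
          ultimately show "(A c p [v] *\<^sub>v unit_vec n j) $ i = (?A c p [v] *\<^sub>v unit_vec n j) $ i"
            using vector_derivative_unique_within A2[OF s c i, of v] by blast
        qed (use endforms_productD(1)[OF Ae, of c p "[v]"] in \<open>simp add: dmat_def\<close>)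
      qed
    qed
  qed
qed

lemma ext_mult_eval1: "ext_mult (\<lambda>v. \<Sum>x\<leftarrow>xs. fst x * snd (snd x) v) g = wedge1 xs g"
proof (induction xs)
  case Nil
  have "(\<lambda>v. 0) = (0 :: 'c \<Rightarrow> complex)" by (simp add: fun_eq_iff)
  then show ?case by simp
next
  case (Cons x xs)
  have "(\<lambda>v. \<Sum>x\<leftarrow>x # xs. fst x * snd (snd x) v) = sc (fst x) (snd (snd x)) + (\<lambda>v. \<Sum>x\<leftarrow>xs. fst x * snd (snd x) v)"
    by (simp add: fun_eq_iff sc_def)
  then show ?case using Cons by (simp add: ext_mult_add_left ext_mult_sc_left)
qed

lemma swedge_form1:
  assumes "c \<in> charts X" "p \<in> fst c"
  shows "swedge (form1 (dpairs l t) c p) g = wedge1 (ttriples l t c p) g"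
proof
  fix vs
  have "swedge (form1 (dpairs l t) c p) g vs = ext_mult (\<lambda>v. \<Sum>x\<leftarrow>ttriples l t c p. fst x * snd (snd x) v) g vs"
    by (rule swedge_deg1) (use assms in \<open>simp add: form1_def dpairs_def ttriples_def comp_def split_def\<close>)
  then show "swedge (form1 (dpairs l t) c p) g vs = wedge1 (ttriples l t c p) g vs" by (simp add: ext_mult_eval1)
qed

lemma swedge_form2:
  assumes l: "smooth_tline l" and c: "c \<in> charts X" "p \<in> fst c"
  shows "swedge (form2 (tpairs l t) c p) = wedge2 (ttriples l t c p)"
proof (intro ext)
  fix g vs
  have d: "cd c (\<lambda>q. s t * u q) p v = s t * cd c u p v" if "(s, s', u, f) \<in> set l" for s s' u f v
    by (rule cd_bounded_linear[OF bounded_linear_mult_right smooth_tlineD(3)[OF l that] c])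
  show "swedge (form2 (tpairs l t) c p) g vs = wedge2 (ttriples l t c p) g vs"
  proof (rule swedge_deg2)
    fix ys :: "'b list"
    show "form2 (tpairs l t) c p ys = (if length ys = 2 then \<Sum>(u, a, b)\<leftarrow>ttriples l t c p. a (ys ! 0) * b (ys ! 1) - a (ys ! 1) * b (ys ! 0) else 0)"
      using c by (auto simp: form2_def tpairs_def ttriples_def comp_def split_def d algebra_simps intro!: arg_cong[of _ _ sum_list] map_cong)
  qed
qed

lemma swedge_zero_left: "swedge (\<lambda>vs. 0) g = (\<lambda>vs. 0)"
  by (rule ext) (rule swedge_zero)

lemma cs_integrand:
  assumes L: "\<And>i. smooth_tline (L i)" and t: "t \<in> {0..1}"
  shows "mat_trace (mwedge n (curve_deriv X (product_bundle n) (tcurve n L) t c p)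
       (mwedge_power n (curvature X (product_bundle n) (tcurve n L t) c p) j) vs)
    = (\<Sum>i<n. swedge (form1 (dpairs (L i) t) c p) ((swedge (form2 (tpairs (L i) t) c p) ^^ j) unit_form) vs)"
proof -
  have c: "curvature X (product_bundle n) (tcurve n L t) = (\<lambda>c p vs. dmat n (\<lambda>i. form2 (tpairs (L i) t) c p vs))"
    unfolding tcurve_def by (rule curvature_dconn[OF smooth_pairs_tpairs[OF L]])
  have p: "mwedge_power n (\<lambda>vs. dmat n (\<lambda>i. form2 (tpairs (L i) t) c p vs)) j
      = (\<lambda>vs. dmat n (\<lambda>i. (swedge (form2 (tpairs (L i) t) c p) ^^ j) unit_form vs))"
    by (rule ext) (rule mwedge_power_dmat)
  show ?thesis
    unfolding curve_deriv_tcurve[OF L t] c p mwedge_dmat mat_trace_dmat ..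
qed

lemma cs_tcurve:
  assumes L: "\<And>i. smooth_tline (L i)" and c: "c \<in> charts X" "p \<in> fst c"
  shows "cs X (product_bundle n) (tcurve n L) c p vs = integral {0..1} (\<lambda>t. \<Sum>j. cs_coeff j *
    (\<Sum>i<n. wedge1 (ttriples (L i) t c p) ((wedge2 (ttriples (L i) t c p) ^^ j) unit_form) vs))"
  unfolding cs_def
proof (rule integral_cong)
  fix t :: real assume t: "t \<in> {0..1}"
  show "(\<Sum>j. 1 / fact j * (1 / (2 * of_real pi * \<i>)) ^ (j + 1) *
     mat_trace (mwedge (rk (product_bundle n) p) (curve_deriv X (product_bundle n) (tcurve n L) t c p)
       (mwedge_power (rk (product_bundle n) p) (curvature X (product_bundle n) (tcurve n L t) c p) j) vs))
    = (\<Sum>j. cs_coeff j * (\<Sum>i<n. wedge1 (ttriples (L i) t c p) ((wedge2 (ttriples (L i) t c p) ^^ j) unit_form) vs))"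
    unfolding product_bundle_simps cs_integrand[OF L t] swedge_form1[OF c] swedge_form2[OF L c] cs_coeff_def ..
qed

lemma cs_tcurve_outside:
  assumes L: "\<And>i. smooth_tline (L i)" and c: "c \<notin> charts X \<or> p \<notin> fst c"
  shows "cs X (product_bundle n) (tcurve n L) c p vs = 0"
proof -
  have z: "form1 (dpairs (L i) t) c p = (\<lambda>vs. 0)" for i t using c by (auto simp: form1_def)
  have "cs X (product_bundle n) (tcurve n L) c p vs = integral {0..1} (\<lambda>t::real. 0)"
    unfolding cs_def
  proof (rule integral_cong)
    fix t :: real assume t: "t \<in> {0..1}"
    show "(\<Sum>j. 1 / fact j * (1 / (2 * of_real pi * \<i>)) ^ (j + 1) *
       mat_trace (mwedge (rk (product_bundle n) p) (curve_deriv X (product_bundle n) (tcurve n L) t c p)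
         (mwedge_power (rk (product_bundle n) p) (curvature X (product_bundle n) (tcurve n L t) c p) j) vs)) = 0"
      unfolding product_bundle_simps cs_integrand[OF L t] z swedge_zero_left by simp
  qed
  then show ?thesis by simp
qed

end

section \<open>The flat product connection and the realization of odd forms\<close>

section \<open>Product bundles as structured bundles\<close>

lemma one_in_GL: "1\<^sub>m n \<in> GL n"
  unfolding GL_def invertible_mat_def inverts_mat_def by (auto intro!: exI[of _ "1\<^sub>m n"])

text \<open>An equality and not just an isomorphism, as \<open>CS_hat\<close> demands of V \<oplus>
  F = H: with F of rank 0 the bundle H may be V itself.\<close>

lemma bundle_sum_product: "bundle_sum (product_bundle n) (product_bundle 0) = product_bundle n"
proof -
  have "four_block_mat (1\<^sub>m n) (0\<^sub>m n 0) (0\<^sub>m 0 n) (1\<^sub>m 0) = (1\<^sub>m n :: complex mat)"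
    by (rule eq_matI) auto
  then show ?thesis by (simp add: bundle_sum_def product_bundle_def)
qed

context corner_mfd
begin

lemma smooth_mat_const: "smooth_mat X W (\<lambda>p. A)"
proof -
  have "smooth_fun X W (\<lambda>p. k)" for k :: complex
  proof -
    have "smooth_fun X UNIV (\<lambda>p. k)" by (simp add: smooth_fun_UNIV)
    then show ?thesis
      by (auto simp: smooth_fun_def smooth_on_set_iff comp_def split: prod.splits)
  qed
  then show ?thesis by (simp add: smooth_mat_def)
qed

lemma product_vector_bundle: "vector_bundle X (product_bundle n)"
  by (simp add: vector_bundle_def one_in_GL minv_one smooth_mat_const)

lemma bundle_iso_one: "bundle_iso X (product_bundle n) (product_bundle n) (\<lambda>p. 1\<^sub>m n)"
  by (simp add: bundle_iso_def one_in_GL minv_one smooth_mat_const)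

lemma product_trivial_bundle: "trivial_bundle X (product_bundle n)"
  using product_vector_bundle bundle_iso_one by (auto simp: trivial_bundle_def)

lemma connection_apply_carrier:
  assumes "connection X (product_bundle n) D" "s \<in> sections X (product_bundle n)"
  shows "D s c p vs \<in> carrier_vec n"
proof -
  have "D s \<in> vforms X (product_bundle n) 1" using assms by (auto simp: connection_def)
  then show ?thesis unfolding vforms_product_iff by blast
qed

lemma push_connection_one:
  assumes "connection X (product_bundle n) D"
  shows "push_connection X (product_bundle n) (\<lambda>p. 1\<^sub>m n) D = D"
proof
  fix s
  show "push_connection X (product_bundle n) (\<lambda>p. 1\<^sub>m n) D s = D s"
  proof (cases "s \<in> sections X (product_bundle n)")
    case True
    have "(\<lambda>q. 1\<^sub>m n *\<^sub>v s q) = s" using sectionD(1)[OF True] by auto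
    moreover have "1\<^sub>m n *\<^sub>v D s c p vs = D s c p vs" for c p vs
      by (rule one_mult_mat_vec[OF connection_apply_carrier[OF assms True]])
    ultimately show ?thesis using True by (simp add: push_connection_def minv_one)
  next
    case False
    then show ?thesis using assms by (auto simp: push_connection_def connection_def PiE_def extensional_def)
  qed
qed

lemma connection_sum_rank_0:
  assumes D: "connection X (product_bundle n) D" and DF: "connection X (product_bundle 0) DF"
  shows "connection_sum X (product_bundle n) (product_bundle 0) D DF = D"
proof
  fix s
  show "connection_sum X (product_bundle n) (product_bundle 0) D DF s = D s"
  proof (cases "s \<in> sections X (product_bundle n)")
    case True
    have d: "vec_first (s q) n = s q" for q
      using sectionD(2)[OF True, of q] by (auto simp: vec_first_def)
    have "(\<lambda>q. vec_last (s q) 0) \<in> sections X (product_bundle 0)" by (simp add: sections_product_iff)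
    from connection_apply_carrier[OF DF this]
    have z: "DF (\<lambda>q. vec_last (s q) 0) c p vs \<in> carrier_vec 0" for c p vs .
    have "v @\<^sub>v w = v" if "w \<in> carrier_vec 0" for v w :: "complex vec"
      using that by (intro eq_vecI) auto
    from this[OF z] show ?thesis
      using True by (simp add: connection_sum_def bundle_sum_product d)
  next
    case False
    then show ?thesis
      using D by (auto simp: connection_sum_def bundle_sum_product connection_def PiE_def extensional_def)
  qed
qed

section \<open>The trivial connection is flat\<close>

text \<open>Chain rule along a path that may run in the boundary. The velocity comes from a local
  extension of the path in the chart; it lies in the model space because the path does, so the
  projection inside \<open>cd\<close> does not change it.\<close>

lemma path_chart_derivative:
  assumes x: "smooth_path X x" and c: "c \<in> charts X" "x t \<in> fst c" and t: "t \<in> {0..1}"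
    and f: "sm_at f (x t)"
  shows "((\<lambda>r. f (x r)) has_vector_derivative
    cd c f (x t) (vector_derivative (snd c \<circ> x) (at t within {0..1}))) (at t within {0..1})"
proof -
  have cont: "continuous_on {0..1} x" and sm: "smooth_on_set {r\<in>{0..1}. x r \<in> fst c} (snd c \<circ> x)"
    using x c(1) by (auto simp: smooth_path_def split: prod.splits)
  obtain O' where O': "open O'" "O' \<inter> {0..1} = x -` fst c \<inter> {0..1}"
    using cont ch_open[OF c(1)] unfolding continuous_on_open_invariant by (elim allE[of _ "fst c"]) auto
  then have tO: "t \<in> O'" using c t by blast
  have "smooth_near {r\<in>{0..1}. x r \<in> fst c} (snd c \<circ> x) t" using sm c t by (simp add: smooth_on_set_iff)
  then obtain W g where g: "open W" "t \<in> W" "Cinf W g" "\<forall>r\<in>{r\<in>{0..1}. x r \<in> fst c} \<inter> W. g r = (snd c \<circ> x) r"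
    unfolding smooth_near_def by (elim exE conjE)
  have "Ck_on (Suc 0) W g" using g(3) unfolding Cinf_def ..
  then obtain G where "\<forall>y\<in>W. (g has_derivative G y) (at y)" unfolding Ck_on.simps by (elim exE conjE)
  then have G: "(g has_derivative G t) (at t)" using g(2) ..
  let ?S = "{0..1} \<inter> (O' \<inter> W)"
  have S: "at t within {0..1} = at t within ?S"
    by (rule at_within_nhd[of t "O' \<inter> W"]) (use tO g O' in auto)
  have tS: "t \<in> ?S" using tO g t by simp
  have xS: "x r \<in> fst c" "g r = snd c (x r)" if "r \<in> ?S" for r
  proof -
    show "x r \<in> fst c" using O'(2) that by blast
    then show "g r = snd c (x r)" using g(4) that by simp
  qed
  have "(g has_derivative G t) (at t within ?S)" using G has_derivative_at_withinI by blast
  then have dx: "(snd c \<circ> x has_derivative G t) (at t within ?S)"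
  proof (rule has_derivative_transform[OF tS, rotated])
    show "(snd c \<circ> x) r = g r" if "r \<in> ?S" for r using xS(2)[OF that] by simp
  qed
  have lin: "linear (G t)" by (rule has_derivative_linear[OF dx])
  define v where "v = G t 1"
  have gv: "G t = (\<lambda>r. r *\<^sub>R v)"
  proof
    show "G t r = r *\<^sub>R v" for r using linear_scale[OF lin, of r 1] by (simp add: v_def)
  qed
  have dxv: "(snd c \<circ> x has_vector_derivative v) (at t within {0..1})"
    using dx by (simp add: has_vector_derivative_def gv S)
  have nb: "at t within {0..1} \<noteq> bot" using t by (simp add: trivial_limit_within islimpt_Icc)
  have vd: "vector_derivative (snd c \<circ> x) (at t within {0..1}) = v"
    by (rule vector_derivative_within[OF nb dxv])
  have "(P \<circ> (snd c \<circ> x) has_vector_derivative P v) (at t within ?S)"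
    using bounded_linear.has_vector_derivative[OF bounded_linear_P dxv] by (simp add: S comp_def)
  then have "(snd c \<circ> x has_vector_derivative P v) (at t within ?S)"
    unfolding has_vector_derivative_def
  proof (rule has_derivative_transform[OF tS, rotated])
    show "(snd c \<circ> x) r = (P \<circ> (snd c \<circ> x)) r" if "r \<in> ?S" for r using P_ch[OF c(1) xS(1)[OF that]] by simp
  qed
  then have Pv: "P v = v"
    unfolding S[symmetric] by (intro vector_derivative_unique_within[OF nb _ dxv])
  obtain A where A: "((\<lambda>y. f (ch_inv c y)) has_derivative A) (at (snd c (x t)) within ch_img c)"
    "\<And>w. cd c f (x t) w = A (P w)"
    using cd_has_derivative[OF f c] by metis
  have "((\<lambda>y. f (ch_inv c y)) \<circ> (snd c \<circ> x) has_derivative A \<circ> G t) (at t within ?S)"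
  proof (rule diff_chain_within[OF dx])
    show "((\<lambda>y. f (ch_inv c y)) has_derivative A) (at ((snd c \<circ> x) t) within (snd c \<circ> x) ` ?S)"
      unfolding comp_apply by (rule has_derivative_subset[OF A(1)]) (use xS in auto)
  qed
  then have "((\<lambda>r. f (x r)) has_derivative A \<circ> G t) (at t within ?S)"
  proof (rule has_derivative_transform[OF tS, rotated])
    show "f (x r) = ((\<lambda>y. f (ch_inv c y)) \<circ> (snd c \<circ> x)) r" if "r \<in> ?S" for r using ch_inv[OF c(1) xS(1)[OF that]] by simp
  qed
  moreover have "A \<circ> G t = (\<lambda>r. r *\<^sub>R A v)"
    using linear_scale[OF has_derivative_linear[OF A(1)]] by (simp add: gv fun_eq_iff)
  ultimately show ?thesis
    unfolding vd A(2) Pv by (simp add: has_vector_derivative_def S)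
qed

text \<open>For the product connection the chain rule identifies the sum in
  \<open>parallel_along\<close> with the derivative of the entries of \<Sum> f_j(t) e_j(x(t)). The
  entries of a parallel lift are therefore constant.\<close>

lemma flat_dconn_zero: "flat_connection X (product_bundle n) (dconn n (\<lambda>i. []))"
  unfolding flat_connection_def
proof (intro conjI allI impI)
  let ?D = "dconn n (\<lambda>i. [])" and ?V = "product_bundle n :: 'a vbundle"
  show "connection X ?V ?D" by (rule connection_dconn) (simp add: smooth_pairs_def)
  fix x \<sigma> assume a: "smooth_path X x \<and> x 0 = x 1 \<and> parallel_along X ?V ?D x \<sigma>"
  then have x: "smooth_path X x" and car: "\<And>t. t \<in> {0..1} \<Longrightarrow> \<sigma> t \<in> carrier_vec n"
    by (auto simp: parallel_along_def)
  have d: "((\<lambda>t. \<sigma> t $ i) has_vector_derivative 0) (at t0 within {0..1})" if i: "i < n" and t0: "t0 \<in> {0..1}" for i t0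
  proof -
    from a have "parallel_along X ?V ?D x \<sigma>" by blast
    from bspec[OF conjunct2[OF this[unfolded parallel_along_def]] t0]
    obtain \<epsilon> m e f f' where \<epsilon>: "\<epsilon> > 0" and e: "\<forall>j<m::nat. e j \<in> sections X ?V"
      and l: "\<forall>t\<in>{0..1}. \<bar>t - t0\<bar> < \<epsilon> \<longrightarrow>
           (\<forall>j<m. (f j has_vector_derivative f' j t) (at t within {0..1})) \<and>
           (\<forall>i<rk ?V (x t). \<sigma> t $ i = (\<Sum>j<m. f j t * e j (x t) $ i)) \<and>
           (\<forall>c\<in>charts X. x t \<in> fst c \<longrightarrow> (\<forall>i<rk ?V (x t).
              (\<Sum>j<m. f' j t * e j (x t) $ i + f j t *
                 ?D (e j) c (x t) [vector_derivative (snd c \<circ> x) (at t within {0..1})] $ i) = 0))"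
      by (elim exE conjE)
    have e: "\<And>j. j < m \<Longrightarrow> e j \<in> sections X ?V" using e by blast
    obtain c where c: "c \<in> charts X" "x t0 \<in> fst c" using ex_chart by blast
    let ?v = "vector_derivative (snd c \<circ> x) (at t0 within {0..1})"
    have ff: "(f j has_vector_derivative f' j t0) (at t0 within {0..1})" if "j < m" for j
      using l t0 \<epsilon> that by simp
    have "((\<lambda>t. \<Sum>j<m. f j t * e j (x t) $ i) has_vector_derivative
      (\<Sum>j<m. f j t0 * cd c (\<lambda>q. e j q $ i) (x t0) ?v + f' j t0 * e j (x t0) $ i)) (at t0 within {0..1})"
      by (intro has_vector_derivative_sum has_vector_derivative_mult ff path_chart_derivative[OF x c t0] sectionD(3)[OF e i]) simp_all
    moreover have "(\<Sum>j<m. f j t0 * cd c (\<lambda>q. e j q $ i) (x t0) ?v + f' j t0 * e j (x t0) $ i)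
        = (\<Sum>j<m. f' j t0 * e j (x t0) $ i + f j t0 * ?D (e j) c (x t0) [?v] $ i)"
      by (rule sum.cong) (simp_all add: dconn_entry[OF e c i])
    moreover have "\<dots> = 0"
      using l t0 \<epsilon> c i by simp
    ultimately have "((\<lambda>t. \<Sum>j<m. f j t * e j (x t) $ i) has_vector_derivative 0) (at t0 within {0..1})" by simp
    then show ?thesis
      unfolding has_vector_derivative_def
      by (rule has_derivative_transform_within[OF _ \<epsilon> t0]) (use l i in \<open>simp add: dist_real_def\<close>)
  qed
  show "\<sigma> 0 = \<sigma> 1"
  proof (rule eq_vecI)
    show "dim_vec (\<sigma> 0) = dim_vec (\<sigma> 1)" using car[of 0] car[of 1] by simp
    fix i assume "i < dim_vec (\<sigma> 1)"
    then have i: "i < n" using car[of 1] by simp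
    obtain k where "\<And>t. t \<in> {0..1} \<Longrightarrow> \<sigma> t $ i = k"
      using has_vector_derivative_zero_constant[of "{0..1}" "\<lambda>t. \<sigma> t $ i"] d[OF i] by auto
    from this[of 0] this[of 1] show "\<sigma> 0 $ i = \<sigma> 1 $ i" by simp
  qed
qed

section \<open>Realizing odd forms\<close>

lemma zero_form_exact: "zero_form \<in> exact_odd_forms X"
proof -
  have "smooth_fun X (fst c) (\<lambda>p. 0 :: complex)" if "c \<in> charts X" for c
    using smooth_fun_iff[OF ch_open[OF that], of "\<lambda>p. 0 :: complex"] by simp
  then have e: "zero_form \<in> even_forms X"
    unfolding even_forms_def forms_def mem_Collect_eq zero_form_def using tensorial_zero by blast
  have "ext_deriv X zero_form = zero_form"
    by (intro ext) (simp add: ext_deriv_def zero_form_def)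
  then show ?thesis
    unfolding exact_odd_forms_def by (intro image_eqI[OF _ e]) simp
qed

lemma add_zero_form: "add_form \<omega> zero_form = \<omega>"
  by (simp add: add_form_def zero_form_def)

text \<open>The map to GL(0) suffices, because traces of empty matrices are 0. This makes every odd
  form equivalent to itself in the quotient.\<close>

lemma zero_form_GL: "zero_form \<in> GL_forms X"
proof -
  have "mat_trace (mwedge_power 0 \<Phi> (2 * Suc j - 1) vs) = 0" for \<Phi> j and vs :: "'b list"
    by (simp add: mat_trace_def mwedge_def)
  then have "pullback_Theta X 0 (\<lambda>p. 1\<^sub>m 0) = zero_form"
    by (auto simp: pullback_Theta_def zero_form_def fun_eq_iff)
  moreover have "smooth_GL_map X 0 (\<lambda>p. 1\<^sub>m 0)"
    by (simp add: smooth_GL_map_def one_in_GL smooth_mat_const)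
  moreover have "zero_form = add_form zero_form zero_form" by (simp add: add_zero_form)
  ultimately show ?thesis
    unfolding GL_forms_def mem_Collect_eq using zero_form_exact
    by (intro exI[of _ 0] exI[of _ "\<lambda>p. 1\<^sub>m 0"] exI[of _ zero_form]) simp
qed

text \<open>Different lists may encode the same form: at time 0 the lists of the curve are not
  empty, but all weights vanish. This identifies the start of the curve with the product
  connection.\<close>

lemma dconn_cong: "(\<And>i. i < n \<Longrightarrow> form1 (B i) = form1 (B' i)) \<Longrightarrow> dconn n B = dconn n B'"
  unfolding dconn_def by (intro arg_cong2[of _ _ _ _ restrict] ext eq_vecI refl) simp_all

text \<open>The constant curve, obtained by freezing all weights at \<open>t0\<close> and setting
  their derivatives to 0, has vanishing Chern-Simons form. It places a connection in its own
  class.\<close>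

lemma zero_form_CS_self:
  assumes L: "\<And>i. smooth_tline (L i)"
  shows "zero_form \<in> CS X (product_bundle n) (tcurve n L t0) (tcurve n L t0)"
proof -
  define L' where "L' i = map (\<lambda>(s, s', u, g). (\<lambda>t::real. s t0, \<lambda>t::real. 0 :: complex, u, g)) (L i)" for i
  have L': "smooth_tline (L' i)" for i
    using L[of i] by (auto simp: L'_def smooth_tline_def)
  have const: "tcurve n L' t = tcurve n L t0" for t
    by (simp add: tcurve_def L'_def tpairs_def comp_def split_def)
  have z: "wedge1 (ttriples (L' i) t c p) g = 0" for i t c p g
  proof -
    have w: "wedge1 xs g = 0" if "\<And>x. x \<in> set xs \<Longrightarrow> fst x = 0" for xs :: "'b triple list"
      using that by (induction xs) simp_all
    show ?thesis by (rule w) (auto simp: L'_def ttriples_def)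
  qed
  have "cs X (product_bundle n) (tcurve n L') c p vs = 0" for c p vs
  proof (cases "c \<in> charts X \<and> p \<in> fst c")
    case True
    then show ?thesis by (simp add: cs_tcurve[OF L'] z)
  next
    case False
    then show ?thesis by (intro cs_tcurve_outside[OF L']) auto
  qed
  then have "cs X (product_bundle n) (tcurve n L') = zero_form"
    by (intro ext) (simp add: zero_form_def)
  then have "zero_form = add_form (cs X (product_bundle n) (tcurve n L')) zero_form"
    by (simp add: add_zero_form)
  then show ?thesis
    unfolding CS_def mem_Collect_eq
    using connection_curve_tcurve[where L = L' and n = n, OF L'] const zero_form_exact
    by (intro exI[of _ "tcurve n L'"] exI[of _ zero_form]) simp
qed

end

text \<open>Applied to the differentials after the first one; their number is even, so that the last
  equation, which drops a single leftover, only ends the list.\<close>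

fun pair_up :: "'c list \<Rightarrow> ('c \<times> 'c) list" where
  "pair_up (a # b # xs) = (a, b) # pair_up xs"
| "pair_up _ = []"

lemma decomposable_pair_up:
  "even (length as) \<Longrightarrow> decomposable (map h as)
    = foldr (\<lambda>x g. ext_mult (h (fst x)) (ext_mult (h (snd x)) g)) (pair_up as) unit_form"
  by (induction as rule: pair_up.induct) simp_all

lemma set_pair_up: "x \<in> set (pair_up as) \<Longrightarrow> fst x \<in> set as \<and> snd x \<in> set as"
  by (induction as rule: pair_up.induct) auto

context corner_mfd
begin

text \<open>For a term \<open>u dg\<^sub>1 \<and> (da\<^sub>1 \<and> db\<^sub>1) \<and> \<dots> \<and> (da\<^sub>K \<and> db\<^sub>K)\<close>, the line bundle connections
  \<open>d + z (w(t) u dg\<^sub>1 + t \<Sum> a\<^sub>i db\<^sub>i)\<close>, where \<open>z\<close> runs through the roots of unity of order \<open>K + 1\<close>.\<close>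

definition term_line :: "('a \<Rightarrow> complex) \<times> ('a \<Rightarrow> complex) list \<Rightarrow> nat \<Rightarrow> 'a tline" where
  "term_line x m = (let ps = pair_up (tl (snd x)); K = length ps; z = root1 (Suc K) ^ m in
     (wgt K, wgt' K, \<lambda>q. z * (fst x q / (cs_coeff K * of_nat (Suc K) * fact K)), hd (snd x))
     # map (\<lambda>y. (of_real, \<lambda>t. 1, \<lambda>q. z * fst y q, snd y)) ps)"

text \<open>The input of \<open>blocks_integral\<close> at a point. The coefficient is divided in
  advance by the constants that the construction produces: the Chern-Simons coefficient, the number
  K + 1 of roots, and the factorial from the K-th power of a sum of K decomposable 2-forms.\<close>

definition term_block :: "('a \<Rightarrow> complex) \<times> ('a \<Rightarrow> complex) list \<Rightarrow> ('a, 'b) chart \<Rightarrow> 'a \<Rightarrow> 'b triple \<times> 'b triple list" where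
  "term_block x c p = (let ps = pair_up (tl (snd x)); K = length ps;
     u = (\<lambda>q. fst x q / (cs_coeff K * of_nat (Suc K) * fact K)) in
     ((u p, cd c u p, cd c (hd (snd x)) p), map (\<lambda>y. (fst y p, cd c (fst y) p, cd c (snd y) p)) ps))"

lemma Cinf_of_real: "Cinf W (complex_of_real)"
  by (rule Cinf_bounded_linear[OF bounded_linear_of_real Cinf_id])

lemma Cinf_wgt: "Cinf W (wgt K)"
proof -
  have "Cinf W (\<lambda>t. complex_of_real (real (K + 2) * (t * t) + (- real (K + 1)) * t))"
    by (intro Cinf_bounded_linear[OF bounded_linear_of_real] Cinf_add Cinf_bilinear[OF bounded_bilinear_mult] Cinf_const Cinf_id)
  moreover have "wgt K = (\<lambda>t. complex_of_real (real (K + 2) * (t * t) + (- real (K + 1)) * t))"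
    by (simp add: wgt_def fun_eq_iff power2_eq_square algebra_simps)
  ultimately show ?thesis by simp
qed

lemma wgt_deriv: "(wgt K has_vector_derivative wgt' K t) (at t)"
proof -
  have "((\<lambda>t. real (K + 2) * t\<^sup>2 - real (K + 1) * t) has_real_derivative (2 * real (K + 2) * t - real (K + 1))) (at t)"
    by (rule derivative_eq_intros refl)+ simp
  then have "((\<lambda>t. complex_of_real (real (K + 2) * t\<^sup>2 - real (K + 1) * t)) has_vector_derivative
      complex_of_real (2 * real (K + 2) * t - real (K + 1))) (at t)"
    by (intro has_vector_derivative_of_real) (simp add: has_real_derivative_iff_has_vector_derivative)
  then show ?thesis unfolding wgt_def[abs_def] wgt'_def .
qed

lemma smooth_term_line:
  assumes u: "\<And>p. sm_at (fst x) p" and gs: "\<And>g p. g \<in> set (snd x) \<Longrightarrow> sm_at g p" and odd: "odd (length (snd x))"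
  shows "smooth_tline (term_line x m)"
proof -
  obtain g gs' where x: "snd x = g # gs'" using odd by (cases "snd x") auto
  have ps: "sm_at (fst y) p \<and> sm_at (snd y) p" if "y \<in> set (pair_up gs')" for y p
    using set_pair_up[OF that] gs by (simp add: x)
  have d: "(complex_of_real has_vector_derivative 1) (at t)" for t
    using has_vector_derivative_of_real[OF DERIV_ident, of "at t"] by simp
  show ?thesis
    unfolding smooth_tline_def term_line_def Let_def
    using ps gs[of g]
    by (auto simp: x Cinf_wgt wgt_deriv Cinf_of_real d intro!: sm_at_mult u sm_at_bounded_linear[OF bounded_linear_divide])
qed

lemma ttriples_term_line:
  assumes u: "\<And>p. sm_at (fst x) p" and gs: "\<And>g p. g \<in> set (snd x) \<Longrightarrow> sm_at g p" and odd: "odd (length (snd x))"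
    and c: "c \<in> charts X" "p \<in> fst c"
  shows "ttriples (term_line x m) t c p
    = block_line (root1 (Suc (length (snd (term_block x c p)))) ^ m)
        (fst (term_block x c p)) (snd (term_block x c p)) t"
proof -
  obtain g gs' where x: "snd x = g # gs'" using odd by (cases "snd x") auto
  have ps: "sm_at (fst y) p" if "y \<in> set (pair_up gs')" for y
    using set_pair_up[OF that] gs by (simp add: x)
  have cm: "cd c (\<lambda>q. z * h q) p v = z * cd c h p v" if "sm_at h p" for z :: complex and h :: "'a \<Rightarrow> complex" and v
    by (rule cd_bounded_linear[OF bounded_linear_mult_right that c])
  have su: "sm_at (\<lambda>q. fst x q / k) p" for k by (rule sm_at_bounded_linear[OF bounded_linear_divide u])
  have head: "(wgt' K t * (z * (fst x p / k)), \<lambda>v. wgt K t * cd c (\<lambda>q. z * (fst x q / k)) p v, cd c g p)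
      = (z * (wgt' K t * (fst x p / k)), sc z (sc (wgt K t) (cd c (\<lambda>q. fst x q / k) p)), cd c g p)" for z k K
    by (simp only: cm[OF su]) (simp add: sc_def mult_ac fun_eq_iff)
  have tail: "map (\<lambda>y. (1 * (z * fst y p), \<lambda>v. of_real t * cd c (\<lambda>q. z * fst y q) p v, cd c (snd y) p)) (pair_up gs')
      = map (\<lambda>y. (z * fst y p, sc z (sc (of_real t) (cd c (fst y) p)), cd c (snd y) p)) (pair_up gs')" for z
    by (intro map_cong refl) (simp add: cm[OF ps] sc_def mult_ac fun_eq_iff)
  show ?thesis
    unfolding ttriples_def term_line_def term_block_def block_line_def Let_def
    by (simp only: x list.sel list.map map_map comp_def prod.case fst_conv snd_conv length_map head tail)
qed

text \<open>\<open>wedge2_power_length\<close> supplies the factor K!; together with the two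
  explicit factors it cancels the divisor in the coefficient, and the original monomial is
  left.\<close>

lemma term_block_value:
  assumes odd: "odd (length (snd x))"
  shows "cs_coeff (length (snd (term_block x c p))) * of_nat (Suc (length (snd (term_block x c p)))) * fst (fst (term_block x c p))
      * ext_mult (snd (snd (fst (term_block x c p)))) ((wedge2 (snd (term_block x c p)) ^^ length (snd (term_block x c p))) unit_form) vs
    = fst x p * decomposable (map (\<lambda>g. cd c g p) (snd x)) vs"
proof -
  obtain g gs' where x: "snd x = g # gs'" using odd by (cases "snd x") auto
  have ev: "even (length gs')" using odd by (simp add: x)
  let ?K = "length (pair_up gs')" and ?tr = "map (\<lambda>y. (fst y p, cd c (fst y) p, cd c (snd y) p)) (pair_up gs')"
  have "(wedge2 ?tr ^^ ?K) unit_form = sc (fact ?K) (decomposable (map (\<lambda>g. cd c g p) gs'))"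
    using wedge2_power_length[of ?tr unit_form] decomposable_pair_up[OF ev, of "\<lambda>g. cd c g p"]
    by (simp add: foldr_map comp_def)
  moreover have "(fact ?K :: complex) \<noteq> 0" "(of_nat (Suc ?K) :: complex) \<noteq> 0" by (simp_all del: of_nat_Suc)
  ultimately show ?thesis
    using cs_coeff_nonzero[of ?K]
    by (simp add: term_block_def Let_def x ext_mult_sc sc_apply field_simps del: of_nat_Suc)
qed

text \<open>The trace is additive over the diagonal, so the lines for all monomials and all roots of
  unity are listed as the entries of one product bundle of rank n, and their contributions add up to
  \<omega>.\<close>

lemma odd_form_is_cs:
  assumes "compact (UNIV :: 'a set)" and \<omega>: "\<omega> \<in> odd_forms X"
  obtains n L where "\<And>i. smooth_tline (L i)" "\<And>i. form1 (tpairs (L i) 0) = form1 []" "cs X (product_bundle n) (tcurve n L) = \<omega>"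
proof -
  obtain ts where ts: "\<forall>t\<in>set ts. (\<forall>p. sm_at (fst t) p) \<and> (\<forall>g\<in>set (snd t). \<forall>p. sm_at g p) \<and> odd (length (snd t))"
    "\<forall>c\<in>charts X. \<forall>p\<in>fst c. \<forall>vs. \<omega> c p vs = (\<Sum>t\<leftarrow>ts. fst t p * decomposable (map (\<lambda>g. cd c g p) (snd t)) vs)"
    using odd_form_decomposition[OF assms] by (elim exE conjE)
  have ts1: "\<And>p. sm_at (fst x) p" "\<And>g p. g \<in> set (snd x) \<Longrightarrow> sm_at g p" "odd (length (snd x))" if "x \<in> set ts" for x
    using ts(1) that by blast+
  define K where "K x = length (pair_up (tl (snd x)))" for x :: "('a \<Rightarrow> complex) \<times> ('a \<Rightarrow> complex) list"
  define lines where "lines = concat (map (\<lambda>x. map (term_line x) [0..<Suc (K x)]) ts)"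
  define n where "n = length lines"
  \<comment> \<open>Indices beyond the rank get the empty line, so that smoothness holds for all i,
    as the lemmas on \<open>tcurve\<close> require.\<close>
  define L where "L i = (if i < n then lines ! i else [])" for i
  have lines: "\<exists>x m. x \<in> set ts \<and> l = term_line x m" if "l \<in> set lines" for l
    using that by (auto simp: lines_def simp del: upt_Suc)
  have L_cases: "L i = [] \<or> (\<exists>x m. x \<in> set ts \<and> L i = term_line x m)" for i
    using lines[of "lines ! i"] by (auto simp: L_def n_def)
  have sm: "smooth_tline (L i)" for i
    using L_cases[of i] smooth_term_line[OF ts1] by (auto simp: smooth_tline_def[of "[]"])
  have z: "form1 (tpairs (L i) 0) = form1 []" for i
  proof -
    have "fst y p = 0" if "y \<in> set (tpairs (L i) 0)" for y p
      using L_cases[of i] that by (auto simp: tpairs_def term_line_def Let_def wgt_def)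
    then have "(\<Sum>y\<leftarrow>tpairs (L i) 0. fst y p * h y) = 0" for p h
      by (simp cong: map_cong)
    then show ?thesis by (simp add: form1_def fun_eq_iff)
  qed
  have sum_lines: "(\<Sum>i<n. F (L i)) = (\<Sum>x\<leftarrow>ts. \<Sum>m<Suc (K x). F (term_line x m))" for F :: "'a tline \<Rightarrow> complex"
  proof -
    have conc: "(\<Sum>t\<leftarrow>concat xss. F t) = (\<Sum>xs\<leftarrow>xss. \<Sum>t\<leftarrow>xs. F t)" for xss
      by (induction xss) simp_all
    have "(\<Sum>i<n. F (L i)) = (\<Sum>i<n. F (lines ! i))" by (simp add: L_def)
    also have "\<dots> = (\<Sum>l\<leftarrow>lines. F l)" by (simp add: n_def sum_list_sum_nth atLeast0LessThan)
    also have "\<dots> = (\<Sum>x\<leftarrow>ts. \<Sum>m<Suc (K x). F (term_line x m))"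
      unfolding lines_def conc map_map comp_def
      by (simp only: interv_sum_list_conv_sum_set_nat set_upt atLeast0LessThan)
    finally show ?thesis .
  qed
  have "cs X (product_bundle n) (tcurve n L) c p vs = \<omega> c p vs" for c p vs
  proof (cases "c \<in> charts X \<and> p \<in> fst c")
    case False
    then show ?thesis using cs_tcurve_outside[where L = L and n = n, OF sm] odd_forms_props(4)[OF \<omega>] by simp
  next
    case True
    then have c: "c \<in> charts X" "p \<in> fst c" by auto
    let ?B = "\<lambda>x. term_block x c p"
    have KB: "K x = length (snd (?B x))" for x by (simp add: K_def term_block_def Let_def)
    let ?W = "\<lambda>b m j t. wedge1 (block_line (root1 (Suc (length (snd b))) ^ m) (fst b) (snd b) t)
        ((wedge2 (block_line (root1 (Suc (length (snd b))) ^ m) (fst b) (snd b) t) ^^ j) unit_form) vs"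
    have tt: "(\<Sum>x\<leftarrow>ts. \<Sum>m<Suc (K x). wedge1 (ttriples (term_line x m) t c p) ((wedge2 (ttriples (term_line x m) t c p) ^^ j) unit_form) vs)
      = (\<Sum>b\<leftarrow>map ?B ts. \<Sum>m<Suc (length (snd b)). ?W b m j t)" for j t
      unfolding map_map comp_def
    proof (intro arg_cong[of _ _ sum_list] map_cong refl)
      fix x assume x: "x \<in> set ts"
      show "(\<Sum>m<Suc (K x). wedge1 (ttriples (term_line x m) t c p) ((wedge2 (ttriples (term_line x m) t c p) ^^ j) unit_form) vs)
        = (\<Sum>m<Suc (length (snd (?B x))). ?W (?B x) m j t)"
        by (simp only: ttriples_term_line[OF ts1[OF x] c] KB)
    qed
    have sl: "(\<Sum>i<n. wedge1 (ttriples (L i) t c p) ((wedge2 (ttriples (L i) t c p) ^^ j) unit_form) vs)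
      = (\<Sum>b\<leftarrow>map ?B ts. \<Sum>m<Suc (length (snd b)). ?W b m j t)" for j t
      unfolding tt[symmetric] by (rule sum_lines)
    have "cs X (product_bundle n) (tcurve n L) c p vs
      = integral {0..1} (\<lambda>t. \<Sum>j. cs_coeff j * (\<Sum>b\<leftarrow>map ?B ts. \<Sum>m<Suc (length (snd b)). ?W b m j t))"
      unfolding cs_tcurve[where L = L and n = n, OF sm c] sl ..
    also have "\<dots> = (\<Sum>b\<leftarrow>map ?B ts. cs_coeff (length (snd b)) * of_nat (Suc (length (snd b))) * fst (fst b)
      * ext_mult (snd (snd (fst b))) ((wedge2 (snd b) ^^ length (snd b)) unit_form) vs)"
      by (rule integral_unique[OF blocks_integral])
    also have "\<dots> = (\<Sum>x\<leftarrow>ts. fst x p * decomposable (map (\<lambda>g. cd c g p) (snd x)) vs)"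
      unfolding map_map comp_def
      by (intro arg_cong[of _ _ sum_list] map_cong refl term_block_value ts1(3))
    also have "\<dots> = \<omega> c p vs" using ts(2) c by simp
    finally show ?thesis .
  qed
  then have "cs X (product_bundle n) (tcurve n L) = \<omega>" by (intro ext)
  with sm z that show ?thesis by blast
qed

text \<open>V is a product bundle with the end point of the curve as connection, F has rank 0, and H
  = V carries the product connection at which the curve starts. So this very curve computes
  CS(\<nabla>^H, \<nabla> \<oplus> \<nabla>^F).\<close>

lemma odd_form_in_image:
  assumes "compact (UNIV :: 'a set)" and \<omega>: "\<omega> \<in> odd_forms X" and \<kappa>: "\<kappa> \<in> odd_forms_mod_GL X" "\<omega> \<in> \<kappa>"
  shows "\<exists>\<V>. (\<V>, \<kappa>) \<in> CS_hat X"
proof -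
  obtain n L where L: "\<And>i. smooth_tline (L i)" and z: "\<And>i. form1 (tpairs (L i) 0) = form1 []"
    and cs: "cs X (product_bundle n) (tcurve n L) = \<omega>"
    using odd_form_is_cs[OF assms(1,2)] by metis
  let ?V = "product_bundle n :: 'a vbundle" and ?F = "product_bundle 0 :: 'a vbundle"
  define D where "D = tcurve n L 1"
  define C where "C = conn_class X ?V D"
  have D: "connection X ?V D" unfolding D_def by (rule connection_tcurve[OF L])
  have DC: "D \<in> C"
    using D zero_form_CS_self[where L = L and n = n, OF L, of 1] by (simp add: C_def conn_class_def D_def)
  have sb: "(?V, C) \<in> structured_bundles X"
    using D product_vector_bundle by (auto simp: structured_bundles_def C_def)
  \<comment> \<open>The identity isomorphism fixes every connection, which puts the structured
    bundle into its own isomorphism class.\<close>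
  have "push_connection X ?V (\<lambda>p. 1\<^sub>m n) ` C = C"
    using push_connection_one by (force simp: C_def conn_class_def image_iff)
  then have refl: "((?V, C), (?V, C)) \<in> structured_iso X"
    unfolding structured_iso_def using sb bundle_iso_one by blast
  define \<V> where "\<V> = structured_iso X `` {(?V, C)}"
  have V1: "(?V, C) \<in> \<V>" using refl by (simp add: \<V>_def)
  have V2: "\<V> \<in> Struct X" unfolding Struct_def \<V>_def by (rule quotientI[OF sb])
  have "stably_trivial X ?V"
    unfolding stably_trivial_def using product_trivial_bundle bundle_sum_product by metis
  then have V3: "\<V> \<in> Struct_ST X" unfolding Struct_ST_def using V1 V2 by blast
  have flat: "flat_connection X ?F (dconn 0 (\<lambda>i. []))" "flat_connection X ?V (dconn n (\<lambda>i. []))"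
    by (rule flat_dconn_zero)+
  have sum: "connection_sum X ?V ?F D (dconn 0 (\<lambda>i. [])) = D"
    using flat(1) by (intro connection_sum_rank_0[OF D]) (simp add: flat_connection_def)
  have "tcurve n L 0 = dconn n (\<lambda>i. [])" unfolding tcurve_def by (rule dconn_cong) (rule z)
  then have "\<omega> \<in> CS X ?V (dconn n (\<lambda>i. [])) D"
    unfolding CS_def mem_Collect_eq
    using connection_curve_tcurve[where L = L and n = n, OF L] zero_form_exact cs
    by (intro exI[of _ "tcurve n L"] exI[of _ zero_form]) (simp add: add_zero_form D_def)
  then have "\<omega> \<in> CS X ?V (dconn n (\<lambda>i. [])) (connection_sum X ?V ?F D (dconn 0 (\<lambda>i. [])))"
    by (simp only: sum)
  then have "\<exists>V C D F DF H DH \<omega>. (V, C) \<in> \<V> \<and> D \<in> C \<and>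
        trivial_bundle X F \<and> trivial_bundle X H \<and> bundle_sum V F = H \<and>
        flat_connection X F DF \<and> flat_connection X H DH \<and>
        \<omega> \<in> CS X H DH (connection_sum X V F D DF) \<and> \<omega> \<in> \<kappa>"
    using V1 DC product_trivial_bundle bundle_sum_product flat \<kappa>(2) by blast
  then have "(\<V>, \<kappa>) \<in> CS_hat X" unfolding CS_hat_def using V3 \<kappa>(1) by blast
  then show ?thesis by blast
qed

lemma CS_hat_surjective:
  assumes "compact (UNIV :: 'a set)"
  shows "CS_hat X `` Struct_ST X = odd_forms_mod_GL X"
proof
  show "CS_hat X `` Struct_ST X \<subseteq> odd_forms_mod_GL X" by (auto simp: CS_hat_def)
  show "odd_forms_mod_GL X \<subseteq> CS_hat X `` Struct_ST X"
  proof
    fix \<kappa> assume \<kappa>: "\<kappa> \<in> odd_forms_mod_GL X"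
    then obtain \<omega> where \<omega>: "\<omega> \<in> odd_forms X"
      "\<kappa> = {(\<omega>, \<omega>'). \<omega> \<in> odd_forms X \<and> \<omega>' \<in> odd_forms X \<and> diff_form \<omega>' \<omega> \<in> GL_forms X} `` {\<omega>}"
      unfolding odd_forms_mod_GL_def by (rule quotientE)
    have "diff_form \<omega> \<omega> = zero_form" by (simp add: diff_form_def zero_form_def)
    \<comment> \<open>A class contains the form that generates it because 0 lies in
      \<open>GL_forms\<close>.\<close>
    then have "\<omega> \<in> \<kappa>" using \<omega> zero_form_GL by simp
    from odd_form_in_image[OF assms \<omega>(1) \<kappa> this] obtain \<V> where V: "(\<V>, \<kappa>) \<in> CS_hat X" by blast
    moreover have "\<V> \<in> Struct_ST X" using V by (simp add: CS_hat_def)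
    ultimately show "\<kappa> \<in> CS_hat X `` Struct_ST X" by blast
  qed
qed

end

theorem proposition2p6:
  fixes X :: "('a::{t2_space, second_countable_topology}, 'b::euclidean_space) corner_manifold"
  assumes "manifold_with_corners X"
    and "compact (UNIV :: 'a set)"
  shows "CS_hat X `` Struct_ST X = odd_forms_mod_GL X"
proof -
  interpret corner_mfd X by standard (rule assms(1))
  show ?thesis by (rule CS_hat_surjective[OF assms(2)])
qed

end
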